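(* Let $\Lambda_\infty=(r_0=0,r_1,r_2,\dots)$ be a sequence of real numbers with $0<r_1<r_2<\cdots$ and $\lim_{n\to\infty} r_n=\infty$. Let $[a,b]\subset\,]0,\infty[$ with $a<b$, let $n\ge 1$, and let $P\in E(\Lambda_n)$ be a non-constant $\mathbb{R}^s$-valued element ($s\ge1$). Then the sequence of control polygons $\bigl(\eta_0(P,\Lambda_m,[a,b]),\dots,\eta_m(P,\Lambda_m,[a,b])\bigr)_{m\ge n}$ generated by dimension elevation converges uniformly to the curve $P$ on $[a,b]$ (in the sense defined in the context) if and only if $$\sum_{i=1}^{\infty}\frac{1}{r_i}=\infty .$$
   Context: For a sequence $0=r_0<r_1<r_2<\cdots$ of reals, write $\Lambda_n=(r_0,\dots,r_n)$ and $E(\Lambda_n)=\mathrm{span}(t^{r_0}=1,t^{r_1},\dots,t^{r_n})$ (functions on $]0,\infty[$); an $\mathbb{R}^s$-valued element of $E(\Lambda_n)$ is a map $t\mapsto\sum_{k=0}^n t^{r_k}A_k$ with $A_k\in\mathbb{R}^s$. Note $E(\Lambda_n)\subset E(\Lambda_m)$ for $m\ge n$. For an interval $[a,b]$ with $0<a<b$, the Chebyshev–Bernstein basis $(B^n_{0,\Lambda_n},\dots,B^n_{n,\Lambda_n})$ of $E(\Lambda_n)$ over $[a,b]$ is the unique basis of $E(\Lambda_n)$ with $\sum_{k=0}^n B^n_{k,\Lambda_n}\equiv 1$ such that, for each $k$, $B^n_{k,\Lambda_n}$ has a zero of multiplicity (exactly) $k$ at $a$ and of multiplicity $n-k$ at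 $b$. For $P\in E(\Lambda_n)$ and $m\ge n$, the control points $\eta_i(P,\Lambda_m,[a,b])\in\mathbb{R}^s$, $i=0,\dots,m$, are defined by $P(t)=\sum_{i=0}^m B^m_{i,\Lambda_m}(t)\,\eta_i(P,\Lambda_m,[a,b])$. Uniform convergence of the control polygons to $P$ on $[a,b]$ means: there exist parameters $a=t^m_0\le t^m_1\le\dots\le t^m_m=b$ such that $\max_i |t^m_{i+1}-t^m_i|\to0$ and $\max_{0\le i\le m}\|P(t^m_i)-\eta_i(P,\Lambda_m,[a,b])\|_\infty\to 0$ as $m\to\infty$. *)

theory Defs
  imports "HOL-Analysis.Analysis"
begin

text \<open>Elements of E(Lambda_n): real functions t \<mapsto> sum_{k<=n} c_k t^{r_k}
  (the formula is taken literally on all reals; only t > 0 is relevant).\<close>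
definition inE :: "(nat \<Rightarrow> real) \<Rightarrow> nat \<Rightarrow> (real \<Rightarrow> real) \<Rightarrow> bool" where
  "inE r n f \<longleftrightarrow> (\<exists>c::nat \<Rightarrow> real. f = (\<lambda>t. \<Sum>k\<le>n. c k * t powr r k))"

definition inEv :: "(nat \<Rightarrow> real) \<Rightarrow> nat \<Rightarrow> (real \<Rightarrow> real^'s) \<Rightarrow> bool" where
  "inEv r n P \<longleftrightarrow> (\<exists>A::nat \<Rightarrow> real^'s. \<forall>t>0. P t = (\<Sum>k\<le>n. t powr r k *\<^sub>R A k))"

definition zero_mult :: "(real \<Rightarrow> real) \<Rightarrow> real \<Rightarrow> nat \<Rightarrow> bool" where
  "zero_mult f x k \<longleftrightarrow> (\<forall>j<k. (deriv ^^ j) f x = 0) \<and> (deriv ^^ k) f x \<noteq> 0"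

definition CB_basis :: "(nat \<Rightarrow> real) \<Rightarrow> real \<Rightarrow> real \<Rightarrow> nat \<Rightarrow> nat \<Rightarrow> real \<Rightarrow> real" where
  "CB_basis r a b m = (THE B. (\<forall>k\<le>m. inE r m (B k) \<and> zero_mult (B k) a k \<and> zero_mult (B k) b (m - k))
       \<and> (\<forall>t>0. (\<Sum>k\<le>m. B k t) = 1) \<and> (\<forall>k>m. B k = (\<lambda>_. 0)))"

definition ctrl_pts :: "(nat \<Rightarrow> real) \<Rightarrow> real \<Rightarrow> real \<Rightarrow> nat \<Rightarrow> (real \<Rightarrow> real^'s) \<Rightarrow> nat \<Rightarrow> real^'s" where
  "ctrl_pts r a b m P = (THE \<eta>. (\<forall>t>0. P t = (\<Sum>i\<le>m. CB_basis r a b m i t *\<^sub>R \<eta> i))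
       \<and> (\<forall>i>m. \<eta> i = 0))"

definition ctrl_poly_unif_conv :: "(nat \<Rightarrow> real) \<Rightarrow> real \<Rightarrow> real \<Rightarrow> nat \<Rightarrow> (real \<Rightarrow> real^'s) \<Rightarrow> bool" where
  "ctrl_poly_unif_conv r a b n P \<longleftrightarrow>
     (\<exists>T :: nat \<Rightarrow> nat \<Rightarrow> real.
        (\<forall>m\<ge>n. T m 0 = a \<and> T m m = b \<and> (\<forall>i<m. T m i \<le> T m (Suc i)))
      \<and> (\<lambda>m. Max {\<bar>T m (Suc i) - T m i\<bar> | i. i < m}) \<longlonglongrightarrow> 0
      \<and> (\<lambda>m. Max {infnorm (P (T m i) - ctrl_pts r a b m P i) | i. i \<le> m}) \<longlonglongrightarrow> 0)"

end

(*
  With t = b exp(-s), sigma = ln (b/a) and w(x) = exp(-sigma x), the i-th control point of t^(r_j) of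
  order m is b^(r_j) p_i(r_j), where p_i / q_i is the rational function of type (m - i, i) that
  interpolates w at r_0, ..., r_m, normalised by p_i(0) = q_i(0) = 1.  All sign information
  (monotone and convex polygons, corner cutting under elevation) comes from Rolle's theorem
  through the signs of the leading coefficients of p_i and q_i.

  Divergent case.  Consider the polygons with vertices (x_i, z_i) = (p_i(r_1), p_i(r_j)).  Passing from
  order m to m + 1 enlarges the area below the polygon by Omega_m / (2 r_(m+1)), where Omega_m >= 0
  measures how far the polygon is from an Euler scheme for dz/dx = (r_j/r_1) z/x.  The area is bounded,
  so divergence of sum 1/r_m forces Omega_m to be small for arbitrarily large m, and then the
  polygon is close to z = x^(r_j/r_1).  Convexity makes max (x_i^(r_j/r_1) - z_i) decrease in m, which
  gives the full limit, and positivity of the basis gives the reverse inequality.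

  Summable case.  If P - P(a) vanishes to order exactly k at a, the k-th control point is P(a) plus a fixed
  nonzero vector times the leading coefficient of q_k, so it suffices to bound that coefficient below.
  Its inverse is, up to sign, the k-th derivative at a of the basis function B_k, which lies in the
  span of k + 1 distribution functions of sums of independent exponential variables with rates
  r_(j+1), ..., r_m.  As sum 1/r_i is finite, these stay bounded away from 0 as m grows; since
  |B_k| <= 1, the coefficients of B_k, and hence its derivatives at a, stay bounded.
*)

theory Submission
  imports Defs "HOL-Computational_Algebra.Polynomial"
begin

section \<open>Real zeros of exponential polynomials\<close>

text \<open>The bridge between Bernstein bases and rational interpolation is duality. A coefficient
  vector \<beta> of sum \<beta>_l exp(-s r_l) acts on functions h of the nodes by sum \<beta>_l
  h(r_l). A zero of order d at b kills all polynomials with d coefficients, a zero of order d at a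
  kills w times such polynomials. The node function that equals p_i and q_i w at once is therefore
  killed by every B_k with k \<noteq> i: through q_i if i < k, through p_i if i > k. Pairing with it
  reads off the i-th Bernstein coefficient although the basis has no usable closed form for
  arbitrary real exponents.

  Plane polygons suffice in the divergent case: with parameters at which t^(r_1) takes exactly its
  control values, the error for P is a fixed linear combination of the plane errors, one for each
  r_j.

  Failure of convergence is seen at one fixed index k. An admissible parameter t_k lies within k
  mesh widths of a, so uniform convergence would force the k-th control point to tend to
  P(a).\<close>

definition coeffs_below :: "nat \<Rightarrow> real poly \<Rightarrow> bool" where
  "coeffs_below A p \<longleftrightarrow> (\<forall>k\<ge>A. coeff p k = 0)"

lemma coeffs_below_0 [simp]: "coeffs_below A 0"
  by (simp add: coeffs_below_def)

text \<open>Counting coefficients instead of bounding \<open>degree\<close> separates the zero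
  polynomial (no coefficient) from the constants (one coefficient). The zero counts below need both
  cases.\<close>

lemma coeffs_below_zero_iff [simp]: "coeffs_below 0 p \<longleftrightarrow> p = 0"
  by (auto simp: coeffs_below_def poly_eq_iff)

lemma coeffs_below_mono: "coeffs_below A p \<Longrightarrow> A \<le> B \<Longrightarrow> coeffs_below B p"
  by (auto simp: coeffs_below_def)

lemma coeffs_below_diff: "coeffs_below A p \<Longrightarrow> coeffs_below A q \<Longrightarrow> coeffs_below A (p - q)"
  by (auto simp: coeffs_below_def)

lemma coeffs_below_smult: "coeffs_below A p \<Longrightarrow> coeffs_below A (smult c p)"
  by (auto simp: coeffs_below_def)

lemma coeffs_below_Suc_drop:
  "coeffs_below (Suc A) p \<Longrightarrow> coeff p A = 0 \<Longrightarrow> coeffs_below A p"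
  unfolding coeffs_below_def by (metis le_eq_less_or_eq less_eq_Suc_le)

lemma coeffs_below_pderiv: "coeffs_below (Suc A) p \<Longrightarrow> coeffs_below A (pderiv p)"
  by (auto simp: coeffs_below_def coeff_pderiv)

lemma coeffs_below_degree: "coeffs_below (Suc (degree p)) p"
  by (auto simp: coeffs_below_def coeff_eq_0)

lemma degree_coeffs_below: "coeffs_below (Suc A) p \<Longrightarrow> degree p \<le> A"
  by (intro degree_le) (auto simp: coeffs_below_def)

lemma coeffs_below_linear_mult:
  "coeffs_below A p \<Longrightarrow> coeffs_below (Suc A) ([:c, d:] * p)"
  by (auto simp: coeffs_below_def coeff_pCons split: nat.split)

lemma coeffs_below_linear_mult_cancel:
  assumes "coeffs_below (Suc A) ([:c, 1:] * p)"
  shows "coeffs_below A p"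
proof (cases "p = 0")
  case False
  have "degree ([:c, 1:] * p) = Suc (degree p)"
    using False by (subst degree_mult_eq) auto
  with degree_coeffs_below[OF assms] have "Suc (degree p) \<le> A" by simp
  thus ?thesis using coeffs_below_degree coeffs_below_mono by blast
qed simp

lemma coeffs_below_1: "coeffs_below (Suc 0) p \<Longrightarrow> p = [:coeff p 0:]"
  by (auto simp: coeffs_below_def poly_eq_iff coeff_pCons split: nat.split)

lemma coeffs_below_1_poly: "coeffs_below (Suc 0) p \<Longrightarrow> poly p x = coeff p 0"
  by (subst coeffs_below_1) auto

lemma coeffs_below_const [simp]: "coeffs_below (Suc A) [:c:]"
  by (auto simp: coeffs_below_def coeff_pCons split: nat.split)

lemma rolle_zeros:
  fixes f :: "real \<Rightarrow> real"
  assumes "finite Z" and "\<And>x. (f has_real_derivative f' x) (at x)"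
    and "\<forall>x\<in>Z. f x = 0" and "card Z \<ge> Suc n"
  shows "\<exists>Y. finite Y \<and> card Y \<ge> n \<and> (\<forall>y\<in>Y. f' y = 0)"
proof -
  \<comment> \<open>The bound by \<open>Max Z\<close> makes the induction work: the next zero of
    \<open>f'\<close> is found beyond \<open>Max Z\<close> and so differs from all earlier
    ones.\<close>
  have "\<exists>Y. finite Y \<and> Suc (card Y) = card Z \<and> (\<forall>y\<in>Y. f' y = 0 \<and> y < Max Z)"
    if "Z \<noteq> {}"
    using assms(1,3) that
  proof (induction Z rule: finite_linorder_max_induct)
    case (insert b Z)
    show ?case
    proof (cases "Z = {}")
      case True
      thus ?thesis by (intro exI[of _ "{}"]) auto
    next
      case False
      with insert obtain Y where Y: "finite Y" "Suc (card Y) = card Z"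
        "\<forall>y\<in>Y. f' y = 0 \<and> y < Max Z" by auto
      have M: "Max Z \<in> Z" "Max Z < b" using False insert by auto
      have "\<exists>z. Max Z < z \<and> z < b \<and> f' z = 0"
      proof -
        have "\<exists>z. z > Max Z \<and> z < b \<and> f b - f (Max Z) = (b - Max Z) * f' z"
          by (rule MVT2) (use M assms(2) in auto)
        with M insert.prems show ?thesis by auto
      qed
      then obtain z where z: "Max Z < z" "z < b" "f' z = 0" by blast
      have "Max (insert b Z) = b"
        by (intro Max_eqI) (use insert in \<open>auto intro: less_imp_le\<close>)
      moreover have "z \<notin> Y" using Y z by force
      moreover have "b \<notin> Z" using insert by auto
      ultimately show ?thesis using Y z M insert.hyps(1)
        by (intro exI[of _ "insert z Y"]) force
    qed
  qed simp
  with assms(4) show ?thesis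
    by (metis Suc_le_mono card.empty not_less_eq_eq zero_le)
qed

text \<open>The sign relations below come from differentiating the polynomials away: Rolle keeps enough
  zeros to force a zero of a two-term expression in which only the top coefficients survive.\<close>

lemma lead_sign_exp_minus_poly:
  assumes "\<sigma> > 0" "coeffs_below (Suc B) q" "g \<noteq> 0 \<or> q \<noteq> 0"
    "finite Z" "card Z \<ge> Suc B" "\<And>x. x \<in> Z \<Longrightarrow> g * exp (\<sigma> * x) - poly q x = 0"
  shows "g * coeff q B > 0"
  using assms(2-)
proof (induction B arbitrary: g q Z)
  case 0
  then obtain x where "x \<in> Z" by fastforce
  with 0 have eq: "g * exp (\<sigma> * x) = poly q x" by auto
  have q: "q = [:coeff q 0:]" using 0 coeffs_below_1 by auto
  then have "poly q x = coeff q 0" by (simp add: coeffs_below_1_poly[OF 0(1)])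
  with eq have e: "coeff q 0 = g * exp (\<sigma> * x)" by simp
  have "g \<noteq> 0" using 0 e q by (metis mult_zero_left pCons_0_0)
  then have "g * g > 0" by (metis not_real_square_gt_zero)
  then show ?case unfolding e by (simp add: mult.assoc[symmetric])
next
  case (Suc B)
  have der: "((\<lambda>x. g * exp (\<sigma> * x) - poly q x) has_real_derivative (\<lambda>x. (g * \<sigma>) * exp (\<sigma> * x) - poly (pderiv q) x) x) (at x)" for x
    by (auto intro!: derivative_eq_intros simp: algebra_simps)
  have zero: "\<forall>x\<in>Z. g * exp (\<sigma> * x) - poly q x = 0"
    using Suc.prems(5) by simp
  from rolle_zeros[OF Suc.prems(3) der zero Suc.prems(4)]
  obtain Y where Y: "finite Y" "card Y \<ge> Suc B"
    "\<forall>y\<in>Y. (g * \<sigma>) * exp (\<sigma> * y) - poly (pderiv q) y = 0"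
    by (elim exE conjE)
  have ne: "g * \<sigma> \<noteq> 0 \<or> pderiv q \<noteq> 0"
  proof (rule ccontr)
    assume "\<not> ?thesis"
    with assms(1) have g: "g = 0" and "pderiv q = 0" by auto
    then obtain c where c: "q = [:c:]" using pderiv_iszero by blast
    obtain x where "x \<in> Z" using Suc.prems(4) by fastforce
    with Suc.prems(5)[of x] Suc.prems(2) g c show False by auto
  qed
  have "(g * \<sigma>) * coeff (pderiv q) B > 0"
    using Suc.IH[OF coeffs_below_pderiv[OF Suc.prems(1)] ne Y(1,2) bspec[OF Y(3)]] by blast
  then have "(\<sigma> * real (Suc B)) * (g * coeff q (Suc B)) > 0"
    by (simp add: coeff_pderiv mult_ac)
  then show ?case by (rule zero_less_mult_pos) (use assms(1) in simp)
qed

lemma lead_sign_exp_exp_poly: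
  assumes "\<sigma> > 0" "\<tau> > 0" "coeffs_below B q" "g \<noteq> 0 \<or> h \<noteq> 0 \<or> q \<noteq> 0"
    "finite Z" "card Z \<ge> Suc B"
    "\<And>x. x \<in> Z \<Longrightarrow> g * exp (\<sigma> * x) - poly q x - h * exp (\<tau> * x) = 0"
  shows "g * h > 0"
  using assms(3-)
proof (induction B arbitrary: g h q Z)
  case 0
  then obtain x where "x \<in> Z" by fastforce
  with 0 have eq: "g * exp (\<sigma> * x) = h * exp (\<tau> * x)" by auto
  then have h: "h = g * exp (\<sigma> * x) / exp (\<tau> * x)" by (simp add: field_simps)
  have "g \<noteq> 0" using 0 h by auto
  then have "g * g > 0" by (metis not_real_square_gt_zero)
  then have "(g * g) * (exp (\<sigma> * x) / exp (\<tau> * x)) > 0"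
    by (rule mult_pos_pos) simp
  also have "(g * g) * (exp (\<sigma> * x) / exp (\<tau> * x)) = g * h" by (simp add: h)
  finally show ?case .
next
  case (Suc B)
  have der: "((\<lambda>x. g * exp (\<sigma> * x) - poly q x - h * exp (\<tau> * x)) has_real_derivative (\<lambda>x. (g * \<sigma>) * exp (\<sigma> * x) - poly (pderiv q) x - (h * \<tau>) * exp (\<tau> * x)) x) (at x)" for x
    by (auto intro!: derivative_eq_intros simp: algebra_simps)
  have zero: "\<forall>x\<in>Z. g * exp (\<sigma> * x) - poly q x - h * exp (\<tau> * x) = 0"
    using Suc.prems(5) by simp
  from rolle_zeros[OF Suc.prems(3) der zero Suc.prems(4)]
  obtain Y where Y: "finite Y" "card Y \<ge> Suc B"
    "\<forall>y\<in>Y. (g * \<sigma>) * exp (\<sigma> * y) - poly (pderiv q) y - (h * \<tau>) * exp (\<tau> * y) = 0"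
    by (elim exE conjE)
  have ne: "g * \<sigma> \<noteq> 0 \<or> h * \<tau> \<noteq> 0 \<or> pderiv q \<noteq> 0"
  proof (rule ccontr)
    assume "\<not> ?thesis"
    with assms(1,2) have g: "g = 0" "h = 0" and "pderiv q = 0" by auto
    then obtain c where c: "q = [:c:]" using pderiv_iszero by blast
    obtain x where "x \<in> Z" using Suc.prems(4) by fastforce
    with Suc.prems(5)[of x] Suc.prems(2) g c show False by auto
  qed
  have "(g * \<sigma>) * (h * \<tau>) > 0"
    using Suc.IH[OF coeffs_below_pderiv[OF Suc.prems(1)] ne Y(1,2) bspec[OF Y(3)]] by blast
  then have "(\<sigma> * \<tau>) * (g * h) > 0"
    by (simp add: mult_ac)
  then show ?case by (rule zero_less_mult_pos) (use assms(1,2) in simp)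
qed

lemma pderiv_minus_smult_eq_0:
  fixes q :: "real poly"
  assumes "pderiv q - smult \<sigma> q = 0" "\<sigma> \<noteq> 0"
  shows "q = 0"
proof (rule ccontr)
  assume "q \<noteq> 0"
  have "coeff (pderiv q - smult \<sigma> q) (degree q) = - \<sigma> * lead_coeff q"
    by (simp add: coeff_pderiv coeff_eq_0)
  with assms \<open>q \<noteq> 0\<close> show False by simp
qed

lemma coeffs_below_pderiv_minus_smult:
  "coeffs_below B q \<Longrightarrow> coeffs_below B (pderiv q - smult \<sigma> q)"
  by (auto simp: coeffs_below_def coeff_pderiv)

text \<open>A derivatives reduce p to a constant and turn q into (D - \<sigma>)^A q, whose top
  coefficient has gained (-\<sigma>)^A; this is the origin of the sign. Multiplication by
  exp(\<sigma> x) then leads to \<open>lead_sign_exp_minus_poly\<close>. The number of zeros is one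
  below the number A + B + 2 of free coefficients, the largest possible.\<close>

lemma lead_sign:
  assumes "\<sigma> > 0" "coeffs_below (Suc A) p" "coeffs_below (Suc B) q" "p \<noteq> 0 \<or> q \<noteq> 0"
    "finite Z" "card Z \<ge> Suc (A + B)" "\<And>x. x \<in> Z \<Longrightarrow> poly p x - poly q x * exp (- \<sigma> * x) = 0"
  shows "(- 1) ^ A * coeff p A * coeff q B > 0"
  using assms(2-)
proof (induction A arbitrary: p q Z)
  case 0
  then have p: "p = [:coeff p 0:]" using coeffs_below_1 by auto
  have "coeff p 0 * coeff q B > 0"
  proof (rule lead_sign_exp_minus_poly[OF assms(1) 0(2) _ 0(4)])
    show "coeff p 0 \<noteq> 0 \<or> q \<noteq> 0" using p 0(3) by force
    fix x assume "x \<in> Z"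
    with 0(6) have "poly p x = poly q x * exp (- \<sigma> * x)" by simp
    moreover have "poly p x = coeff p 0" by (simp add: coeffs_below_1_poly[OF 0(1)])
    ultimately show "coeff p 0 * exp (\<sigma> * x) - poly q x = 0" by (simp add: exp_minus)
  qed (use 0(5) in auto)
  then show ?case by simp
next
  case (Suc A)
  let ?q = "pderiv q - smult \<sigma> q"
  have der: "((\<lambda>x. poly p x - poly q x * exp (- \<sigma> * x)) has_real_derivative (\<lambda>x. poly (pderiv p) x - poly ?q x * exp (- \<sigma> * x)) x) (at x)" for x
    by (auto intro!: derivative_eq_intros simp: algebra_simps)
  have zero: "\<forall>x\<in>Z. poly p x - poly q x * exp (- \<sigma> * x) = 0"
    using Suc.prems(6) by simp
  from rolle_zeros[OF Suc.prems(4) der zero Suc.prems(5), unfolded add_Suc]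
  obtain Y where Y: "finite Y" "card Y \<ge> Suc (A + B)"
    "\<forall>y\<in>Y. poly (pderiv p) y - poly ?q y * exp (- \<sigma> * y) = 0"
    by (elim exE conjE)
  have ne: "pderiv p \<noteq> 0 \<or> ?q \<noteq> 0"
  proof (rule ccontr)
    assume "\<not> ?thesis"
    then have q: "q = 0" and "pderiv p = 0"
      using assms(1) pderiv_minus_smult_eq_0[of q \<sigma>] by auto
    then obtain c where c: "p = [:c:]" using pderiv_iszero by blast
    obtain x where "x \<in> Z" using Suc.prems(5) by fastforce
    with Suc.prems(6)[of x] Suc.prems(3) q c show False by auto
  qed
  have "(- 1) ^ A * coeff (pderiv p) A * coeff ?q B > 0"
    using Suc.IH[OF coeffs_below_pderiv[OF Suc.prems(1)]
        coeffs_below_pderiv_minus_smult[OF Suc.prems(2)] ne Y(1,2) bspec[OF Y(3)]] by blast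
  moreover have q: "coeff ?q B = - \<sigma> * coeff q B"
    using Suc.prems(2) by (simp add: coeff_pderiv coeffs_below_def)
  ultimately have "(\<sigma> * real (Suc A)) * ((- 1) ^ Suc A * coeff p (Suc A) * coeff q B) > 0"
    unfolding q by (simp add: coeff_pderiv mult_ac)
  then show ?case by (rule zero_less_mult_pos) (use assms(1) in simp)
qed

text \<open>The third exponential will carry an interior point s of [0, \<sigma>] in the proof that
  the Bernstein functions are positive. The order s < \<sigma> enters when p has become constant:
  multiplication by exp(\<sigma> x) leaves two growing exponentials, with rates \<sigma> and
  \<sigma> - s, and a polynomial.\<close>

lemma lead_sign_three:
  assumes "0 < s" "s < \<sigma>" "coeffs_below (Suc A) p" "coeffs_below B q" "p \<noteq> 0 \<or> q \<noteq> 0 \<or> g \<noteq> 0"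
    "finite Z" "card Z \<ge> Suc (A + B)"
    "\<And>x. x \<in> Z \<Longrightarrow> poly p x - poly q x * exp (- \<sigma> * x) - g * exp (- s * x) = 0"
  shows "(- 1) ^ A * coeff p A * g > 0"
  using assms(3-)
proof (induction A arbitrary: p q g Z)
  case 0
  then have p: "p = [:coeff p 0:]" using coeffs_below_1 by auto
  have "coeff p 0 * g > 0"
  proof (rule lead_sign_exp_exp_poly[OF _ _ 0(2) _ 0(4), of \<sigma> "\<sigma> - s"])
    show "coeff p 0 \<noteq> 0 \<or> g \<noteq> 0 \<or> q \<noteq> 0" using p 0(3) by force
    fix x assume "x \<in> Z"
    with 0(6)[of x] have "poly p x = poly q x * exp (- \<sigma> * x) + g * exp (- s * x)" by linarith
    moreover have "poly p x = coeff p 0" by (simp add: coeffs_below_1_poly[OF 0(1)])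
    moreover have "exp (- s * x) * exp (\<sigma> * x) = exp ((\<sigma> - s) * x)"
      by (simp add: exp_add[symmetric] algebra_simps)
    moreover have "exp (- \<sigma> * x) * exp (\<sigma> * x) = 1"
      by (simp add: exp_add[symmetric])
    ultimately show "coeff p 0 * exp (\<sigma> * x) - poly q x - g * exp ((\<sigma> - s) * x) = 0"
      by (simp add: algebra_simps)
  qed (use assms(1,2) 0(5) in auto)
  then show ?case by simp
next
  case (Suc A)
  let ?q = "pderiv q - smult \<sigma> q"
  have der: "((\<lambda>x. poly p x - poly q x * exp (- \<sigma> * x) - g * exp (- s * x)) has_real_derivative (\<lambda>x. poly (pderiv p) x - poly ?q x * exp (- \<sigma> * x) - (- s * g) * exp (- s * x)) x) (at x)" for x
    by (auto intro!: derivative_eq_intros simp: algebra_simps)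
  have zero: "\<forall>x\<in>Z. poly p x - poly q x * exp (- \<sigma> * x) - g * exp (- s * x) = 0"
    using Suc.prems(6) by simp
  from rolle_zeros[OF Suc.prems(4) der zero Suc.prems(5), unfolded add_Suc]
  obtain Y where Y: "finite Y" "card Y \<ge> Suc (A + B)"
    "\<forall>y\<in>Y. poly (pderiv p) y - poly ?q y * exp (- \<sigma> * y) - (- s * g) * exp (- s * y) = 0"
    by (elim exE conjE)
  have ne: "pderiv p \<noteq> 0 \<or> ?q \<noteq> 0 \<or> - s * g \<noteq> 0"
  proof (rule ccontr)
    assume "\<not> ?thesis"
    then have q: "q = 0" "g = 0" and "pderiv p = 0"
      using assms(1,2) pderiv_minus_smult_eq_0[of q \<sigma>] by auto
    then obtain c where c: "p = [:c:]" using pderiv_iszero by blast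
    obtain x where "x \<in> Z" using Suc.prems(5) by fastforce
    with Suc.prems(6)[of x] Suc.prems(3) q c show False by auto
  qed
  have "(- 1) ^ A * coeff (pderiv p) A * (- s * g) > 0"
    using Suc.IH[OF coeffs_below_pderiv[OF Suc.prems(1)]
        coeffs_below_pderiv_minus_smult[OF Suc.prems(2)] ne Y(1,2) bspec[OF Y(3)]] by blast
  then have "(s * real (Suc A)) * ((- 1) ^ Suc A * coeff p (Suc A) * g) > 0"
    by (simp add: coeff_pderiv algebra_simps)
  then show ?case by (rule zero_less_mult_pos) (use assms(1) in simp)
qed

text \<open>With A + B zeros, \<open>lead_sign\<close> would apply with one of the two bounds raised
  by one, and would give a nonzero product containing a coefficient that lies beyond the true
  bound.\<close>

lemma zero_count:
  assumes "\<sigma> > 0" "coeffs_below A p" "coeffs_below B q" "p \<noteq> 0 \<or> q \<noteq> 0"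
    "finite Z" "\<And>x. x \<in> Z \<Longrightarrow> poly p x - poly q x * exp (- \<sigma> * x) = 0"
  shows "card Z < A + B"
proof (rule ccontr)
  assume "\<not> ?thesis"
  then have c: "card Z \<ge> A + B" by simp
  show False
  proof (cases B)
    case 0
    then show False
    proof (cases A)
      case (Suc A')
      have "(- 1) ^ A' * coeff p A' * coeff q B > 0"
        by (rule lead_sign[OF assms(1) _ _ assms(4,5)])
          (use assms c Suc in \<open>auto intro: coeffs_below_mono\<close>)
      then show ?thesis using assms(3) by (simp add: coeffs_below_def)
    qed (use assms 0 in auto)
  next
    case (Suc B')
    have "(- 1) ^ A * coeff p A * coeff q B' > 0"
      by (rule lead_sign[OF assms(1) _ _ assms(4,5)])
        (use assms c Suc in \<open>auto intro: coeffs_below_mono\<close>)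
    then show ?thesis using assms(2) by (simp add: coeffs_below_def)
  qed
qed

section \<open>Nonzero solutions from a count of unknowns\<close>

lemma homogeneous_system_solution:
  fixes f :: "'i \<Rightarrow> 's \<Rightarrow> real"
  assumes "finite S" "finite I" "card S < card I"
  shows "\<exists>c. (\<exists>i\<in>I. c i \<noteq> 0) \<and> (\<forall>x\<in>S. (\<Sum>i\<in>I. c i * f i x) = 0)"
  using assms
proof (induction S arbitrary: I f rule: finite_induct)
  case empty
  then obtain i where "i \<in> I" by fastforce
  then show ?case by (intro exI[of _ "\<lambda>_. 1"]) auto
next
  case (insert x S)
  show ?case
  proof (cases "\<forall>i\<in>I. f i x = 0")
    case True
    with insert.IH[of I f] insert.prems insert.hyps show ?thesis by auto
  next
    case False
    then obtain k where k: "k \<in> I" "f k x \<noteq> 0" by blast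
    define g where "g = (\<lambda>i y. f i y - f i x / f k x * f k y)"
    have "card S < card (I - {k})" using insert k by auto
    with insert.IH[of "I - {k}" g] insert.prems obtain c where
      c: "\<exists>i\<in>I - {k}. c i \<noteq> 0" "\<forall>y\<in>S. (\<Sum>i\<in>I - {k}. c i * g i y) = 0" by auto
    \<comment> \<open>The pivot coefficient solves equation x; the other equations see it only
      through the eliminated entries \<open>g\<close>.\<close>
    define e where "e = - (\<Sum>i\<in>I - {k}. c i * f i x / f k x)"
    define d where "d = c(k := e)"
    have eq: "(\<Sum>i\<in>I. d i * f i y) = (\<Sum>i\<in>I - {k}. c i * g i y)" for y
    proof -
      have "(\<Sum>i\<in>I. d i * f i y) = e * f k y + (\<Sum>i\<in>I - {k}. c i * f i y)"
        using insert.prems k by (subst sum.remove[of _ k]) (auto simp: d_def intro!: sum.cong)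
      also have "\<dots> = (\<Sum>i\<in>I - {k}. c i * g i y)"
        by (simp add: e_def g_def sum_distrib_left sum_subtractf right_diff_distrib mult_ac)
      finally show ?thesis .
    qed
    have "(\<Sum>i\<in>I - {k}. c i * g i x) = 0" using k by (simp add: g_def)
    then show ?thesis using c eq by (intro exI[of _ d]) (auto simp: d_def)
  qed
qed

text \<open>One count of A + B + C unknowns with two uses: C = 0 yields the interpolants and the
  functions isolating a node, C = 1 adds the exponential at an interior point.\<close>

lemma pair_exists_gen:
  assumes "finite S" "card S < A + B + C" "C \<le> 1"
  shows "\<exists>p q g. coeffs_below A p \<and> coeffs_below B q \<and> (p \<noteq> 0 \<or> q \<noteq> 0 \<or> g \<noteq> 0) \<and> (C = 0 \<longrightarrow> g = 0) \<and>
    (\<forall>x\<in>S. poly p x - poly q x * exp (- \<sigma> * x) - g * exp (- s * x) = 0)"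
proof -
  define f where "f = (\<lambda>i x. if i < A then x ^ i else if i < A + B then - (x ^ (i - A) * exp (- \<sigma> * x))
    else - exp (- s * x :: real))"
  obtain c where c: "\<exists>i\<in>{..<A+B+C}. c i \<noteq> 0" "\<forall>x\<in>S. (\<Sum>i\<in>{..<A+B+C}. c i * f i x) = 0"
    using homogeneous_system_solution[OF assms(1), of "{..<A+B+C}" f] assms(2) by auto
  define p where "p = (\<Sum>i<A. monom (c i) i)"
  define q where "q = (\<Sum>i<B. monom (c (A + i)) i)"
  define g where "g = (if C = 0 then 0 else c (A + B))"
  have cp: "coeff p i = (if i < A then c i else 0)" for i
    by (auto simp: p_def coeff_sum if_distrib cong: if_cong)
  have cq: "coeff q i = (if i < B then c (A + i) else 0)" for i
    by (auto simp: q_def coeff_sum if_distrib cong: if_cong)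
  have "p \<noteq> 0 \<or> q \<noteq> 0 \<or> g \<noteq> 0"
  proof -
    obtain i where i: "i < A + B + C" "c i \<noteq> 0" using c by auto
    consider "i < A" | "A \<le> i" "i < A + B" | "i = A + B" "C = 1"
      using i assms(3) by linarith
    then show ?thesis
    proof cases
      case 1
      then have "coeff p i \<noteq> 0" using cp i by auto
      then show ?thesis by auto
    next
      case 2
      then have "coeff q (i - A) \<noteq> 0" using cq i by auto
      then show ?thesis by auto
    qed (use i in \<open>auto simp: g_def\<close>)
  qed
  moreover have "poly p x - poly q x * exp (- \<sigma> * x) - g * exp (- s * x) = 0" if "x \<in> S" for x
  proof -
    have split: "(\<Sum>i<M+N. h i) = (\<Sum>i<M. h i) + (\<Sum>i<N. h (M + i))" for M N and h :: "nat \<Rightarrow> real"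
      by (induction N) (auto simp: algebra_simps)
    have "(\<Sum>i<A+B+C. c i * f i x) = (\<Sum>i<A. c i * x ^ i) + (\<Sum>i<B. c (A+i) * - (x ^ i * exp (- \<sigma> * x)))
      + (\<Sum>i<C. c (A+B+i) * - exp (- s * x))"
      unfolding split by (auto simp: f_def)
    also have "\<dots> = poly p x - poly q x * exp (- \<sigma> * x) - g * exp (- s * x)"
    proof -
      have 1: "poly p x = (\<Sum>i<A. c i * x ^ i)" by (simp add: p_def poly_sum poly_monom)
      have 2: "(\<Sum>i<B. c (A+i) * - (x ^ i * exp (- \<sigma> * x))) = - (poly q x * exp (- \<sigma> * x))"
        unfolding q_def poly_sum poly_monom sum_distrib_right sum_negf[symmetric]
        by (intro sum.cong) simp_all
      have "C = 0 \<or> C = 1" using assms(3) by linarith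
      then have 3: "(\<Sum>i<C. c (A+B+i) * - exp (- s * x)) = - (g * exp (- s * x))"
        by (auto simp: g_def)
      show ?thesis unfolding 1 2 3 by simp
    qed
    finally show ?thesis using bspec[OF c(2) that] by simp
  qed
  moreover have "coeffs_below A p" "coeffs_below B q" "C = 0 \<longrightarrow> g = 0"
    using cp cq by (simp_all add: coeffs_below_def g_def)
  ultimately show ?thesis by blast
qed

section \<open>Rational interpolation of an exponential\<close>

lemma poly_divide_root:
  fixes p :: "real poly"
  assumes "poly p c = 0" "coeffs_below (Suc A) p"
  obtains u where "p = [:- c, 1:] * u" "coeffs_below A u"
proof -
  from assms(1) obtain u where u: "p = [:- c, 1:] * u" by (auto simp: poly_eq_0_iff_dvd elim: dvdE)
  with assms(2) have "coeffs_below A u" using coeffs_below_linear_mult_cancel by blast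
  with u show ?thesis using that by blast
qed

text \<open>Rational interpolation of exp(-\<sigma> x) of type (card S - 1 - i, i), in linearised
  form so that no denominator has to be nonzero. The base point c is a parameter because the
  comparison of neighbouring types divides by x - c and continues on S - {c} with another base
  point.\<close>

definition interp_pair :: "real \<Rightarrow> real set \<Rightarrow> real \<Rightarrow> nat \<Rightarrow> real poly \<times> real poly \<Rightarrow> bool" where
  "interp_pair \<sigma> S c i pq \<longleftrightarrow> coeffs_below (card S - i) (fst pq) \<and> coeffs_below (Suc i) (snd pq) \<and>
     (\<forall>x\<in>S. poly (fst pq) x = poly (snd pq) x * exp (- \<sigma> * x)) \<and> poly (fst pq) c = 1"

definition inum :: "real \<Rightarrow> real set \<Rightarrow> real \<Rightarrow> nat \<Rightarrow> real poly" where
  "inum \<sigma> S c i = fst (SOME pq. interp_pair \<sigma> S c i pq)"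

definition iden :: "real \<Rightarrow> real set \<Rightarrow> real \<Rightarrow> nat \<Rightarrow> real poly" where
  "iden \<sigma> S c i = snd (SOME pq. interp_pair \<sigma> S c i pq)"

context
  fixes \<sigma> :: real
  assumes \<sigma>: "\<sigma> > 0"
begin

text \<open>If p vanishes at c, so does q. Dividing both by x - c leaves card S - 1 coefficients in
  all and just as many zeros on S - {c}, which \<open>zero_count\<close> excludes.\<close>

lemma interp_zero:
  assumes "finite S" "c \<in> S" "i < card S" "coeffs_below (card S - i) p" "coeffs_below (Suc i) q"
    "\<And>x. x \<in> S \<Longrightarrow> poly p x = poly q x * exp (- \<sigma> * x)" "poly p c = 0"
  shows "p = 0 \<and> q = 0"
proof -
  obtain A where A: "card S - i = Suc A" using assms(3) by (metis Suc_diff_Suc)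
  have qc: "poly q c = 0" using assms(2,6,7) by auto
  obtain u where u: "p = [:- c, 1:] * u" "coeffs_below A u"
    using poly_divide_root assms(4,7) A by metis
  obtain v where v: "q = [:- c, 1:] * v" "coeffs_below i v"
    using poly_divide_root assms(5) qc by metis
  have "u = 0 \<and> v = 0"
  proof (rule ccontr)
    assume "\<not> ?thesis"
    then have "u \<noteq> 0 \<or> v \<noteq> 0" by blast
    then have "card (S - {c}) < A + i"
    proof (rule zero_count[OF \<sigma> u(2) v(2)])
      fix x assume x: "x \<in> S - {c}"
      then have "(x - c) * (poly u x - poly v x * exp (- \<sigma> * x)) = 0"
        using assms(6)[of x] u(1) v(1) by (simp add: algebra_simps)
      with x show "poly u x - poly v x * exp (- \<sigma> * x) = 0" by simp
    qed (use assms in auto)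
    with A assms(2) show False by auto
  qed
  with u v show ?thesis by simp
qed

lemma interp_pair_exists:
  assumes "finite S" "c \<in> S" "i < card S"
  shows "\<exists>pq. interp_pair \<sigma> S c i pq"
proof -
  obtain p q where pq: "coeffs_below (card S - i) p" "coeffs_below (Suc i) q" "p \<noteq> 0 \<or> q \<noteq> 0"
    "\<And>x. x \<in> S \<Longrightarrow> poly p x = poly q x * exp (- \<sigma> * x)"
    using pair_exists_gen[OF assms(1), of "card S - i" "Suc i" 0 \<sigma>] assms(3) by auto
  define k where "k = poly p c"
  have "k \<noteq> 0"
  proof
    assume "k = 0"
    then have "poly p c = 0" by (simp add: k_def)
    from interp_zero[OF assms pq(1,2,4) this] pq(3) show False by blast
  qed
  then have "interp_pair \<sigma> S c i (smult (1 / k) p, smult (1 / k) q)"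
    using pq by (auto simp: interp_pair_def k_def coeffs_below_smult)
  then show ?thesis by blast
qed

context
  fixes S :: "real set" and c :: real and i :: nat
  assumes S: "finite S" "c \<in> S" "i < card S"
begin

lemma interp_pair_inum_iden: "interp_pair \<sigma> S c i (inum \<sigma> S c i, iden \<sigma> S c i)"
  unfolding inum_def iden_def using someI_ex[OF interp_pair_exists[OF S]] by simp

lemma coeffs_below_inum: "coeffs_below (card S - i) (inum \<sigma> S c i)"
  and coeffs_below_iden: "coeffs_below (Suc i) (iden \<sigma> S c i)"
  and inum_eq: "x \<in> S \<Longrightarrow> poly (inum \<sigma> S c i) x = poly (iden \<sigma> S c i) x * exp (- \<sigma> * x)"
  and inum_base: "poly (inum \<sigma> S c i) c = 1"
  using interp_pair_inum_iden by (auto simp: interp_pair_def)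

lemma iden_base: "poly (iden \<sigma> S c i) c = exp (\<sigma> * c)"
  using inum_eq[of c] inum_base S by (simp add: exp_minus field_simps)

lemma interp_unique:
  assumes "coeffs_below (card S - i) p" "coeffs_below (Suc i) q"
    "\<And>x. x \<in> S \<Longrightarrow> poly p x = poly q x * exp (- \<sigma> * x)"
  shows "p = smult (poly p c) (inum \<sigma> S c i)" "q = smult (poly p c) (iden \<sigma> S c i)"
proof -
  have "p - smult (poly p c) (inum \<sigma> S c i) = 0 \<and> q - smult (poly p c) (iden \<sigma> S c i) = 0"
    by (rule interp_zero[OF S])
      (use assms coeffs_below_inum coeffs_below_iden inum_eq inum_base in
        \<open>auto intro!: coeffs_below_diff coeffs_below_smult simp: algebra_simps\<close>)
  then show "p = smult (poly p c) (inum \<sigma> S c i)" "q = smult (poly p c) (iden \<sigma> S c i)" by auto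
qed

lemma inum_iden_lead_sign:
  "(- 1) ^ (card S - i - 1) * coeff (inum \<sigma> S c i) (card S - i - 1) * coeff (iden \<sigma> S c i) i > 0"
proof (rule lead_sign[OF \<sigma> _ coeffs_below_iden _ S(1)])
  show "coeffs_below (Suc (card S - i - 1)) (inum \<sigma> S c i)"
    using coeffs_below_inum S(3) by (metis Suc_diff_1 zero_less_diff)
  show "inum \<sigma> S c i \<noteq> 0 \<or> iden \<sigma> S c i \<noteq> 0" using inum_base by force
qed (use S inum_eq in auto)

end

section \<open>Comparison of interpolants of neighbouring types and node sets\<close>

lemma inum_diff_factor:
  assumes S: "finite S" "c \<in> S" "Suc i < card S" and c': "c' \<in> S" "c' \<noteq> c"
  obtains k where
    "inum \<sigma> S c i - inum \<sigma> S c (Suc i) = [:- c, 1:] * smult k (inum \<sigma> (S - {c}) c' i)"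
    "iden \<sigma> S c i - iden \<sigma> S c (Suc i) = [:- c, 1:] * smult k (iden \<sigma> (S - {c}) c' i)"
proof -
  have i: "i < card S" using S by simp
  note 1 = coeffs_below_inum[OF S(1,2) i] coeffs_below_iden[OF S(1,2) i]
    inum_eq[OF S(1,2) i] inum_base[OF S(1,2) i] iden_base[OF S(1,2) i]
  note 2 = coeffs_below_inum[OF S] coeffs_below_iden[OF S]
    inum_eq[OF S] inum_base[OF S] iden_base[OF S]
  let ?p = "inum \<sigma> S c i - inum \<sigma> S c (Suc i)" and ?q = "iden \<sigma> S c i - iden \<sigma> S c (Suc i)"
  \<comment> \<open>The difference has card S - i and i + 2 coefficients. Dividing out the zero at c
    leaves exactly the type of index i on S - {c}, so uniqueness identifies the quotient.\<close>
  have cs: "card S - i = Suc (card (S - {c}) - i)" "i < card (S - {c})" using S by auto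
  have "coeffs_below (card S - i) ?p"
    using 1(1) 2(1) by (auto intro!: coeffs_below_diff elim: coeffs_below_mono)
  then obtain u where u: "?p = [:- c, 1:] * u" "coeffs_below (card (S - {c}) - i) u"
    using poly_divide_root[of ?p c] 1(4) 2(4) cs by auto
  have "coeffs_below (Suc (Suc i)) ?q"
    using 1(2) 2(2) by (auto intro!: coeffs_below_diff elim: coeffs_below_mono)
  then obtain v where v: "?q = [:- c, 1:] * v" "coeffs_below (Suc i) v"
    using poly_divide_root[of ?q c] 1(5) 2(5) by auto
  have z: "poly u x = poly v x * exp (- \<sigma> * x)" if x: "x \<in> S - {c}" for x
  proof -
    have "(x - c) * poly u x = poly ?p x" unfolding u(1) by (simp add: algebra_simps)
    also have "\<dots> = poly ?q x * exp (- \<sigma> * x)" using x 1(3)[of x] 2(3)[of x] by (simp add: algebra_simps)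
    also have "poly ?q x = (x - c) * poly v x" unfolding v(1) by (simp add: algebra_simps)
    finally show ?thesis using x by simp
  qed
  have S': "finite (S - {c})" "c' \<in> S - {c}" using S c' by auto
  from interp_unique[OF S' cs(2) u(2) v(2) z] u(1) v(1) show ?thesis
    using that[of "poly u c'"] by metis
qed

text \<open>\<open>inum_iden_lead_sign\<close> fixes only the sign of a product. In the factorised
  difference of types i and i + 1, the top numerator coefficient at i is a multiple of k and the top
  denominator coefficient at i + 1 a multiple of -k. This carries positivity along i, starting from
  the constant denominator exp(\<sigma> c).\<close>

lemma iden_lead_pos:
  assumes S: "finite S" "c \<in> S" "i < card S"
  shows "coeff (iden \<sigma> S c i) i > 0"
  using assms(3)
proof (induction i)
  case 0
  have "iden \<sigma> S c 0 = [:coeff (iden \<sigma> S c 0) 0:]"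
    using coeffs_below_iden[OF S(1,2) 0] coeffs_below_1 by blast
  then have "coeff (iden \<sigma> S c 0) 0 = poly (iden \<sigma> S c 0) c"
    using coeffs_below_1_poly[OF coeffs_below_iden[OF S(1,2) 0]] by simp
  also have "\<dots> = exp (\<sigma> * c)" by (rule iden_base[OF S(1,2) 0])
  finally show ?case by simp
next
  case (Suc i)
  then have i: "i < card S" by simp
  obtain c' where c': "c' \<in> S" "c' \<noteq> c"
  proof -
    have "S \<noteq> {c}" using Suc.prems by auto
    then show thesis using that S(2) by blast
  qed
  obtain k where k:
    "inum \<sigma> S c i - inum \<sigma> S c (Suc i) = [:- c, 1:] * smult k (inum \<sigma> (S - {c}) c' i)"
    "iden \<sigma> S c i - iden \<sigma> S c (Suc i) = [:- c, 1:] * smult k (iden \<sigma> (S - {c}) c' i)"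
    using inum_diff_factor[OF S(1,2) Suc.prems c'] by blast
  define n where "n = card S - i - 2"
  have n: "card S - i - 1 = Suc n" "card (S - {c}) - i - 1 = n" "i < card (S - {c})"
    using Suc.prems S by (auto simp: n_def)
  have S': "finite (S - {c})" "c' \<in> S - {c}" using S c' by auto
  have cn: "coeff (inum \<sigma> S c (Suc i)) (Suc n) = 0"
    using coeffs_below_inum[OF S(1,2) Suc.prems] n by (auto simp: coeffs_below_def)
  have ci: "coeff (iden \<sigma> S c i) (Suc i) = 0"
    using coeffs_below_iden[OF S(1,2) i] n by (auto simp: coeffs_below_def)
  have z: "coeff (inum \<sigma> (S - {c}) c' i) (Suc n) = 0" "coeff (iden \<sigma> (S - {c}) c' i) (Suc i) = 0"
    using coeffs_below_inum[OF S' n(3)] coeffs_below_iden[OF S' n(3)] n by (auto simp: coeffs_below_def)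
  define \<pi> where "\<pi> = coeff (inum \<sigma> (S - {c}) c' i) n"
  define \<kappa> where "\<kappa> = coeff (iden \<sigma> (S - {c}) c' i) i"
  have e1: "coeff (inum \<sigma> S c i) (Suc n) = k * \<pi>"
    using arg_cong[OF k(1), of "\<lambda>p. coeff p (Suc n)"] cn z by (simp add: \<pi>_def)
  have e2: "coeff (iden \<sigma> S c (Suc i)) (Suc i) = - (k * \<kappa>)"
    using arg_cong[OF k(2), of "\<lambda>p. coeff p (Suc i)"] ci z by (simp add: \<kappa>_def)
  have s1: "(- 1) ^ Suc n * (k * \<pi>) * coeff (iden \<sigma> S c i) i > 0"
    using inum_iden_lead_sign[OF S(1,2) i] unfolding n e1 .
  have s2: "(- 1) ^ n * \<pi> * \<kappa> > 0"
    using inum_iden_lead_sign[OF S' n(3)] unfolding n \<pi>_def \<kappa>_def .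
  have "coeff (iden \<sigma> S c i) i > 0" using Suc.IH i by simp
  with s1 have "(- 1) ^ Suc n * (k * \<pi>) > 0" by (metis zero_less_mult_pos2)
  then have "((- 1) ^ Suc n * (k * \<pi>)) * ((- 1) ^ n * \<pi> * \<kappa>) > 0" using s2 by (rule mult_pos_pos)
  also have "((- 1) ^ Suc n * (k * \<pi>)) * ((- 1) ^ n * \<pi> * \<kappa>) = ((-1)^n * (-1)^n) * (\<pi> * \<pi>) * (- (k * \<kappa>))"
    by (simp add: algebra_simps)
  also have "(-1)^n * (-1)^n = (1::real)" by (simp add: power_add[symmetric])
  finally have "(\<pi> * \<pi>) * (- (k * \<kappa>)) > 0" by simp
  moreover from this have "\<pi> * \<pi> > 0" by (metis mult_zero_left not_real_square_gt_zero order_less_irrefl)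
  ultimately show ?case unfolding e2 by (rule zero_less_mult_pos)
qed

lemma inum_lead_sign:
  assumes S: "finite S" "c \<in> S" "i < card S"
  shows "(- 1) ^ (card S - i - 1) * coeff (inum \<sigma> S c i) (card S - i - 1) > 0"
  using inum_iden_lead_sign[OF S] iden_lead_pos[OF S] by (metis zero_less_mult_pos2)

lemma inum_diff_factor_pos:
  assumes S: "finite S" "c \<in> S" "Suc i < card S" and c': "c' \<in> S" "c' \<noteq> c"
  obtains k where "k > 0"
    "inum \<sigma> S c (Suc i) - inum \<sigma> S c i = [:- c, 1:] * smult k (inum \<sigma> (S - {c}) c' i)"
proof -
  obtain k where k:
    "inum \<sigma> S c i - inum \<sigma> S c (Suc i) = [:- c, 1:] * smult k (inum \<sigma> (S - {c}) c' i)"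
    "iden \<sigma> S c i - iden \<sigma> S c (Suc i) = [:- c, 1:] * smult k (iden \<sigma> (S - {c}) c' i)"
    using inum_diff_factor[OF S c'] by blast
  have i: "i < card (S - {c})" "i < card S" using S by auto
  have S': "finite (S - {c})" "c' \<in> S - {c}" using S c' by auto
  have z: "coeff (iden \<sigma> (S - {c}) c' i) (Suc i) = 0" "coeff (iden \<sigma> S c i) (Suc i) = 0"
    using coeffs_below_iden[OF S' i(1)] coeffs_below_iden[OF S(1,2) i(2)] by (auto simp: coeffs_below_def)
  have "coeff (iden \<sigma> S c (Suc i)) (Suc i) = - k * coeff (iden \<sigma> (S - {c}) c' i) i"
    using arg_cong[OF k(2), of "\<lambda>p. coeff p (Suc i)"] z by simp
  with iden_lead_pos[OF S] iden_lead_pos[OF S' i(1)] have "- k > 0"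
    by (metis zero_less_mult_pos2)
  moreover have "inum \<sigma> S c (Suc i) - inum \<sigma> S c i = [:- c, 1:] * smult (- k) (inum \<sigma> (S - {c}) c' i)"
    using arg_cong[OF k(1), of uminus] by simp
  ultimately show ?thesis using that by blast
qed

text \<open>Normalising the quotient on S - {c} at the evaluation point y gives it the value 1
  there, so the increment is (y - c) k.\<close>

lemma inum_strict_mono:
  assumes S: "finite S" "c \<in> S" "Suc i < card S" and y: "y \<in> S" "c < y"
  shows "poly (inum \<sigma> S c i) y < poly (inum \<sigma> S c (Suc i)) y"
proof -
  obtain k where k: "k > 0"
    "inum \<sigma> S c (Suc i) - inum \<sigma> S c i = [:- c, 1:] * smult k (inum \<sigma> (S - {c}) y i)"
    using inum_diff_factor_pos[OF S y(1)] y(2) by blast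
  have "poly (inum \<sigma> (S - {c}) y i) y = 1" by (rule inum_base) (use S y in auto)
  then have "poly (inum \<sigma> S c (Suc i)) y - poly (inum \<sigma> S c i) y = (y - c) * k"
    using arg_cong[OF k(2), of "\<lambda>p. poly p y"] by (simp add: algebra_simps)
  also have "\<dots> > 0" using k y by simp
  finally show ?thesis by simp
qed

text \<open>The increment at z divided by that at y is (z - c) / (y - c) times the value at z of an
  interpolant on S - {c} normalised at y. By \<open>inum_strict_mono\<close>, applied there, this
  value increases with i.\<close>

lemma inum_slopes_increasing:
  assumes S: "finite S" "c \<in> S" "Suc (Suc i) < card S" and y: "y \<in> S" "z \<in> S" "c < y" "y < z"
  shows "(poly (inum \<sigma> S c (Suc i)) z - poly (inum \<sigma> S c i) z) *
      (poly (inum \<sigma> S c (Suc (Suc i))) y - poly (inum \<sigma> S c (Suc i)) y)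
    < (poly (inum \<sigma> S c (Suc (Suc i))) z - poly (inum \<sigma> S c (Suc i)) z) *
      (poly (inum \<sigma> S c (Suc i)) y - poly (inum \<sigma> S c i) y)"
proof -
  have i: "Suc i < card S" using S by simp
  obtain k where k: "k > 0"
    "inum \<sigma> S c (Suc i) - inum \<sigma> S c i = [:- c, 1:] * smult k (inum \<sigma> (S - {c}) y i)"
    using inum_diff_factor_pos[OF S(1,2) i y(1)] y(3) by blast
  obtain l where l: "l > 0"
    "inum \<sigma> S c (Suc (Suc i)) - inum \<sigma> S c (Suc i) = [:- c, 1:] * smult l (inum \<sigma> (S - {c}) y (Suc i))"
    using inum_diff_factor_pos[OF S(1,2,3) y(1)] y(3) by blast
  have S': "finite (S - {c})" "y \<in> S - {c}" "Suc i < card (S - {c})" "i < card (S - {c})"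
    using S y by auto
  have b: "poly (inum \<sigma> (S - {c}) y i) y = 1" "poly (inum \<sigma> (S - {c}) y (Suc i)) y = 1"
    using inum_base[OF S'(1,2)] S' by auto
  have m: "poly (inum \<sigma> (S - {c}) y i) z < poly (inum \<sigma> (S - {c}) y (Suc i)) z"
    by (rule inum_strict_mono[OF S'(1,2,3)]) (use y in auto)
  have e: "poly (inum \<sigma> S c (Suc i)) x - poly (inum \<sigma> S c i) x = (x - c) * k * poly (inum \<sigma> (S - {c}) y i) x"
    "poly (inum \<sigma> S c (Suc (Suc i))) x - poly (inum \<sigma> S c (Suc i)) x = (x - c) * l * poly (inum \<sigma> (S - {c}) y (Suc i)) x" for x
    using arg_cong[OF k(2), of "\<lambda>p. poly p x"] arg_cong[OF l(2), of "\<lambda>p. poly p x"]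
    by (simp_all add: algebra_simps)
  have "((z - c) * k * (y - c) * l) * poly (inum \<sigma> (S - {c}) y i) z
      < ((z - c) * k * (y - c) * l) * poly (inum \<sigma> (S - {c}) y (Suc i)) z"
    using m k l y by (intro mult_strict_left_mono) auto
  then show ?thesis unfolding e b by (simp add: mult_ac)
qed

text \<open>Subtracting the multiple \<beta> of type i on S that cancels the top numerator
  coefficient leaves type i + 1 on S, and the normalisation makes the weights add up to 1. Numerator
  tops give \<beta> > 0, denominator tops give 1 - \<beta> > 0.\<close>

lemma inum_elevation:
  assumes S: "finite S" "c \<in> S" "y \<notin> S" "Suc i < card S"
  obtains \<alpha> where "0 < \<alpha>" "\<alpha> < 1"
    "inum \<sigma> (insert y S) c (Suc i) = smult (1 - \<alpha>) (inum \<sigma> S c i) + smult \<alpha> (inum \<sigma> S c (Suc i))"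
proof -
  let ?T = "insert y S"
  have i: "i < card S" using S by simp
  have T: "finite ?T" "c \<in> ?T" "Suc i < card ?T" using S by auto
  define n where "n = card S - i - 1"
  have n: "card S - i = Suc n" "card ?T - Suc i = Suc n" "card S - Suc i = n"
    using S i by (auto simp: n_def)
  note T1 = coeffs_below_inum[OF T] coeffs_below_iden[OF T] inum_eq[OF T] inum_base[OF T]
  note S1 = coeffs_below_inum[OF S(1,2) i] coeffs_below_iden[OF S(1,2) i] inum_eq[OF S(1,2) i]
    inum_base[OF S(1,2) i]
  define \<beta> where "\<beta> = coeff (inum \<sigma> ?T c (Suc i)) n / coeff (inum \<sigma> S c i) n"
  have l: "(- 1) ^ n * coeff (inum \<sigma> S c i) n > 0" "(- 1) ^ n * coeff (inum \<sigma> ?T c (Suc i)) n > 0"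
    using inum_lead_sign[OF S(1,2) i] inum_lead_sign[OF T] n by auto
  have "\<beta> = ((- 1) ^ n * coeff (inum \<sigma> ?T c (Suc i)) n) / ((- 1) ^ n * coeff (inum \<sigma> S c i) n)"
    by (simp add: \<beta>_def)
  also have "\<dots> > 0" using l by (rule divide_pos_pos[rotated])
  finally have \<beta>: "\<beta> > 0" .
  let ?p = "inum \<sigma> ?T c (Suc i) - smult \<beta> (inum \<sigma> S c i)"
  let ?q = "iden \<sigma> ?T c (Suc i) - smult \<beta> (iden \<sigma> S c i)"
  have cz: "coeff ?p n = 0" using l by (auto simp: \<beta>_def)
  have "coeffs_below (Suc n) ?p"
    using T1(1) S1(1) n by (auto intro!: coeffs_below_diff coeffs_below_smult)
  then have p: "coeffs_below (card S - Suc i) ?p" using coeffs_below_Suc_drop cz n by metis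
  have q: "coeffs_below (Suc (Suc i)) ?q"
    using T1(2) S1(2) by (auto intro!: coeffs_below_diff coeffs_below_smult elim: coeffs_below_mono)
  have z: "poly ?p x = poly ?q x * exp (- \<sigma> * x)" if "x \<in> S" for x
    using T1(3)[of x] S1(3)[of x] that by (simp add: algebra_simps)
  have pc: "poly ?p c = 1 - \<beta>" using T1(4) S1(4) by simp
  note u = interp_unique[OF S(1,2,4) p q z, unfolded pc]
  have "coeff ?q (Suc i) = (1 - \<beta>) * coeff (iden \<sigma> S c (Suc i)) (Suc i)"
    by (subst u(2)) simp_all
  moreover have "coeff ?q (Suc i) = coeff (iden \<sigma> ?T c (Suc i)) (Suc i)"
    using S1(2) by (simp add: coeffs_below_def)
  ultimately have \<beta>1: "1 - \<beta> > 0" using iden_lead_pos[OF T] iden_lead_pos[OF S(1,2,4)]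
    by (metis zero_less_mult_pos2)
  have eq: "inum \<sigma> ?T c (Suc i) = smult (1 - (1 - \<beta>)) (inum \<sigma> S c i) + smult (1 - \<beta>) (inum \<sigma> S c (Suc i))"
    using u(1) by (simp add: algebra_simps)
  show ?thesis by (rule that[OF \<beta>1 _ eq]) (use \<beta> in simp)
qed

text \<open>The factor y - x supplies the interpolation condition at the new node at the price of
  one more coefficient on each side, so the product is a combination of two neighbouring types over
  the larger set. That \<xi> does not depend on x will allow its elimination between two
  coordinates.\<close>

lemma inum_insert_relation:
  assumes S: "finite S" "c \<in> S" "y \<notin> S" "i < card S"
  obtains \<xi> where "0 \<le> \<xi>"
    "\<And>x. (y - x) * poly (inum \<sigma> S c i) x =
      (y - c + \<xi>) * poly (inum \<sigma> (insert y S) c i) x - \<xi> * poly (inum \<sigma> (insert y S) c (Suc i)) x"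
proof -
  let ?T = "insert y S"
  have T: "finite ?T" "c \<in> ?T" "Suc i < card ?T" "i < card ?T" using S by auto
  define n where "n = card S - i"
  have n: "card S - i = n" "card ?T - i = Suc n" "card ?T - Suc i = n"
    using S by (auto simp: n_def)
  note T1 = coeffs_below_inum[OF T(1,2,4)] coeffs_below_iden[OF T(1,2,4)] inum_eq[OF T(1,2,4)] inum_base[OF T(1,2,4)]
  note T2 = coeffs_below_inum[OF T(1,2,3)] coeffs_below_iden[OF T(1,2,3)] inum_eq[OF T(1,2,3)] inum_base[OF T(1,2,3)]
  note S1 = coeffs_below_inum[OF S(1,2,4)] coeffs_below_iden[OF S(1,2,4)] inum_eq[OF S(1,2,4)] inum_base[OF S(1,2,4)]
  define P where "P = [:y, -1:] * inum \<sigma> S c i"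
  define Q where "Q = [:y, -1:] * iden \<sigma> S c i"
  have PQ: "coeffs_below (Suc n) P" "coeffs_below (Suc (Suc i)) Q"
    unfolding P_def Q_def using S1(1,2) n by (metis coeffs_below_linear_mult)+
  have PQz: "poly P x = poly Q x * exp (- \<sigma> * x)" if "x \<in> ?T" for x
    using that S1(3)[of x] by (auto simp: P_def Q_def algebra_simps)
  have l: "(- 1) ^ n * coeff (inum \<sigma> ?T c i) n > 0"
    using inum_lead_sign[OF T(1,2,4)] n by auto
  define \<alpha> where "\<alpha> = coeff P n / coeff (inum \<sigma> ?T c i) n"
  let ?p = "P - smult \<alpha> (inum \<sigma> ?T c i)" and ?q = "Q - smult \<alpha> (iden \<sigma> ?T c i)"
  have cz: "coeff ?p n = 0" using l by (auto simp: \<alpha>_def)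
  have "coeffs_below (Suc n) ?p"
    using T1(1) PQ(1) n by (auto intro!: coeffs_below_diff coeffs_below_smult)
  then have p: "coeffs_below (card ?T - Suc i) ?p" using coeffs_below_Suc_drop cz n by metis
  have q: "coeffs_below (Suc (Suc i)) ?q"
    using T1(2) PQ(2) by (auto intro!: coeffs_below_diff coeffs_below_smult elim: coeffs_below_mono)
  have z: "poly ?p x = poly ?q x * exp (- \<sigma> * x)" if "x \<in> ?T" for x
    using T1(3)[of x] PQz[of x] that by (simp add: algebra_simps)
  have pc: "poly ?p c = (y - c) - \<alpha>" using T1(4) S1(4) by (simp add: P_def)
  note u = interp_unique[OF T(1,2,3) p q z, unfolded pc]
  have "coeff ?q (Suc i) = ((y - c) - \<alpha>) * coeff (iden \<sigma> ?T c (Suc i)) (Suc i)"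
    by (subst u(2)) simp_all
  moreover have "coeff ?q (Suc i) = - coeff (iden \<sigma> S c i) i"
    using T1(2) S1(2) by (simp add: Q_def coeffs_below_def)
  ultimately have "coeff (iden \<sigma> S c i) i = (\<alpha> - (y - c)) * coeff (iden \<sigma> ?T c (Suc i)) (Suc i)"
    by (simp add: algebra_simps)
  then have pos: "\<alpha> - (y - c) > 0" using iden_lead_pos[OF T(1,2,3)] iden_lead_pos[OF S(1,2,4)]
    by (metis zero_less_mult_pos2)
  have eq: "(y - x) * poly (inum \<sigma> S c i) x =
      (y - c + (\<alpha> - (y - c))) * poly (inum \<sigma> ?T c i) x - (\<alpha> - (y - c)) * poly (inum \<sigma> ?T c (Suc i)) x" for x
    using arg_cong[OF u(1), of "\<lambda>p. poly p x"] by (simp add: P_def algebra_simps)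
  show ?thesis by (rule that[OF less_imp_le[OF pos] eq])
qed

lemma inum_first:
  assumes S: "finite S" "c \<in> S" "x \<in> S"
  shows "poly (inum \<sigma> S c 0) x = exp (- \<sigma> * (x - c))"
proof -
  have 0: "0 < card S" using S card_gt_0_iff by blast
  have q: "poly (iden \<sigma> S c 0) z = coeff (iden \<sigma> S c 0) 0" for z
    using coeffs_below_1_poly[OF coeffs_below_iden[OF S(1,2) 0]] .
  have "poly (iden \<sigma> S c 0) x = exp (\<sigma> * c)"
    using iden_base[OF S(1,2) 0] unfolding q .
  then show ?thesis using inum_eq[OF S(1,2) 0 S(3)] by (simp add: exp_add[symmetric] algebra_simps)
qed

lemma inum_last:
  assumes S: "finite S" "c \<in> S" "card S = Suc m"
  shows "poly (inum \<sigma> S c m) x = 1"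
proof -
  have m: "m < card S" using S by simp
  have "coeffs_below (Suc 0) (inum \<sigma> S c m)" using coeffs_below_inum[OF S(1,2) m] S by simp
  from coeffs_below_1_poly[OF this] inum_base[OF S(1,2) m] show ?thesis by simp
qed

end

section \<open>Control points over a Muntz space\<close>

locale muntz_interval =
  fixes r :: "nat \<Rightarrow> real" and a b :: real
  assumes r0: "r 0 = 0" and r_mono: "strict_mono r" and a_pos: "0 < a" and ab: "a < b"
begin

definition \<sigma> :: real where "\<sigma> = ln (b / a)"

definition nodes :: "nat \<Rightarrow> real set" where "nodes m = r ` {..m}"

text \<open>With \<open>t = b * exp (- s)\<close> the control points of \<open>exp (- s * r j)\<close> over
  \<open>[a, b]\<close> in the space of order \<open>m\<close> are the node values of the interpolation numerators.\<close>

definition cv :: "nat \<Rightarrow> nat \<Rightarrow> nat \<Rightarrow> real" where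
  "cv m i j = poly (inum \<sigma> (nodes m) 0 i) (r j)"

lemma \<sigma>_pos: "\<sigma> > 0"
  using a_pos ab by (simp add: \<sigma>_def)

lemma r_eq_iff [simp]: "r i = r j \<longleftrightarrow> i = j"
  using strict_mono_eq[OF r_mono] .

lemma r_less_iff [simp]: "r i < r j \<longleftrightarrow> i < j"
  using strict_mono_less[OF r_mono] .

lemma r_pos: "0 < i \<Longrightarrow> 0 < r i"
  using r_less_iff[of 0 i] r0 by simp

lemma r_nonneg [simp]: "0 \<le> r i"
  using r_pos[of i] r0 by (cases i) auto

lemma r_inj: "inj_on r A"
  by (auto simp: inj_on_def)

lemma finite_nodes [simp]: "finite (nodes m)"
  by (simp add: nodes_def)

lemma card_nodes [simp]: "card (nodes m) = Suc m"
  by (simp add: nodes_def card_image r_inj)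

lemma r_in_nodes: "r j \<in> nodes m \<longleftrightarrow> j \<le> m"
  by (auto simp: nodes_def)

lemma zero_in_nodes [simp]: "0 \<in> nodes m"
  using r_in_nodes[of 0 m] r0 by simp

lemma nodes_Suc: "nodes (Suc m) = insert (r (Suc m)) (nodes m)"
  by (auto simp: nodes_def atMost_Suc)

lemmas node_facts = coeffs_below_inum[OF \<sigma>_pos finite_nodes zero_in_nodes, unfolded card_nodes]
  coeffs_below_iden[OF \<sigma>_pos finite_nodes zero_in_nodes, unfolded card_nodes]
  inum_eq[OF \<sigma>_pos finite_nodes zero_in_nodes, unfolded card_nodes]
  inum_base[OF \<sigma>_pos finite_nodes zero_in_nodes, unfolded card_nodes]
  iden_base[OF \<sigma>_pos finite_nodes zero_in_nodes, unfolded card_nodes]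
  inum_lead_sign[OF \<sigma>_pos finite_nodes zero_in_nodes, unfolded card_nodes]
  iden_lead_pos[OF \<sigma>_pos finite_nodes zero_in_nodes, unfolded card_nodes]

lemma cv_base [simp]: "i \<le> m \<Longrightarrow> cv m i 0 = 1"
  using node_facts(4)[of i m] by (simp add: cv_def r0)

lemma cv_first: "j \<le> m \<Longrightarrow> cv m 0 j = exp (- \<sigma> * r j)"
  using inum_first[OF \<sigma>_pos finite_nodes zero_in_nodes, of "r j" m] by (simp add: cv_def r_in_nodes)

lemma cv_last: "cv m m j = 1"
  unfolding cv_def by (rule inum_last[OF \<sigma>_pos]) auto

lemma cv_less_Suc: "0 < j \<Longrightarrow> j \<le> m \<Longrightarrow> i < m \<Longrightarrow> cv m i j < cv m (Suc i) j"
  unfolding cv_def by (rule inum_strict_mono[OF \<sigma>_pos]) (auto simp: r_in_nodes r_pos)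

lemma cv_slopes:
  "0 < j \<Longrightarrow> j < k \<Longrightarrow> k \<le> m \<Longrightarrow> Suc i < m \<Longrightarrow>
   (cv m (Suc i) k - cv m i k) * (cv m (Suc (Suc i)) j - cv m (Suc i) j)
   < (cv m (Suc (Suc i)) k - cv m (Suc i) k) * (cv m (Suc i) j - cv m i j)"
  unfolding cv_def by (rule inum_slopes_increasing[OF \<sigma>_pos]) (auto simp: r_in_nodes r_pos)

lemma cv_elevation:
  assumes "i < m"
  obtains \<alpha> where "0 < \<alpha>" "\<alpha> < 1"
    "\<And>j. cv (Suc m) (Suc i) j = (1 - \<alpha>) * cv m i j + \<alpha> * cv m (Suc i) j"
proof -
  have "r (Suc m) \<notin> nodes m" "Suc i < card (nodes m)" using assms by (auto simp: r_in_nodes)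
  from inum_elevation[OF \<sigma>_pos finite_nodes zero_in_nodes this] obtain \<alpha> where
    "0 < \<alpha>" "\<alpha> < 1" "inum \<sigma> (nodes (Suc m)) 0 (Suc i) =
      smult (1 - \<alpha>) (inum \<sigma> (nodes m) 0 i) + smult \<alpha> (inum \<sigma> (nodes m) 0 (Suc i))"
    unfolding nodes_Suc .
  then show ?thesis using that[of \<alpha>] by (simp add: cv_def)
qed

lemma cv_Suc_relation:
  assumes "i \<le> m"
  obtains \<xi> where "0 \<le> \<xi>"
    "\<And>j. (r (Suc m) - r j) * cv m i j = (r (Suc m) + \<xi>) * cv (Suc m) i j - \<xi> * cv (Suc m) (Suc i) j"
proof -
  have "r (Suc m) \<notin> nodes m" "i < card (nodes m)" using assms by (auto simp: r_in_nodes)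
  from inum_insert_relation[OF \<sigma>_pos finite_nodes zero_in_nodes this] obtain \<xi> where
    "0 \<le> \<xi>" "\<And>x. (r (Suc m) - x) * poly (inum \<sigma> (nodes m) 0 i) x =
      (r (Suc m) - 0 + \<xi>) * poly (inum \<sigma> (nodes (Suc m)) 0 i) x - \<xi> * poly (inum \<sigma> (nodes (Suc m)) 0 (Suc i)) x"
    unfolding nodes_Suc by blast
  then show ?thesis using that[of \<xi>] by (simp add: cv_def)
qed

text \<open>For f(s) = sum \<beta>_l exp(-s r_l) the moments of \<beta> are, up to sign, the
  derivatives of f at s = 0, that is at t = b. The weight exp(-\<sigma> r_l) in \<open>ord_a\<close>
  moves them to s = \<sigma>, that is to t = a. Both predicates express vanishing to order at least
  k.\<close>

definition ord_b :: "nat \<Rightarrow> nat \<Rightarrow> (nat \<Rightarrow> real) \<Rightarrow> bool" where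
  "ord_b m k \<beta> \<longleftrightarrow> (\<forall>p. coeffs_below k p \<longrightarrow> (\<Sum>l\<le>m. \<beta> l * poly p (r l)) = 0)"

definition ord_a :: "nat \<Rightarrow> nat \<Rightarrow> (nat \<Rightarrow> real) \<Rightarrow> bool" where
  "ord_a m k \<beta> \<longleftrightarrow> (\<forall>p. coeffs_below k p \<longrightarrow> (\<Sum>l\<le>m. \<beta> l * (poly p (r l) * exp (- \<sigma> * r l))) = 0)"

definition ctrl :: "nat \<Rightarrow> nat \<Rightarrow> (nat \<Rightarrow> real) \<Rightarrow> real" where
  "ctrl m i \<beta> = (\<Sum>l\<le>m. \<beta> l * cv m i l)"

lemma ctrl_iden:
  "i \<le> m \<Longrightarrow> ctrl m i \<beta> = (\<Sum>l\<le>m. \<beta> l * (poly (iden \<sigma> (nodes m) 0 i) (r l) * exp (- \<sigma> * r l)))"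
  unfolding ctrl_def cv_def by (intro sum.cong) (auto simp: node_facts(3) r_in_nodes)

lemma ord_b_top:
  assumes "ord_b m (m - k) \<beta>" "k \<le> m" "coeffs_below (Suc (m - k)) p"
  shows "(\<Sum>l\<le>m. \<beta> l * poly p (r l)) * coeff (inum \<sigma> (nodes m) 0 k) (m - k) = coeff p (m - k) * ctrl m k \<beta>"
proof -
  define \<pi> where "\<pi> = coeff (inum \<sigma> (nodes m) 0 k) (m - k)"
  let ?q = "smult \<pi> p - smult (coeff p (m - k)) (inum \<sigma> (nodes m) 0 k)"
  have "coeffs_below (Suc (m - k)) ?q"
    using assms(2,3) node_facts(1)[of k m]
    by (auto intro!: coeffs_below_diff coeffs_below_smult simp: Suc_diff_le)
  moreover have "coeff ?q (m - k) = 0" by (simp add: \<pi>_def)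
  ultimately have "coeffs_below (m - k) ?q" by (rule coeffs_below_Suc_drop)
  with assms(1) have "(\<Sum>l\<le>m. \<beta> l * poly ?q (r l)) = 0" unfolding ord_b_def by blast
  then show ?thesis
    by (simp add: \<pi>_def ctrl_def cv_def algebra_simps sum_subtractf sum_distrib_left sum_distrib_right)
qed

lemma ord_a_top:
  assumes "ord_a m k \<beta>" "k \<le> m" "coeffs_below (Suc k) p"
  shows "(\<Sum>l\<le>m. \<beta> l * (poly p (r l) * exp (- \<sigma> * r l))) * coeff (iden \<sigma> (nodes m) 0 k) k
    = coeff p k * ctrl m k \<beta>"
proof -
  define \<pi> where "\<pi> = coeff (iden \<sigma> (nodes m) 0 k) k"
  let ?q = "smult \<pi> p - smult (coeff p k) (iden \<sigma> (nodes m) 0 k)"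
  have "coeffs_below (Suc k) ?q"
    using assms(2,3) node_facts(2)[of k m] by (auto intro!: coeffs_below_diff coeffs_below_smult)
  moreover have "coeff ?q k = 0" by (simp add: \<pi>_def)
  ultimately have "coeffs_below k ?q" by (rule coeffs_below_Suc_drop)
  with assms(1) have "(\<Sum>l\<le>m. \<beta> l * (poly ?q (r l) * exp (- \<sigma> * r l))) = 0" unfolding ord_a_def by blast
  then show ?thesis unfolding ctrl_iden[OF assms(2)]
    by (simp add: \<pi>_def algebra_simps sum.distrib sum_subtractf sum_distrib_left)
qed

lemma inum_lead_nonzero: "k \<le> m \<Longrightarrow> coeff (inum \<sigma> (nodes m) 0 k) (m - k) \<noteq> 0"
  using node_facts(6)[of k m] by auto

lemma iden_lead_nodes_pos: "k \<le> m \<Longrightarrow> coeff (iden \<sigma> (nodes m) 0 k) k > 0"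
  using node_facts(7)[of k m] by auto

text \<open>A combination of p and q exp(-\<sigma> x) with m + 1 coefficients that vanishes at the
  other m nodes cannot vanish at r l too, so it isolates \<beta> l. The vanishing control value
  supplies the last order at b, which lets p have m - k + 1 coefficients.\<close>

lemma ord_ctrl_zero:
  assumes "ord_b m (m - k) \<beta>" "ord_a m k \<beta>" "ctrl m k \<beta> = 0" "k \<le> m" "l \<le> m"
  shows "\<beta> l = 0"
proof -
  have "finite (nodes m - {r l})" "card (nodes m - {r l}) < Suc (m - k) + k + 0"
    using assms by (auto simp: r_in_nodes)
  from pair_exists_gen[OF this, of \<sigma>] obtain p q where pq:
    "coeffs_below (Suc (m - k)) p" "coeffs_below k q" "p \<noteq> 0 \<or> q \<noteq> 0"
    "\<And>x. x \<in> nodes m - {r l} \<Longrightarrow> poly p x - poly q x * exp (- \<sigma> * x) = 0"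
    by auto
  let ?h = "\<lambda>x. poly p x - poly q x * exp (- \<sigma> * x)"
  have "?h (r l) \<noteq> 0"
  proof
    assume "?h (r l) = 0"
    then have "card (nodes m) < Suc (m - k) + k"
      by (intro zero_count[OF \<sigma>_pos pq(1-3)]) (use pq(4) in auto)
    then show False using assms by simp
  qed
  moreover have "(\<Sum>i\<le>m. \<beta> i * ?h (r i)) = 0"
  proof -
    have "(\<Sum>i\<le>m. \<beta> i * poly p (r i)) = 0"
      using ord_b_top[OF assms(1,4) pq(1)] inum_lead_nonzero[OF assms(4)] assms(3) by simp
    moreover have "(\<Sum>i\<le>m. \<beta> i * (poly q (r i) * exp (- \<sigma> * r i))) = 0"
      using assms(2) pq(2) by (simp add: ord_a_def)
    ultimately show ?thesis by (simp add: right_diff_distrib sum_subtractf)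
  qed
  moreover have "(\<Sum>i\<le>m. \<beta> i * ?h (r i)) = \<beta> l * ?h (r l)"
    by (subst sum.remove[of _ l]) (use assms pq(4) in \<open>auto simp: r_in_nodes intro!: sum.neutral\<close>)
  ultimately show ?thesis by simp
qed

text \<open>The control values are used from i = m downwards, each raising the order of vanishing at
  b by one.\<close>

lemma ctrl_complete:
  assumes "\<And>i. i \<le> m \<Longrightarrow> ctrl m i \<beta> = 0" "l \<le> m"
  shows "\<beta> l = 0"
proof -
  have "ord_b m n \<beta>" if "n \<le> Suc m" for n
    using that
  proof (induction n)
    case (Suc n)
    have "(\<Sum>l\<le>m. \<beta> l * poly p (r l)) = 0" if p: "coeffs_below (Suc n) p" for p
    proof -
      have *: "m - n \<le> m" "m - (m - n) = n" using Suc.prems by auto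
      show ?thesis
        using ord_b_top[of m "m - n" \<beta> p] Suc * p assms(1)[of "m - n"] inum_lead_nonzero[of "m - n" m]
        by simp
    qed
    then show ?case by (simp add: ord_b_def)
  qed (simp add: ord_b_def)
  then have "ord_b m (m - 0) \<beta>" by simp
  moreover have "ord_a m 0 \<beta>" by (simp add: ord_a_def)
  ultimately show ?thesis using ord_ctrl_zero[of m 0] assms by simp
qed

lemma ctrl_eq_0_of_ord:
  assumes "ord_b m (m - k) \<beta>" "ord_a m k \<beta>" "i \<le> m" "k \<le> m" "i \<noteq> k"
  shows "ctrl m i \<beta> = 0"
proof (cases "i < k")
  case True
  have "coeffs_below k (iden \<sigma> (nodes m) 0 i)"
    using node_facts(2)[of i m] True assms(3) by (auto elim: coeffs_below_mono)
  then show ?thesis unfolding ctrl_iden[OF assms(3)] using assms(2) by (simp add: ord_a_def)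
next
  case False
  have "coeffs_below (m - k) (inum \<sigma> (nodes m) 0 i)"
    using node_facts(1)[of i m] False assms(3,5) by (auto elim: coeffs_below_mono)
  then show ?thesis unfolding ctrl_def cv_def using assms(1) by (simp add: ord_b_def)
qed

text \<open>Coefficients of the Chebyshev--Bernstein basis with respect to \<open>exp (- s * r l)\<close>.\<close>

definition bern :: "nat \<Rightarrow> nat \<Rightarrow> nat \<Rightarrow> real" where
  "bern m k = (SOME \<beta>. ord_b m (m - k) \<beta> \<and> ord_a m k \<beta> \<and> ctrl m k \<beta> = 1)"

lemma coeffs_below_expand:
  assumes "coeffs_below n p"
  shows "poly p x = (\<Sum>i<n. coeff p i * x ^ i)"
proof (cases "p = 0")
  case False
  have "n \<ge> Suc (degree p)"
  proof (rule ccontr)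
    assume "\<not> ?thesis"
    then have "lead_coeff p = 0" using assms by (simp add: coeffs_below_def)
    with False show False by simp
  qed
  then have "(\<Sum>i\<le>degree p. coeff p i * x ^ i) = (\<Sum>i<n. coeff p i * x ^ i)"
    by (intro sum.mono_neutral_left) (auto simp: coeff_eq_0 not_le)
  then show ?thesis by (simp add: poly_altdef)
qed simp

lemma bern_exists:
  assumes "k \<le> m"
  shows "\<exists>\<beta>. ord_b m (m - k) \<beta> \<and> ord_a m k \<beta> \<and> ctrl m k \<beta> = 1"
proof -
  \<comment> \<open>m - k conditions at b and k conditions at a, against m + 1 coefficients.\<close>
  define f where "f = (\<lambda>l i. if i < m - k then r l ^ i else r l ^ (i - (m - k)) * exp (- \<sigma> * r l))"
  obtain \<beta> where \<beta>: "\<exists>l\<in>{..m}. \<beta> l \<noteq> 0" "\<forall>i\<in>{..<m}. (\<Sum>l\<in>{..m}. \<beta> l * f l i) = 0"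
    using homogeneous_system_solution[of "{..<m}" "{..m}" f] by auto
  have b: "ord_b m (m - k) \<beta>" unfolding ord_b_def
  proof (intro allI impI)
    fix p assume p: "coeffs_below (m - k) p"
    have "(\<Sum>l\<le>m. \<beta> l * poly p (r l)) = (\<Sum>i<m-k. coeff p i * (\<Sum>l\<le>m. \<beta> l * f l i))"
      unfolding coeffs_below_expand[OF p] sum_distrib_left
      by (subst sum.swap) (auto simp: f_def intro!: sum.cong)
    also have "\<dots> = 0" using \<beta>(2) by (intro sum.neutral) auto
    finally show "(\<Sum>l\<le>m. \<beta> l * poly p (r l)) = 0" .
  qed
  have a: "ord_a m k \<beta>" unfolding ord_a_def
  proof (intro allI impI)
    fix p assume p: "coeffs_below k p"
    have "(\<Sum>l\<le>m. \<beta> l * (poly p (r l) * exp (- \<sigma> * r l))) = (\<Sum>i<k. coeff p i * (\<Sum>l\<le>m. \<beta> l * f l (m - k + i)))"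
      unfolding coeffs_below_expand[OF p] sum_distrib_left sum_distrib_right
      by (subst sum.swap) (auto simp: f_def intro!: sum.cong)
    also have "\<dots> = 0" using \<beta>(2) assms by (intro sum.neutral) auto
    finally show "(\<Sum>l\<le>m. \<beta> l * (poly p (r l) * exp (- \<sigma> * r l))) = 0" .
  qed
  define c where "c = ctrl m k \<beta>"
  have "c \<noteq> 0" using ord_ctrl_zero[OF b a] \<beta>(1) assms c_def by auto
  have sc: "(\<Sum>l\<le>m. \<beta> l / c * g l) = (\<Sum>l\<le>m. \<beta> l * g l) / c" for g
    by (simp add: sum_divide_distrib)
  have "ord_b m (m - k) (\<lambda>l. \<beta> l / c)" "ord_a m k (\<lambda>l. \<beta> l / c)"
    using a b unfolding ord_a_def ord_b_def sc by simp_all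
  moreover have "ctrl m k (\<lambda>l. \<beta> l / c) = 1"
    using \<open>c \<noteq> 0\<close> unfolding ctrl_def sc by (simp add: c_def ctrl_def)
  ultimately show ?thesis by blast
qed

lemma bern:
  assumes "k \<le> m"
  shows "ord_b m (m - k) (bern m k)" "ord_a m k (bern m k)" "ctrl m k (bern m k) = 1"
  unfolding bern_def using someI_ex[OF bern_exists[OF assms]] by auto

lemma ctrl_bern: "i \<le> m \<Longrightarrow> k \<le> m \<Longrightarrow> ctrl m i (bern m k) = (if i = k then 1 else 0)"
  using bern(3) ctrl_eq_0_of_ord[OF bern(1,2), of k m i] by auto

lemma ctrl_diff: "ctrl m i (\<lambda>l. \<beta> l - \<gamma> l) = ctrl m i \<beta> - ctrl m i \<gamma>"
  by (simp add: ctrl_def left_diff_distrib sum_subtractf)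

lemma ctrl_sum: "ctrl m i (\<lambda>l. \<Sum>k\<in>K. c k * \<beta> k l) = (\<Sum>k\<in>K. c k * ctrl m i (\<beta> k))"
  unfolding ctrl_def sum_distrib_right sum_distrib_left by (subst sum.swap) (simp add: mult_ac)

lemma bern_expansion:
  assumes "l \<le> m"
  shows "\<beta> l = (\<Sum>k\<le>m. ctrl m k \<beta> * bern m k l)"
proof -
  have "ctrl m i (\<lambda>l. \<beta> l - (\<Sum>k\<le>m. ctrl m k \<beta> * bern m k l)) = 0" if "i \<le> m" for i
    unfolding ctrl_diff ctrl_sum using that by (simp add: ctrl_bern if_distrib cong: if_cong)
  from ctrl_complete[OF this assms] show ?thesis by simp
qed

section \<open>Partition of unity and positivity of the Bernstein functions\<close>

definition bf :: "nat \<Rightarrow> nat \<Rightarrow> real \<Rightarrow> real" where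
  "bf m k s = (\<Sum>l\<le>m. bern m k l * exp (- s * r l))"

lemma exp_expansion:
  assumes "j \<le> m"
  shows "exp (- s * r j) = (\<Sum>k\<le>m. cv m k j * bf m k s)"
proof -
  have c: "ctrl m k (\<lambda>l. if l = j then 1 else 0) = cv m k j" for k
    using assms by (simp add: ctrl_def if_distrib[of "\<lambda>x. x * _"] cong: if_cong)
  have "exp (- s * r j) = (\<Sum>l\<le>m. (if l = j then 1 else 0) * exp (- s * r l))"
    using assms by (simp add: if_distrib[of "\<lambda>x. x * _"] cong: if_cong)
  also have "\<dots> = (\<Sum>l\<le>m. (\<Sum>k\<le>m. cv m k j * bern m k l) * exp (- s * r l))"
    by (intro sum.cong refl) (use bern_expansion[of _ m "\<lambda>l. if l = j then 1 else 0"] c in auto)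
  also have "\<dots> = (\<Sum>k\<le>m. cv m k j * bf m k s)"
    unfolding bf_def sum_distrib_left sum_distrib_right by (subst sum.swap) (simp add: mult_ac)
  finally show ?thesis .
qed

lemma bf_sum: "(\<Sum>k\<le>m. bf m k s) = 1"
  using exp_expansion[of 0 m s] by (simp add: r0)

text \<open>Pair the basis coefficients with a nontrivial p - q exp(-\<sigma> x) - g exp(-s x) that
  vanishes on all nodes. The q part is killed by the zero at a, the p part depends only on its top
  coefficient, so g times the Bernstein function is that coefficient over \<pi>. The signs come from
  \<open>lead_sign_three\<close> and \<open>inum_lead_sign\<close>.\<close>

lemma bf_pos:
  assumes "k \<le> m" "0 < s" "s < \<sigma>"
  shows "bf m k s > 0"
proof -
  have "card (nodes m) < Suc (m - k) + k + 1" using assms by simp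
  from pair_exists_gen[OF finite_nodes this, of \<sigma> s] obtain p q g where pq:
    "coeffs_below (Suc (m - k)) p" "coeffs_below k q" "p \<noteq> 0 \<or> q \<noteq> 0 \<or> g \<noteq> 0"
    "\<And>x. x \<in> nodes m \<Longrightarrow> poly p x - poly q x * exp (- \<sigma> * x) - g * exp (- s * x) = 0"
    by auto
  define n where "n = m - k"
  define \<pi> where "\<pi> = coeff (inum \<sigma> (nodes m) 0 k) n"
  have 1: "(- 1) ^ n * coeff p n * g > 0"
    unfolding n_def by (rule lead_sign_three[OF assms(2,3) pq(1-3) finite_nodes _ pq(4)]) (use assms in auto)
  have 2: "(- 1) ^ n * \<pi> > 0"
    using node_facts(6)[of k m] assms(1) by (simp add: \<pi>_def n_def)
  have "(\<Sum>l\<le>m. bern m k l * (poly p (r l) - poly q (r l) * exp (- \<sigma> * r l) - g * exp (- s * r l))) = 0"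
    using pq(4) by (intro sum.neutral) (auto simp: r_in_nodes)
  then have "(\<Sum>l\<le>m. bern m k l * poly p (r l)) - (\<Sum>l\<le>m. bern m k l * (poly q (r l) * exp (- \<sigma> * r l)))
     - g * bf m k s = 0"
    by (simp add: bf_def sum_distrib_left sum_subtractf right_diff_distrib mult_ac)
  moreover have "(\<Sum>l\<le>m. bern m k l * (poly q (r l) * exp (- \<sigma> * r l))) = 0"
    using bern(2)[OF assms(1)] pq(2) by (simp add: ord_a_def)
  ultimately have "(\<Sum>l\<le>m. bern m k l * poly p (r l)) = g * bf m k s" by simp
  with ord_b_top[OF bern(1)[OF assms(1)] assms(1) pq(1)] bern(3)[OF assms(1)]
  have 3: "g * bf m k s * \<pi> = coeff p n" by (simp add: n_def \<pi>_def)
  have "((- 1) ^ n * \<pi>) * ((g * g) * bf m k s) = (- 1) ^ n * coeff p n * g"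
    unfolding 3[symmetric] by (simp add: mult_ac)
  with 1 have "((- 1) ^ n * \<pi>) * ((g * g) * bf m k s) > 0" by metis
  then have 4: "(g * g) * bf m k s > 0" using 2 by (rule zero_less_mult_pos)
  have "g \<noteq> 0" using 1 by auto
  then have "g * g > 0" by (metis not_real_square_gt_zero)
  with 4 show ?thesis by (rule zero_less_mult_pos)
qed

lemma bf_nonneg:
  assumes "k \<le> m" "0 \<le> s" "s \<le> \<sigma>"
  shows "bf m k s \<ge> 0"
proof -
  consider "s = 0" | "s = \<sigma>" | "0 < s" "s < \<sigma>" using assms by linarith
  then show ?thesis
  proof cases
    case 1
    show ?thesis
    proof (cases "k = m")
      case True
      then show ?thesis using bern(3)[OF assms(1)] 1 by (simp add: bf_def ctrl_def cv_last)
    next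
      case False
      then obtain n where "m - k = Suc n" using assms(1) by (metis Suc_diff_Suc le_neq_implies_less)
      then have "coeffs_below (m - k) [:1:]" by simp
      with bern(1)[OF assms(1)] have "(\<Sum>l\<le>m. bern m k l * poly [:1:] (r l)) = 0" unfolding ord_b_def by blast
      then show ?thesis using 1 by (simp add: bf_def)
    qed
  next
    case 2
    show ?thesis
    proof (cases k)
      case 0
      have "ctrl m 0 (bern m 0) = bf m 0 \<sigma>" unfolding ctrl_def bf_def by (intro sum.cong) (auto simp: cv_first)
      then show ?thesis using bern(3)[of 0 m] 0 2 by simp
    next
      case (Suc n)
      then have "coeffs_below k [:1:]" by simp
      with bern(2)[OF assms(1)] have "(\<Sum>l\<le>m. bern m k l * (poly [:1:] (r l) * exp (- \<sigma> * r l))) = 0"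
        unfolding ord_a_def by blast
      then show ?thesis using 2 by (simp add: bf_def)
    qed
  qed (use bf_pos assms in \<open>auto intro: less_imp_le\<close>)
qed

lemma bf_le_1:
  assumes "k \<le> m" "0 \<le> s" "s \<le> \<sigma>"
  shows "bf m k s \<le> 1"
proof -
  have "bf m k s \<le> (\<Sum>k\<le>m. bf m k s)"
    using assms bf_nonneg by (intro member_le_sum) auto
  then show ?thesis by (simp add: bf_sum)
qed

text \<open>The sum is, up to the sign (-1)^k, the k-th derivative of \<open>bf m k\<close> at s =
  \<sigma>. Lower bounds for the leading denominator coefficient are thus upper bounds for a
  derivative.\<close>

lemma bern_lead:
  assumes "k \<le> m"
  shows "coeff (iden \<sigma> (nodes m) 0 k) k * (\<Sum>l\<le>m. bern m k l * (r l ^ k * exp (- \<sigma> * r l))) = 1"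
proof -
  have c: "coeffs_below (Suc k) (monom 1 k)" by (auto simp: coeffs_below_def)
  show ?thesis
    using ord_a_top[OF bern(2)[OF assms] assms c] bern(3)[OF assms] by (simp add: poly_monom mult_ac)
qed

end

section \<open>The Chebyshev--Bernstein basis\<close>

text \<open>Falling factorial x (x - 1) ... (x - j + 1), the factor produced by j derivatives of t
  powr x.\<close>

definition ffp :: "nat \<Rightarrow> real poly" where
  "ffp j = (\<Prod>i<j. [:- real i, 1:])"

lemma ffp_Suc: "ffp (Suc j) = [:- real j, 1:] * ffp j"
  by (simp add: ffp_def mult.commute)

lemma ffp_coeffs: "coeffs_below (Suc j) (ffp j) \<and> coeff (ffp j) j = 1"
proof (induction j)
  case 0
  then show ?case by (auto simp: ffp_def coeffs_below_def)
next
  case (Suc j)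
  then have "coeff (ffp j) (Suc j) = 0" by (simp add: coeffs_below_def)
  then show ?case using Suc unfolding ffp_Suc
    by (auto intro: coeffs_below_linear_mult simp del: mult_pCons_left) (simp add: mult_pCons_left)
qed

lemma has_field_derivative_powr_sum:
  fixes x :: real
  assumes "x > 0"
  shows "((\<lambda>t. \<Sum>k\<le>n. c k * t powr e k) has_field_derivative (\<Sum>k\<le>n. (c k * e k) * x powr (e k - 1))) (at x)"
proof (rule DERIV_sum)
  fix k
  have "((\<lambda>t. c k * t powr e k) has_field_derivative c k * (e k * x powr (e k - 1))) (at x)"
    by (intro DERIV_cmult has_real_derivative_powr assms)
  then show "((\<lambda>t. c k * t powr e k) has_field_derivative (c k * e k) * x powr (e k - 1)) (at x)"
    by (simp add: mult.assoc)
qed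

lemma higher_deriv_powr_sum:
  fixes x :: real
  assumes "x > 0"
  shows "(deriv ^^ j) (\<lambda>t. \<Sum>k\<le>n. c k * t powr r k) x
     = (\<Sum>k\<le>n. (c k * poly (ffp j) (r k)) * x powr (r k - real j))"
  using assms
proof (induction j arbitrary: x)
  case 0
  then show ?case by (simp add: ffp_def)
next
  case (Suc j)
  have "\<forall>\<^sub>F y in nhds x. y > 0" using Suc.prems eventually_nhds_in_open[of "{0<..}" x] by simp
  then have ev: "\<forall>\<^sub>F y in nhds x. (deriv ^^ j) (\<lambda>t. \<Sum>k\<le>n. c k * t powr r k) y
     = (\<Sum>k\<le>n. (c k * poly (ffp j) (r k)) * y powr (r k - real j))"
    by eventually_elim (rule Suc.IH)
  have "(deriv ^^ Suc j) (\<lambda>t. \<Sum>k\<le>n. c k * t powr r k) x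
     = deriv (\<lambda>y. \<Sum>k\<le>n. (c k * poly (ffp j) (r k)) * y powr (r k - real j)) x"
    using deriv_cong_ev[OF ev refl] by simp
  also have "\<dots> = (\<Sum>k\<le>n. (c k * poly (ffp j) (r k) * (r k - real j)) * x powr (r k - real j - 1))"
    by (intro DERIV_imp_deriv has_field_derivative_powr_sum Suc.prems)
  also have "\<dots> = (\<Sum>k\<le>n. (c k * poly (ffp (Suc j)) (r k)) * x powr (r k - real (Suc j)))"
    by (intro sum.cong refl) (simp add: ffp_Suc algebra_simps)
  finally show ?case .
qed

text \<open>The falling factorials are monic of every degree, so vanishing of their first k moments
  spreads to all polynomials with k coefficients.\<close>

lemma moments_ffp:
  assumes "\<forall>j<k. (\<Sum>l\<le>m. w l * poly (ffp j) (r l)) = (0 :: real)" "coeffs_below k p"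
  shows "(\<Sum>l\<le>m. w l * poly p (r l)) = 0"
  using assms
proof (induction k arbitrary: p)
  case (Suc k)
  let ?q = "p - smult (coeff p k) (ffp k)"
  have "coeffs_below (Suc k) ?q" "coeff ?q k = 0"
    using Suc.prems(2) ffp_coeffs[of k] by (auto intro!: coeffs_below_diff coeffs_below_smult)
  then have "coeffs_below k ?q" by (rule coeffs_below_Suc_drop)
  then have "(\<Sum>l\<le>m. w l * poly ?q (r l)) = 0"
    by (rule Suc.IH[rotated]) (use Suc.prems(1) in simp)
  moreover have "(\<Sum>l\<le>m. w l * poly ?q (r l)) = (\<Sum>l\<le>m. w l * poly p (r l)) - coeff p k * (\<Sum>l\<le>m. w l * poly (ffp k) (r l))"
    by (simp add: algebra_simps sum_subtractf sum_distrib_left)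
  ultimately show ?case using Suc.prems(1) by simp
qed simp

lemma zero_mult_powr_sum:
  fixes x :: real
  assumes "x > 0"
  shows "zero_mult (\<lambda>t. \<Sum>l\<le>m. c l * t powr r l) x k \<longleftrightarrow>
    (\<forall>p. coeffs_below k p \<longrightarrow> (\<Sum>l\<le>m. (c l * x powr r l) * poly p (r l)) = 0) \<and>
    (\<Sum>l\<le>m. (c l * x powr r l) * poly (ffp k) (r l)) \<noteq> 0"
proof -
  have d: "(deriv ^^ j) (\<lambda>t. \<Sum>l\<le>m. c l * t powr r l) x
     = (\<Sum>l\<le>m. (c l * x powr r l) * poly (ffp j) (r l)) / x powr real j" for j
    unfolding higher_deriv_powr_sum[OF assms] sum_divide_distrib
    by (intro sum.cong refl) (simp add: powr_diff)
  have "zero_mult (\<lambda>t. \<Sum>l\<le>m. c l * t powr r l) x k \<longleftrightarrow>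
    (\<forall>j<k. (\<Sum>l\<le>m. (c l * x powr r l) * poly (ffp j) (r l)) = 0) \<and>
    (\<Sum>l\<le>m. (c l * x powr r l) * poly (ffp k) (r l)) \<noteq> 0"
    using assms unfolding zero_mult_def d by simp
  moreover have "(\<forall>j<k. (\<Sum>l\<le>m. (c l * x powr r l) * poly (ffp j) (r l)) = 0) \<longleftrightarrow>
    (\<forall>p. coeffs_below k p \<longrightarrow> (\<Sum>l\<le>m. (c l * x powr r l) * poly p (r l)) = 0)"
  proof safe
    fix p assume "\<forall>j<k. (\<Sum>l\<le>m. (c l * x powr r l) * poly (ffp j) (r l)) = 0" "coeffs_below k p"
    then show "(\<Sum>l\<le>m. (c l * x powr r l) * poly p (r l)) = 0" by (rule moments_ffp)
  next
    fix j assume *: "\<forall>p. coeffs_below k p \<longrightarrow> (\<Sum>l\<le>m. (c l * x powr r l) * poly p (r l)) = 0" "j < k"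
    have "coeffs_below k (ffp j)" using ffp_coeffs[of j] *(2) by (auto elim: coeffs_below_mono)
    with * show "(\<Sum>l\<le>m. (c l * x powr r l) * poly (ffp j) (r l)) = 0" by blast
  qed
  ultimately show ?thesis by blast
qed

lemma moments_zero_imp_zero:
  fixes r w :: "nat \<Rightarrow> real"
  assumes "inj_on r {..m}" "\<And>p. (\<Sum>l\<le>m. w l * poly p (r l)) = 0" "i \<le> m"
  shows "w i = 0"
proof -
  define p where "p = (\<Prod>l\<in>{..m} - {i}. [:- r l, 1:])"
  have p: "poly p x = (\<Prod>l\<in>{..m} - {i}. x - r l)" for x by (simp add: p_def poly_prod)
  have z: "poly p (r l) = 0" if "l \<le> m" "l \<noteq> i" for l unfolding p using that by (intro prod_zero) auto
  have "poly p (r i) \<noteq> 0" unfolding p using assms(1,3) by (auto simp: inj_on_def)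
  moreover have "(\<Sum>l\<le>m. w l * poly p (r l)) = w i * poly p (r i)"
    by (subst sum.remove[of _ i]) (use assms z in \<open>auto intro!: sum.neutral\<close>)
  ultimately show ?thesis using assms(2) by simp
qed

text \<open>All derivatives vanish at t = 1, where every power equals 1, so all polynomial moments
  of c vanish.\<close>

lemma powr_sum_zero:
  fixes r c :: "nat \<Rightarrow> real"
  assumes "inj_on r {..m}" "\<And>t. t > 0 \<Longrightarrow> (\<Sum>l\<le>m. c l * t powr r l) = 0" "i \<le> m"
  shows "c i = 0"
proof -
  have ev: "\<forall>\<^sub>F t in nhds (1::real). (\<Sum>l\<le>m. c l * t powr r l) = 0"
    using assms(2) eventually_nhds_in_open[of "{0<..}" "1::real"] by (auto elim: eventually_mono)
  have z: "(deriv ^^ j) (\<lambda>t. \<Sum>l\<le>m. c l * t powr r l) (1::real) = 0" for j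
  proof -
    have "(deriv ^^ j) (\<lambda>t. \<Sum>l\<le>m. c l * t powr r l) (1::real) = (deriv ^^ j) (\<lambda>t. 0) 1"
      by (rule higher_deriv_cong_ev[OF ev refl])
    also have "(deriv ^^ j) (\<lambda>t::real. 0::real) = (\<lambda>t. 0)" by (induction j) simp_all
    finally show ?thesis by simp
  qed
  have "(\<Sum>l\<le>m. c l * poly (ffp j) (r l)) = 0" for j
    using z[of j] by (simp add: higher_deriv_powr_sum)
  then have "(\<Sum>l\<le>m. c l * poly p (r l)) = 0" for p
    using moments_ffp[where w = c and k = "Suc (degree p)" and p = p] coeffs_below_degree by blast
  with assms show ?thesis by (intro moments_zero_imp_zero[of r m c i])
qed

context muntz_interval
begin

lemma b_pos: "0 < b" using a_pos ab by simp

lemma a_powr: "a powr x = b powr x * exp (- \<sigma> * x)"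
proof -
  have "\<sigma> = ln b - ln a" using a_pos b_pos by (simp add: \<sigma>_def ln_div)
  then have "x * ln a = x * (ln b - \<sigma>)" by simp
  then have "x * ln a = x * ln b + - \<sigma> * x" by (simp add: algebra_simps)
  then show ?thesis using a_pos b_pos by (simp add: powr_def exp_add[symmetric])
qed

definition bcoef :: "nat \<Rightarrow> nat \<Rightarrow> nat \<Rightarrow> real" where
  "bcoef m k l = bern m k l / b powr r l"

definition B :: "nat \<Rightarrow> nat \<Rightarrow> real \<Rightarrow> real" where
  "B m k = (if k \<le> m then (\<lambda>t. \<Sum>l\<le>m. bcoef m k l * t powr r l) else (\<lambda>_. 0))"

lemma zero_mult_a: "zero_mult (\<lambda>t. \<Sum>l\<le>m. c l * t powr r l) a k \<longleftrightarrow>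
   ord_a m k (\<lambda>l. c l * b powr r l) \<and>
   (\<Sum>l\<le>m. (c l * b powr r l) * (poly (ffp k) (r l) * exp (- \<sigma> * r l))) \<noteq> 0"
proof -
  have eq: "(c l * a powr r l) * y = (c l * b powr r l) * (y * exp (- \<sigma> * r l))" for l y
    by (simp add: a_powr)
  show ?thesis unfolding zero_mult_powr_sum[OF a_pos] eq ord_a_def ..
qed

lemma zero_mult_b: "zero_mult (\<lambda>t. \<Sum>l\<le>m. c l * t powr r l) b k \<longleftrightarrow>
   ord_b m k (\<lambda>l. c l * b powr r l) \<and>
   (\<Sum>l\<le>m. (c l * b powr r l) * poly (ffp k) (r l)) \<noteq> 0"
  unfolding zero_mult_powr_sum[OF b_pos] ord_b_def ..

lemma bcoef_b: "bcoef m k l * b powr r l = bern m k l"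
  using b_pos by (simp add: bcoef_def)

lemma B_zero_mult:
  assumes "k \<le> m"
  shows "zero_mult (B m k) a k" "zero_mult (B m k) b (m - k)"
proof -
  have "(\<Sum>l\<le>m. bern m k l * (poly (ffp k) (r l) * exp (- \<sigma> * r l))) \<noteq> 0"
    using ord_a_top[OF bern(2)[OF assms] assms, of "ffp k"] bern(3)[OF assms] ffp_coeffs[of k] by auto
  then show "zero_mult (B m k) a k"
    using assms bern(2)[OF assms] by (simp add: B_def zero_mult_a bcoef_b)
  have "(\<Sum>l\<le>m. bern m k l * poly (ffp (m - k)) (r l)) \<noteq> 0"
    using ord_b_top[OF bern(1)[OF assms] assms, of "ffp (m - k)"] bern(3)[OF assms] ffp_coeffs[of "m - k"] by auto
  then show "zero_mult (B m k) b (m - k)"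
    using assms bern(1)[OF assms] by (simp add: B_def zero_mult_b bcoef_b)
qed

lemma B_bf:
  assumes "k \<le> m" "t > 0"
  shows "B m k t = bf m k (ln (b / t))"
proof -
  have "bcoef m k l * t powr r l = bern m k l * exp (- ln (b / t) * r l)" for l
    using assms(2) b_pos by (simp add: bcoef_def powr_def ln_div exp_diff algebra_simps)
  with assms show ?thesis by (simp add: B_def bf_def)
qed

lemma B_sum: "t > 0 \<Longrightarrow> (\<Sum>k\<le>m. B m k t) = 1"
  using bf_sum[of m "ln (b / t)"] by (simp add: B_bf)

lemma CB_basis_eq: "CB_basis r a b m = B m"
  unfolding CB_basis_def
proof (rule the_equality)
  show "(\<forall>k\<le>m. inE r m (B m k) \<and> zero_mult (B m k) a k \<and> zero_mult (B m k) b (m - k)) \<and>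
    (\<forall>t>0. (\<Sum>k\<le>m. B m k t) = 1) \<and> (\<forall>k>m. B m k = (\<lambda>_. 0))"
    using B_zero_mult B_sum by (auto simp: inE_def B_def)
next
  fix D assume D: "(\<forall>k\<le>m. inE r m (D k) \<and> zero_mult (D k) a k \<and> zero_mult (D k) b (m - k)) \<and>
    (\<forall>t>0. (\<Sum>k\<le>m. D k t) = 1) \<and> (\<forall>k>m. D k = (\<lambda>_. 0))"
  then have "\<forall>k\<in>{..m}. \<exists>c. D k = (\<lambda>t. \<Sum>l\<le>m. c l * t powr r l)" by (auto simp: inE_def)
  then obtain d where d: "\<And>k. k \<le> m \<Longrightarrow> D k = (\<lambda>t. \<Sum>l\<le>m. d k l * t powr r l)"
    unfolding bchoice_iff by auto
  define e where "e k l = d k l * b powr r l" for k l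
  have o: "ord_a m k (e k)" "ord_b m (m - k) (e k)" if "k \<le> m" for k
    using D that unfolding e_def d[OF that] using zero_mult_a zero_mult_b by (auto simp: d)
  have sum1: "(\<Sum>k\<le>m. d k l) - (if l = 0 then 1 else 0) = 0" if "l \<le> m" for l
  proof (rule powr_sum_zero[OF r_inj _ that])
    fix t :: real assume t: "t > 0"
    have "(\<Sum>l\<le>m. ((\<Sum>k\<le>m. d k l) - (if l = 0 then 1 else 0)) * t powr r l)
       = (\<Sum>l\<le>m. (\<Sum>k\<le>m. d k l) * t powr r l) - (\<Sum>l\<le>m. if l = 0 then t powr r l else 0)"
      unfolding left_diff_distrib sum_subtractf by (intro arg_cong2[of _ _ _ _ "(-)"] sum.cong) auto
    also have "(\<Sum>l\<le>m. (\<Sum>k\<le>m. d k l) * t powr r l) = (\<Sum>k\<le>m. D k t)"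
      unfolding sum_distrib_right by (subst sum.swap) (auto simp: d)
    also have "\<dots> = 1" using D t by auto
    finally show "(\<Sum>l\<le>m. ((\<Sum>k\<le>m. d k l) - (if l = 0 then 1 else 0)) * t powr r l) = 0"
      using t by (simp add: r0)
  qed
  \<comment> \<open>The k-th control value of every other member is 0 by the zero orders, so that of
    member k equals the control value of the whole sum, which is the constant 1.\<close>
  have c1: "ctrl m k (e k) = 1" if k: "k \<le> m" for k
  proof -
    have "ctrl m k (e k) = (\<Sum>i\<le>m. if i = k then ctrl m k (e i) else 0)" using k by simp
    also have "\<dots> = (\<Sum>i\<le>m. 1 * ctrl m k (e i))"
      using ctrl_eq_0_of_ord[OF o(2) o(1)] k by (intro sum.cong) auto
    also have "\<dots> = ctrl m k (\<lambda>l. \<Sum>i\<le>m. 1 * e i l)" by (rule ctrl_sum[symmetric])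
    also have "\<dots> = (\<Sum>l\<le>m. if l = 0 then 1 else 0)" unfolding ctrl_def
    proof (intro sum.cong refl)
      fix l assume "l \<in> {..m}"
      with sum1[of l] have "(\<Sum>i\<le>m. 1 * e i l) = (if l = 0 then 1 else 0) * b powr r l"
        unfolding e_def by (simp add: sum_distrib_right[symmetric])
      with b_pos k show "(\<Sum>i\<le>m. 1 * e i l) * cv m k l = (if l = 0 then 1 else 0)"
        by (simp add: r0)
    qed
    finally show ?thesis by simp
  qed
  have "d k l = bcoef m k l" if k: "k \<le> m" and l: "l \<le> m" for k l
  proof -
    have "ctrl m i (\<lambda>l. e k l - bern m k l) = 0" if "i \<le> m" for i
      unfolding ctrl_diff using ctrl_bern[OF that k] c1[OF k] ctrl_eq_0_of_ord[OF o(2)[OF k] o(1)[OF k] that k] by auto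
    from ctrl_complete[OF this l] show ?thesis using b_pos by (simp add: e_def bcoef_def field_simps)
  qed
  then have "D k = B m k" if "k \<le> m" for k
    using that unfolding B_def by (simp add: d)
  moreover have "D k = B m k" if "\<not> k \<le> m" for k
    using D that unfolding B_def by auto
  ultimately show "D = B m" by blast
qed

lemma powr_expansion:
  assumes "j \<le> m" "t > 0"
  shows "t powr r j = (\<Sum>k\<le>m. B m k t * (b powr r j * cv m k j))"
proof -
  have "t powr r j = b powr r j * exp (- ln (b / t) * r j)"
    using assms(2) b_pos by (simp add: powr_def ln_div exp_add[symmetric] algebra_simps)
  also have "\<dots> = (\<Sum>k\<le>m. B m k t * (b powr r j * cv m k j))"
    unfolding exp_expansion[OF assms(1)] sum_distrib_left
    by (intro sum.cong) (auto simp: B_bf[OF _ assms(2)])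
  finally show ?thesis .
qed

lemma B_independent:
  fixes c :: "nat \<Rightarrow> real"
  assumes "\<And>t. t > 0 \<Longrightarrow> (\<Sum>k\<le>m. B m k t * c k) = 0" "i \<le> m"
  shows "c i = 0"
proof -
  have "(\<Sum>k\<le>m. c k * bcoef m k l) = 0" if "l \<le> m" for l
  proof (rule powr_sum_zero[OF r_inj _ that])
    fix t :: real assume t: "t > 0"
    have "(\<Sum>l\<le>m. (\<Sum>k\<le>m. c k * bcoef m k l) * t powr r l) = (\<Sum>k\<le>m. B m k t * c k)"
      unfolding sum_distrib_right by (subst sum.swap) (auto simp: B_def sum_distrib_left mult_ac intro!: sum.cong)
    with assms(1)[OF t] show "(\<Sum>l\<le>m. (\<Sum>k\<le>m. c k * bcoef m k l) * t powr r l) = 0" by simp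
  qed
  then have z: "(\<Sum>k\<le>m. c k * bern m k l) = 0" if "l \<le> m" for l
  proof -
    have "(\<Sum>k\<le>m. c k * bern m k l) = (\<Sum>k\<le>m. c k * bcoef m k l) * b powr r l"
      unfolding sum_distrib_right by (simp add: mult.assoc bcoef_b)
    with \<open>l \<le> m\<close> \<open>\<And>l. l \<le> m \<Longrightarrow> (\<Sum>k\<le>m. c k * bcoef m k l) = 0\<close> show ?thesis by simp
  qed
  have "c i = (\<Sum>k\<le>m. c k * ctrl m i (bern m k))"
    using assms(2) by (simp add: ctrl_bern if_distrib cong: if_cong)
  also have "\<dots> = ctrl m i (\<lambda>l. \<Sum>k\<le>m. c k * bern m k l)" by (rule ctrl_sum[symmetric])
  also have "\<dots> = 0" unfolding ctrl_def using z by (intro sum.neutral) auto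
  finally show ?thesis .
qed

lemma ctrl_pts_eq:
  fixes P :: "real \<Rightarrow> real^'s" and A :: "nat \<Rightarrow> real^'s"
  assumes P: "\<And>t. t > 0 \<Longrightarrow> P t = (\<Sum>j\<le>n. t powr r j *\<^sub>R A j)" and "n \<le> m" "i \<le> m"
  shows "ctrl_pts r a b m P i = (\<Sum>j\<le>n. (b powr r j * cv m i j) *\<^sub>R A j)"
proof -
  \<comment> \<open>Zero beyond m is the default value that \<open>ctrl_pts\<close>
    prescribes.\<close>
  define E where "E i = (if i \<le> m then \<Sum>j\<le>n. (b powr r j * cv m i j) *\<^sub>R A j else 0)" for i
  have PE: "P t = (\<Sum>k\<le>m. B m k t *\<^sub>R E k)" if t: "t > 0" for t
  proof -
    have "P t = (\<Sum>j\<le>n. \<Sum>k\<le>m. (B m k t * (b powr r j * cv m k j)) *\<^sub>R A j)"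
      unfolding P[OF t] scaleR_sum_left[symmetric]
      using powr_expansion[OF _ t, of _ m] assms(2) by (intro sum.cong refl) auto
    also have "\<dots> = (\<Sum>k\<le>m. B m k t *\<^sub>R E k)"
      by (subst sum.swap) (auto simp: E_def scaleR_sum_right intro!: sum.cong)
    finally show ?thesis .
  qed
  have "ctrl_pts r a b m P = E"
    unfolding ctrl_pts_def CB_basis_eq
  proof (rule the_equality)
    show "(\<forall>t>0. P t = (\<Sum>i\<le>m. B m i t *\<^sub>R E i)) \<and> (\<forall>i>m. E i = 0)"
      using PE by (simp add: E_def)
  next
    fix F assume "(\<forall>t>0. P t = (\<Sum>i\<le>m. B m i t *\<^sub>R F i)) \<and> (\<forall>i>m. F i = 0)"
    then have F: "\<forall>t>0. P t = (\<Sum>i\<le>m. B m i t *\<^sub>R F i)" "\<forall>i>m. F i = 0" by auto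
    have "F k = E k" if k: "k \<le> m" for k
    proof -
      have "F k $ s - E k $ s = 0" for s
      proof (rule B_independent[OF _ k])
        fix t :: real assume t: "t > 0"
        have "(\<Sum>k\<le>m. B m k t *\<^sub>R F k) = (\<Sum>k\<le>m. B m k t *\<^sub>R E k)" using PE F t by auto
        then have "(\<Sum>k\<le>m. B m k t *\<^sub>R (F k - E k)) = 0" by (simp add: scaleR_diff_right sum_subtractf)
        from arg_cong[OF this, of "\<lambda>v. v $ s"]
        show "(\<Sum>k\<le>m. B m k t * (F k $ s - E k $ s)) = 0" by simp
      qed
      then show ?thesis by (simp add: vec_eq_iff)
    qed
    moreover have "F k = E k" if "\<not> k \<le> m" for k using that F by (simp add: E_def)
    ultimately show "F = E" by blast
  qed
  with assms(3) show ?thesis by (simp add: E_def)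
qed

end

section \<open>Divergent reciprocals: area under the control polygon\<close>

lemma one_plus_powr_ge:
  fixes x p :: real
  assumes "x \<ge> 0" "p \<ge> 1"
  shows "1 + p * x \<le> (1 + x) powr p"
proof -
  have "(p * 1 powr (p - 1)) * ((1 + x) - 1) \<le> (1 + x) powr p - 1 powr p"
  proof (rule f''_imp_f'[where C = "{0<..}" and f = "\<lambda>t. t powr p"
        and f' = "\<lambda>t. p * t powr (p - 1)" and x = 1 and y = "1 + x" and f'' = "\<lambda>x. p * (p - 1) * x powr (p - 2)"])
    fix t :: real assume t: "t \<in> {0<..}"
    show "((\<lambda>t. t powr p) has_real_derivative p * t powr (p - 1)) (at t)"
      using t by (auto intro!: derivative_eq_intros)
    show "((\<lambda>t. p * t powr (p - 1)) has_real_derivative p * (p - 1) * t powr (p - 2)) (at t)"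
      using t by (auto intro!: derivative_eq_intros simp: algebra_simps)
  qed (use assms in auto)
  then show ?thesis by simp
qed

text \<open>On [w, 1] the second derivative of t powr p is at least p (p - 1) w powr p, because t
  \<le> 1 gives t powr (p - 2) \<ge> t powr p. Subtracting the quadratic with this second derivative
  therefore preserves convexity.\<close>

lemma powr_midpoint_gap:
  fixes w p x y :: real
  assumes "0 < w" "p > 1" "x \<in> {w..1}" "y \<in> {w..1}"
  shows "((x + y) / 2) powr p + p * (p - 1) * w powr p / 8 * (y - x)\<^sup>2 \<le> (x powr p + y powr p) / 2"
proof -
  define k where "k = p * (p - 1) * w powr p"
  define g where "g = (\<lambda>t. t powr p - k / 2 * t\<^sup>2)"
  have "convex_on {w..1} g"
  proof (rule f''_ge0_imp_convex[where f' = "\<lambda>t. p * t powr (p - 1) - k * t"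
        and f'' = "\<lambda>t. p * (p - 1) * t powr (p - 2) - k"])
    fix t :: real assume t: "t \<in> {w..1}"
    then have t0: "t > 0" using assms by auto
    show "(g has_real_derivative p * t powr (p - 1) - k * t) (at t)"
      unfolding g_def using t0 by (auto intro!: derivative_eq_intros)
    show "((\<lambda>t. p * t powr (p - 1) - k * t) has_real_derivative p * (p - 1) * t powr (p - 2) - k) (at t)"
      using t0 by (auto intro!: derivative_eq_intros simp: algebra_simps)
    have "w powr p \<le> t powr p" using t assms by (intro powr_mono2) auto
    also have "\<dots> \<le> t powr (p - 2)" using t t0 by (intro powr_mono') auto
    finally have "p * (p - 1) * w powr p \<le> p * (p - 1) * t powr (p - 2)"
      using assms by (intro mult_left_mono) auto
    then show "p * (p - 1) * t powr (p - 2) - k \<ge> 0" by (simp add: k_def)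
  qed simp
  from convex_onD[OF this, of "1/2" x y] assms(3,4)
  have "g ((x + y) / 2) \<le> g x / 2 + g y / 2" by (simp add: add_divide_distrib)
  then show ?thesis unfolding g_def by (simp add: k_def power2_eq_square field_simps)
qed

context muntz_interval
begin

lemma cv_mono:
  assumes "0 < j" "j \<le> m" "i \<le> k" "k \<le> m"
  shows "cv m i j \<le> cv m k j"
  using assms(3,4)
proof (induction k rule: dec_induct)
  case (step n)
  then have "cv m i j \<le> cv m n j" by simp
  also have "\<dots> \<le> cv m (Suc n) j" using cv_less_Suc[OF assms(1,2), of n] step.prems by simp
  finally show ?case .
qed simp

lemma cv_bounds:
  assumes "j \<le> m" "i \<le> m"
  shows "exp (- \<sigma> * r j) \<le> cv m i j" "cv m i j \<le> 1"
proof -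
  have "cv m 0 j \<le> cv m i j \<and> cv m i j \<le> cv m m j"
    using assms by (cases "j = 0") (auto intro!: cv_mono)
  then show "exp (- \<sigma> * r j) \<le> cv m i j" "cv m i j \<le> 1"
    using assms by (auto simp: cv_first cv_last)
qed

lemma cv_pos: "j \<le> m \<Longrightarrow> i \<le> m \<Longrightarrow> 0 < cv m i j"
  using cv_bounds(1)[of j m i] by (meson exp_gt_zero less_le_trans)

text \<open>One elevation lowers a control value by at most r j / r (m + 1): in
  \<open>cv_Suc_relation\<close> the \<xi> term has a sign by monotonicity, and control values are
  at most 1.\<close>

lemma cv_Suc_le:
  assumes "0 < j" "j \<le> m" "i \<le> m"
  shows "cv (Suc m) i j \<le> cv m i j" "r (Suc m) * (cv m i j - cv (Suc m) i j) \<le> r j"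
proof -
  show "cv (Suc m) i j \<le> cv m i j"
  proof (cases i)
    case 0
    then show ?thesis using assms by (simp add: cv_first)
  next
    case (Suc k)
    then obtain \<alpha> where \<alpha>: "0 < \<alpha>" "\<alpha> < 1" "cv (Suc m) i j = (1 - \<alpha>) * cv m k j + \<alpha> * cv m i j"
      using cv_elevation[of k m] assms(3) by (metis Suc_le_eq)
    have "(1 - \<alpha>) * cv m k j \<le> (1 - \<alpha>) * cv m i j"
      using cv_mono[OF assms(1,2), of k i] Suc assms(3) \<alpha> by (intro mult_left_mono) auto
    then show ?thesis using \<alpha>(3) by (simp add: algebra_simps)
  qed
  obtain \<xi> where \<xi>: "0 \<le> \<xi>" "(r (Suc m) - r j) * cv m i j = (r (Suc m) + \<xi>) * cv (Suc m) i j - \<xi> * cv (Suc m) (Suc i) j"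
    using cv_Suc_relation[OF assms(3)] by metis
  have "\<xi> * cv (Suc m) i j \<le> \<xi> * cv (Suc m) (Suc i) j"
    using cv_less_Suc[OF assms(1), of "Suc m" i] assms \<xi>(1) by (intro mult_left_mono) auto
  moreover have "r j * cv m i j \<le> r j * 1" using cv_bounds[OF assms(2,3)] by (intro mult_left_mono) auto
  ultimately show "r (Suc m) * (cv m i j - cv (Suc m) i j) \<le> r j" using \<xi>(2) by (simp add: algebra_simps)
qed

context
  fixes j :: nat
  assumes j: "1 < j"
begin

text \<open>Defect of an Euler step for r_1 x dz = r_j z dx. The point is taken at order m and the
  increment at order m + 1, the mixture that \<open>cv_Suc_relation\<close> turns into a cross
  product.\<close>

definition om :: "nat \<Rightarrow> nat \<Rightarrow> real" where
  "om m i = r 1 * cv m i 1 * (cv (Suc m) (Suc i) j - cv (Suc m) i j)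
    - r j * cv m i j * (cv (Suc m) (Suc i) 1 - cv (Suc m) i 1)"

definition Om :: "nat \<Rightarrow> real" where "Om m = (\<Sum>i\<le>m. om m i)"

text \<open>Twice the area of a trapezium, and twice the area under the control polygon of the
  curve \<open>(t powr r 1, t powr r j)\<close> (rescaled to end at \<open>(1, 1)\<close>).\<close>

definition trap :: "real \<Rightarrow> real \<Rightarrow> real \<Rightarrow> real \<Rightarrow> real" where
  "trap x z x' z' = (x' - x) * (z + z')"

definition area :: "nat \<Rightarrow> real" where
  "area m = (\<Sum>i<m. trap (cv m i 1) (cv m i j) (cv m (Suc i) 1) (cv m (Suc i) j))"

text \<open>The same \<xi> serves both coordinates and cancels. Up to the factor r (m + 1) the
  defect is twice the signed area of the triangle with vertices old i, new i and new i + 1.\<close>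

lemma om_cross:
  assumes "i \<le> m"
  shows "om m i = r (Suc m) * ((cv m i 1 - cv (Suc m) i 1) * (cv (Suc m) (Suc i) j - cv (Suc m) i j)
     - (cv m i j - cv (Suc m) i j) * (cv (Suc m) (Suc i) 1 - cv (Suc m) i 1))"
proof -
  obtain \<xi> where \<xi>: "\<And>j. (r (Suc m) - r j) * cv m i j = (r (Suc m) + \<xi>) * cv (Suc m) i j - \<xi> * cv (Suc m) (Suc i) j"
    using cv_Suc_relation[OF assms] by metis
  have 1: "r k * cv m i k = r (Suc m) * (cv m i k - cv (Suc m) i k) + \<xi> * (cv (Suc m) (Suc i) k - cv (Suc m) i k)" for k
    using \<xi>[of k] by (simp add: algebra_simps)
  show ?thesis unfolding om_def 1 by (simp add: algebra_simps)
qed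

text \<open>New vertices i and i + 1 lie on the old edges before and after old vertex i, so the
  triangle is a cut corner, oriented by convexity. At both ends of the polygon it
  degenerates.\<close>

lemma om_nonneg:
  assumes "i \<le> m" "j \<le> m"
  shows "om m i \<ge> 0"
proof -
  consider "i = 0" | "i = m" "i \<noteq> 0" | k where "i = Suc k" "i < m"
    using assms(1) by (cases i) (auto simp: le_less)
  then have "(cv m i 1 - cv (Suc m) i 1) * (cv (Suc m) (Suc i) j - cv (Suc m) i j)
     - (cv m i j - cv (Suc m) i j) * (cv (Suc m) (Suc i) 1 - cv (Suc m) i 1) \<ge> 0"
  proof cases
    case 1
    then show ?thesis using assms j by (simp add: cv_first)
  next
    case 2
    then show ?thesis by (simp add: cv_last)
  next
    case 3
    obtain \<alpha> where \<alpha>: "0 < \<alpha>" "\<alpha> < 1" "\<And>l. cv (Suc m) i l = (1 - \<alpha>) * cv m k l + \<alpha> * cv m i l"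
      using cv_elevation[of k m] 3 by (metis Suc_lessD)
    obtain \<beta> where \<beta>: "0 < \<beta>" "\<beta> < 1" "\<And>l. cv (Suc m) (Suc i) l = (1 - \<beta>) * cv m i l + \<beta> * cv m (Suc i) l"
      using cv_elevation[of i m] 3 by metis
    have s: "(cv m i j - cv m k j) * (cv m (Suc i) 1 - cv m i 1) < (cv m (Suc i) j - cv m i j) * (cv m i 1 - cv m k 1)"
      using cv_slopes[of 1 j m k] assms j 3 by simp
    have "(cv m i 1 - cv (Suc m) i 1) * (cv (Suc m) (Suc i) j - cv (Suc m) i j)
     - (cv m i j - cv (Suc m) i j) * (cv (Suc m) (Suc i) 1 - cv (Suc m) i 1)
     = (1 - \<alpha>) * \<beta> * ((cv m (Suc i) j - cv m i j) * (cv m i 1 - cv m k 1) - (cv m i j - cv m k j) * (cv m (Suc i) 1 - cv m i 1))"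
      unfolding \<alpha>(3) \<beta>(3) by algebra
    then show ?thesis using \<alpha> \<beta> s by simp
  qed
  then show ?thesis unfolding om_cross[OF assms(1)] by simp
qed

lemma area_Suc:
  assumes "j \<le> m"
  shows "area (Suc m) - area m = Om m / r (Suc m)"
proof -
  let ?x = "\<lambda>i. cv m i 1" and ?z = "\<lambda>i. cv m i j"
  let ?X = "\<lambda>i. cv (Suc m) i 1" and ?Z = "\<lambda>i. cv (Suc m) i j"
  \<comment> \<open>New vertex i + 1 lies on old edge i, so the trapezium splits there.\<close>
  have "area m = (\<Sum>i<m. trap (?x i) (?z i) (?X (Suc i)) (?Z (Suc i)) + trap (?X (Suc i)) (?Z (Suc i)) (?x (Suc i)) (?z (Suc i)))"
    unfolding area_def
  proof (intro sum.cong refl)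
    fix i assume "i \<in> {..<m}"
    then obtain \<alpha> where \<alpha>: "\<And>l. cv (Suc m) (Suc i) l = (1 - \<alpha>) * cv m i l + \<alpha> * cv m (Suc i) l"
      using cv_elevation[of i m] by (metis lessThan_iff)
    show "trap (?x i) (?z i) (?x (Suc i)) (?z (Suc i)) =
      trap (?x i) (?z i) (?X (Suc i)) (?Z (Suc i)) + trap (?X (Suc i)) (?Z (Suc i)) (?x (Suc i)) (?z (Suc i))"
      unfolding \<alpha> trap_def by algebra
  qed
  also have "\<dots> = (\<Sum>i<m. trap (?x i) (?z i) (?X (Suc i)) (?Z (Suc i))) + (\<Sum>i<m. trap (?X (Suc i)) (?Z (Suc i)) (?x (Suc i)) (?z (Suc i)))"
    by (rule sum.distrib)
  \<comment> \<open>The term added at i = m, and the one added at i = 0 in the next equation, have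
    width 0 because polygons of all orders share their end points.\<close>
  also have "(\<Sum>i<m. trap (?x i) (?z i) (?X (Suc i)) (?Z (Suc i))) = (\<Sum>i\<le>m. trap (?x i) (?z i) (?X (Suc i)) (?Z (Suc i)))"
    by (simp add: lessThan_Suc_atMost[symmetric] cv_last trap_def)
  also have "(\<Sum>i<m. trap (?X (Suc i)) (?Z (Suc i)) (?x (Suc i)) (?z (Suc i))) = (\<Sum>i\<le>m. trap (?X i) (?Z i) (?x i) (?z i))"
    using assms j by (simp add: lessThan_Suc_atMost[symmetric] sum.lessThan_Suc_shift cv_first trap_def del: sum.lessThan_Suc)
  finally have "area (Suc m) - area m = (\<Sum>i\<le>m. trap (?X i) (?Z i) (?X (Suc i)) (?Z (Suc i))
     - trap (?x i) (?z i) (?X (Suc i)) (?Z (Suc i)) - trap (?X i) (?Z i) (?x i) (?z i))"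
    by (simp add: area_def lessThan_Suc_atMost sum_subtractf sum.distrib del: sum.lessThan_Suc)
  also have "\<dots> = (\<Sum>i\<le>m. om m i / r (Suc m))"
  proof (intro sum.cong refl)
    fix i assume "i \<in> {..m}"
    then have eq: "om m i / r (Suc m) = (?x i - ?X i) * (?Z (Suc i) - ?Z i) - (?z i - ?Z i) * (?X (Suc i) - ?X i)"
      using om_cross[of i m] r_pos[of "Suc m"] by simp
    show "trap (?X i) (?Z i) (?X (Suc i)) (?Z (Suc i))
     - trap (?x i) (?z i) (?X (Suc i)) (?Z (Suc i)) - trap (?X i) (?Z i) (?x i) (?z i) = om m i / r (Suc m)"
      unfolding eq trap_def by (simp add: algebra_simps)
  qed
  finally show ?thesis by (simp add: Om_def sum_divide_distrib)
qed

lemma area_bounds: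
  assumes "j \<le> m"
  shows "0 \<le> area m" "area m \<le> 2"
proof -
  have b: "0 \<le> trap (cv m i 1) (cv m i j) (cv m (Suc i) 1) (cv m (Suc i) j)"
    "trap (cv m i 1) (cv m i j) (cv m (Suc i) 1) (cv m (Suc i) j) \<le> (cv m (Suc i) 1 - cv m i 1) * 2" if "i < m" for i
  proof -
    have *: "cv m i 1 \<le> cv m (Suc i) 1" using assms j that by (intro less_imp_le cv_less_Suc) auto
    have "0 < cv m i j" "0 < cv m (Suc i) j" using assms that by (auto intro!: cv_pos)
    moreover have "cv m i j \<le> 1" "cv m (Suc i) j \<le> 1" using assms that by (auto intro!: cv_bounds)
    ultimately show "0 \<le> trap (cv m i 1) (cv m i j) (cv m (Suc i) 1) (cv m (Suc i) j)"
      "trap (cv m i 1) (cv m i j) (cv m (Suc i) 1) (cv m (Suc i) j) \<le> (cv m (Suc i) 1 - cv m i 1) * 2"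
      unfolding trap_def using * by (intro mult_nonneg_nonneg mult_left_mono; simp)+
  qed
  show "0 \<le> area m" unfolding area_def using b(1) by (intro sum_nonneg) auto
  have "area m \<le> (\<Sum>i<m. (cv m (Suc i) 1 - cv m i 1) * 2)"
    unfolding area_def using b(2) by (intro sum_mono) auto
  also have "\<dots> = (cv m m 1 - cv m 0 1) * 2"
    unfolding sum_distrib_right[symmetric] by (subst sum_lessThan_telescope) (rule refl)
  also have "\<dots> \<le> 2" using cv_pos[of 1 m 0] assms j by (simp add: cv_last)
  finally show "area m \<le> 2" .
qed

lemma Om_frequently_small:
  assumes "\<not> summable (\<lambda>i. 1 / r (Suc i))" "\<epsilon> > 0"
  shows "\<exists>m\<ge>M. j \<le> m \<and> Om m < \<epsilon>"
proof (rule ccontr)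
  assume "\<not> ?thesis"
  then have big: "Om m \<ge> \<epsilon>" if "m \<ge> max M j" for m using that by force
  define N where "N = max M j"
  have "summable (\<lambda>i. 1 / r (Suc (i + N)))"
  proof (rule summableI_nonneg_bounded)
    fix n
    have "(\<Sum>i<n. 1 / r (Suc (i + N))) \<le> (\<Sum>i<n. (area (Suc i + N) - area (i + N)) / \<epsilon>)"
    proof (intro sum_mono)
      fix i
      have m: "i + N \<ge> j" "i + N \<ge> max M j" by (auto simp: N_def)
      have "\<epsilon> * (1 / r (Suc (i + N))) \<le> Om (i + N) * (1 / r (Suc (i + N)))"
        using big[OF m(2)] by (intro mult_right_mono) auto
      also have "\<dots> = area (Suc i + N) - area (i + N)" using area_Suc[OF m(1)] by simp
      finally show "1 / r (Suc (i + N)) \<le> (area (Suc i + N) - area (i + N)) / \<epsilon>"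
        using assms(2) by (simp add: field_simps)
    qed
    also have "\<dots> = (area (n + N) - area N) / \<epsilon>"
      unfolding sum_divide_distrib[symmetric]
      using sum_lessThan_telescope[of "\<lambda>i. area (i + N)" n] by simp
    also have "\<dots> \<le> 2 / \<epsilon>"
      using area_bounds(2)[of "n + N"] area_bounds(1)[of N] assms(2)
      by (intro divide_right_mono) (auto simp: N_def trans_le_add2)
    finally show "(\<Sum>i<n. 1 / r (Suc (i + N))) \<le> 2 / \<epsilon>" .
  qed simp
  then have "summable (\<lambda>i. 1 / r (Suc i))"
    using summable_iff_shift[of "\<lambda>i. 1 / r (Suc i)" N] by simp
  with assms(1) show False by simp
qed

abbreviation "\<rho> \<equiv> r j / r 1"

lemma \<rho>_gt_1: "\<rho> > 1"
  using j r_pos[of 1] by simp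

text \<open>Small \<open>Om\<close> means that the polygon almost solves \<open>z' = \<rho> z / x\<close> by Euler steps; such steps
  stay below the exact solutions \<open>c * x powr \<rho>\<close>, so \<open>z / x powr \<rho>\<close> is almost decreasing, yet
  it takes the value 1 at both ends.\<close>

lemma powr_minus_cv_le:
  defines "w \<equiv> exp (- \<sigma> * r 1)"
  assumes "j \<le> m" "i \<le> Suc m"
  shows "cv (Suc m) i 1 powr \<rho> - cv (Suc m) i j \<le> (Om m + (r j)\<^sup>2 / r (Suc m)) / (r 1 * w * w powr \<rho>)"
proof -
  let ?X = "\<lambda>i. cv (Suc m) i 1" and ?Z = "\<lambda>i. cv (Suc m) i j"
  \<comment> \<open>Error of one step: the defect with mixed orders, plus the cost of replacing z_i
    of order m by its value at order m + 1, which differs by at most r_j / r_(m+1).\<close>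
  let ?u = "\<lambda>i. om m i + (r j)\<^sup>2 / r (Suc m) * (?X (Suc i) - ?X i)"
  define C where "C = 1 / (r 1 * w * w powr \<rho>)"
  have w: "w > 0" by (simp add: w_def)
  have r1: "r 1 > 0" "r (Suc m) > 0" using r_pos by auto
  have C: "C > 0" using w r1 by (simp add: C_def)
  have X: "w \<le> ?X i" "?X i \<le> 1" if "i \<le> Suc m" for i
    using cv_bounds[of 1 "Suc m" i] that assms(2) j by (auto simp: w_def)
  have Zp: "?Z i > 0" if "i \<le> Suc m" for i using that assms(2) by (intro cv_pos) auto
  have u: "?u i \<ge> 0" if "i \<le> m" for i
  proof -
    have "?X i < ?X (Suc i)" using that assms(2) j by (intro cv_less_Suc) auto
    then show ?thesis using om_nonneg[OF that assms(2)] r1 by simp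
  qed
  have step: "?Z (Suc i) / ?X (Suc i) powr \<rho> \<le> ?Z i / ?X i powr \<rho> + C * ?u i" if i: "i \<le> m" for i
  proof -
    define d where "d = ?X (Suc i) - ?X i"
    define e where "e = ?Z (Suc i) - ?Z i"
    have d: "d > 0" unfolding d_def using i assms(2) j by (simp add: cv_less_Suc)
    have e: "e > 0" unfolding e_def using i assms(2) j by (simp add: cv_less_Suc)
    have x0: "?X i > 0" "?X (Suc i) > 0" using X[of i] X[of "Suc i"] w i by auto
    have err: "r 1 * ?X i * e - r j * ?Z i * d \<le> ?u i"
    proof -
      have "?X i \<le> cv m i 1" using cv_Suc_le(1)[of 1 m i] assms(2) j i by simp
      then have 1: "r 1 * ?X i * e \<le> r 1 * cv m i 1 * e" using e r1 by (intro mult_right_mono mult_left_mono) auto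
      have "cv m i j - ?Z i \<le> r j / r (Suc m)"
        using cv_Suc_le(2)[of j m i] assms(2) j i r1 by (simp add: field_simps)
      then have "r j * d * (cv m i j - ?Z i) \<le> r j * d * (r j / r (Suc m))"
        using d by (intro mult_left_mono) auto
      then have 2: "r j * cv m i j * d - r j * ?Z i * d \<le> (r j)\<^sup>2 / r (Suc m) * d"
        by (simp add: algebra_simps power2_eq_square)
      have "om m i = r 1 * cv m i 1 * e - r j * cv m i j * d" by (simp add: om_def d_def e_def)
      with 1 2 show ?thesis unfolding d_def[symmetric] by linarith
    qed
    have ui: "?u i \<ge> 0" using u i by simp
    have "e \<le> \<rho> * ?Z i * d / ?X i + ?u i / (r 1 * w)"
    proof -
      have "e = (r j * ?Z i * d + (r 1 * ?X i * e - r j * ?Z i * d)) / (r 1 * ?X i)"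
        using x0 r1 by simp
      also have "\<dots> \<le> (r j * ?Z i * d + ?u i) / (r 1 * ?X i)"
        using err x0 r1 by (intro divide_right_mono) auto
      also have "\<dots> = \<rho> * ?Z i * d / ?X i + ?u i / (r 1 * ?X i)"
        by (simp add: add_divide_distrib)
      also have "?u i / (r 1 * ?X i) \<le> ?u i / (r 1 * w)"
        using ui x0 r1 w X[of i] i by (intro divide_left_mono mult_left_mono mult_pos_pos) auto
      finally show ?thesis by simp
    qed
    then have "?Z (Suc i) \<le> ?Z i * (1 + \<rho> * (d / ?X i)) + ?u i / (r 1 * w)"
      by (simp add: e_def algebra_simps)
    also have "\<dots> \<le> ?Z i * (1 + d / ?X i) powr \<rho> + ?u i / (r 1 * w)"
      using one_plus_powr_ge[of "d / ?X i" \<rho>] d x0 \<rho>_gt_1 Zp[of i] i by (intro add_right_mono mult_left_mono) auto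
    also have "1 + d / ?X i = ?X (Suc i) / ?X i" using x0 by (simp add: d_def field_simps)
    finally have "?Z (Suc i) \<le> ?Z i * (?X (Suc i) powr \<rho> / ?X i powr \<rho>) + ?u i / (r 1 * w)"
      using x0 by (simp add: powr_divide)
    then have "?Z (Suc i) / ?X (Suc i) powr \<rho> \<le> (?Z i * (?X (Suc i) powr \<rho> / ?X i powr \<rho>) + ?u i / (r 1 * w)) / ?X (Suc i) powr \<rho>"
      by (rule divide_right_mono) simp
    also have "\<dots> = ?Z i / ?X i powr \<rho> + ?u i / (r 1 * w) / ?X (Suc i) powr \<rho>"
      using x0 by (simp add: add_divide_distrib)
    also have "?u i / (r 1 * w) / ?X (Suc i) powr \<rho> \<le> ?u i / (r 1 * w) / w powr \<rho>"
      using ui r1 w X[of "Suc i"] i \<rho>_gt_1 x0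
      by (intro divide_left_mono powr_mono2 mult_pos_pos) auto
    also have "?u i / (r 1 * w) / w powr \<rho> = C * ?u i" by (simp add: C_def)
    finally show ?thesis by simp
  qed
  have chain: "?Z k / ?X k powr \<rho> \<le> ?Z i / ?X i powr \<rho> + C * (\<Sum>l\<in>{i..<k}. ?u l)" if "i \<le> k" "k \<le> Suc m" for k i
    using that
  proof (induction k rule: dec_induct)
    case (step n)
    then show ?case using \<open>\<And>i. i \<le> m \<Longrightarrow> ?Z (Suc i) / ?X (Suc i) powr \<rho> \<le> ?Z i / ?X i powr \<rho> + C * ?u i\<close>[of n]
      by (simp add: algebra_simps)
  qed simp
  have "(\<Sum>l\<in>{i..<Suc m}. ?u l) \<le> (\<Sum>l\<in>{..m}. ?u l)"
    using u by (intro sum_mono2) auto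
  also have "\<dots> = Om m + (r j)\<^sup>2 / r (Suc m) * (\<Sum>l<Suc m. ?X (Suc l) - ?X l)"
    by (simp add: Om_def sum.distrib sum_distrib_left lessThan_Suc_atMost del: sum.lessThan_Suc)
  also have "(\<Sum>l<Suc m. ?X (Suc l) - ?X l) = 1 - ?X 0"
    by (subst sum_lessThan_telescope) (simp add: cv_last)
  also have "Om m + (r j)\<^sup>2 / r (Suc m) * (1 - ?X 0) \<le> Om m + (r j)\<^sup>2 / r (Suc m) * 1"
    using X[of 0] w r1 by (intro add_left_mono mult_left_mono) auto
  finally have su: "(\<Sum>l\<in>{i..<Suc m}. ?u l) \<le> Om m + (r j)\<^sup>2 / r (Suc m)" by simp
  have "1 \<le> ?Z i / ?X i powr \<rho> + C * (\<Sum>l\<in>{i..<Suc m}. ?u l)"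
    using chain[of i "Suc m"] assms(3) by (simp add: cv_last)
  also have "\<dots> \<le> ?Z i / ?X i powr \<rho> + C * (Om m + (r j)\<^sup>2 / r (Suc m))"
    using su C by simp
  finally have 1: "1 \<le> ?Z i / ?X i powr \<rho> + C * (Om m + (r j)\<^sup>2 / r (Suc m))" .
  have Xp: "0 < ?X i powr \<rho>" "?X i powr \<rho> \<le> 1"
    using X[OF assms(3)] w \<rho>_gt_1 by (auto intro!: powr_le1)
  have nn: "0 \<le> C * (Om m + (r j)\<^sup>2 / r (Suc m))"
    using C r1 om_nonneg assms(2) unfolding Om_def by (intro mult_nonneg_nonneg add_nonneg_nonneg sum_nonneg) auto
  have "?X i powr \<rho> - ?Z i \<le> ?X i powr \<rho> * (C * (Om m + (r j)\<^sup>2 / r (Suc m)))"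
    using mult_left_mono[OF 1, of "?X i powr \<rho>"] Xp by (simp add: distrib_left)
  also have "\<dots> \<le> 1 * (C * (Om m + (r j)\<^sup>2 / r (Suc m)))"
    using Xp nn by (intro mult_right_mono) auto
  finally show ?thesis by (simp add: C_def)
qed

lemma powr_minus_cv_Suc:
  assumes "j \<le> m" "\<And>i. i \<le> m \<Longrightarrow> cv m i 1 powr \<rho> - cv m i j \<le> \<epsilon>" "i \<le> Suc m"
  shows "cv (Suc m) i 1 powr \<rho> - cv (Suc m) i j \<le> \<epsilon>"
proof -
  have 0: "\<epsilon> \<ge> 0" using assms(2)[of m] by (simp add: cv_last)
  consider "i = 0" | "i = Suc m" | k where "i = Suc k" "k < m"
    using assms(3) by (cases i) (auto simp: le_less)
  then show ?thesis
  proof cases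
    case 1
    then show ?thesis using assms(1) assms(2)[of 0] j by (simp add: cv_first)
  next
    case 2
    then show ?thesis using 0 by (simp add: cv_last)
  next
    case 3
    obtain \<alpha> where \<alpha>: "0 < \<alpha>" "\<alpha> < 1" "\<And>l. cv (Suc m) i l = (1 - \<alpha>) * cv m k l + \<alpha> * cv m i l"
      using cv_elevation[of k m] 3 by metis
    have "cv (Suc m) i 1 powr \<rho> \<le> (1 - \<alpha>) * cv m k 1 powr \<rho> + \<alpha> * cv m i 1 powr \<rho>"
      using convex_onD[OF powr_convex[of \<rho>], of \<alpha> "cv m k 1" "cv m i 1"] \<rho>_gt_1 \<alpha> assms(1) j 3
      by (simp add: cv_pos)
    moreover have "(1 - \<alpha>) * (cv m k 1 powr \<rho> - cv m k j) \<le> (1 - \<alpha>) * \<epsilon>"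
      using assms(2)[of k] 3 \<alpha> by (intro mult_left_mono) auto
    moreover have "\<alpha> * (cv m i 1 powr \<rho> - cv m i j) \<le> \<alpha> * \<epsilon>"
      using assms(2)[of i] 3 \<alpha> by (intro mult_left_mono) auto
    ultimately show ?thesis unfolding \<alpha>(3)[of j] by (simp add: algebra_simps)
  qed
qed

text \<open>Edge slopes increase, so the line through one edge supports the polygon; the two
  inductions walk away from that edge to the right and to the left.\<close>

lemma edge_line_below_vertices:
  assumes "j \<le> m" "i < m" "k \<le> m"
  defines "S \<equiv> \<lambda>i. (cv m (Suc i) j - cv m i j) / (cv m (Suc i) 1 - cv m i 1)"
  shows "cv m i j + S i * (cv m k 1 - cv m i 1) \<le> cv m k j"
proof -
  have d: "cv m (Suc l) 1 - cv m l 1 > 0" if "l < m" for l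
    using that assms(1) j by (simp add: cv_less_Suc)
  have e: "cv m (Suc l) j - cv m l j = S l * (cv m (Suc l) 1 - cv m l 1)" if "l < m" for l
    using d[OF that] by (simp add: S_def)
  have S1: "S l \<le> S (Suc l)" if "Suc l < m" for l
  proof -
    have dd: "cv m (Suc l) 1 - cv m l 1 > 0" "cv m (Suc (Suc l)) 1 - cv m (Suc l) 1 > 0"
      using d that by auto
    show ?thesis unfolding S_def using cv_slopes[of 1 j m l] that assms(1) j dd
      by (simp add: frac_le_eq divide_le_0_iff field_simps)
  qed
  have S: "S l \<le> S n" if "l \<le> n" "n < m" for l n
    using that
  proof (induction n rule: dec_induct)
    case (step n)
    then show ?case using S1[of n] by simp
  qed simp
  show ?thesis
  proof (cases "i \<le> k")
    case True
    then show ?thesis using assms(3)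
    proof (induction k rule: dec_induct)
      case (step n)
      have "S i * (cv m (Suc n) 1 - cv m n 1) \<le> S n * (cv m (Suc n) 1 - cv m n 1)"
        using S[of i n] step d[of n] by (intro mult_right_mono) auto
      then show ?case using step e[of n] by (simp add: algebra_simps)
    qed simp
  next
    case False
    then have "k \<le> i" by simp
    then show ?thesis
    proof (induction k rule: inc_induct)
      case (step n)
      have "S n * (cv m (Suc n) 1 - cv m n 1) \<le> S i * (cv m (Suc n) 1 - cv m n 1)"
        using S[of n i] step d[of n] assms(2) by (intro mult_right_mono) auto
      then show ?case using step e[of n] assms(2) by (simp add: algebra_simps)
    qed simp
  qed
qed

text \<open>A point of the curve is the average of the vertices with weights
  \<open>bf m k s\<close>, so a line below all vertices is below the curve.\<close>

lemma edge_line_below_curve: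
  assumes "j \<le> m" "i < m" "exp (- \<sigma> * r 1) \<le> x" "x \<le> 1"
  defines "S \<equiv> \<lambda>i. (cv m (Suc i) j - cv m i j) / (cv m (Suc i) 1 - cv m i 1)"
  shows "cv m i j + S i * (x - cv m i 1) \<le> x powr \<rho>"
proof -
  define s where "s = - ln x / r 1"
  have x0: "x > 0" using assms(3) by (meson exp_gt_zero less_le_trans)
  have r1: "r 1 > 0" using r_pos by simp
  have "- \<sigma> * r 1 \<le> ln x" using assms(3) x0 by (simp add: ln_ge_iff)
  then have s: "0 \<le> s" "s \<le> \<sigma>" using r1 x0 assms(4) by (auto simp: s_def field_simps)
  have x: "x = exp (- s * r 1)" using r1 x0 by (simp add: s_def)
  have "x powr \<rho> = exp (- s * r j)" using r1 by (simp add: x powr_def)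
  have "cv m i j + S i * (x - cv m i 1) = (cv m i j - S i * cv m i 1) * (\<Sum>k\<le>m. bf m k s) + S i * (\<Sum>k\<le>m. cv m k 1 * bf m k s)"
    using exp_expansion[of 1 m s] assms(1) j by (simp add: bf_sum x algebra_simps)
  also have "\<dots> = (\<Sum>k\<le>m. (cv m i j + S i * (cv m k 1 - cv m i 1)) * bf m k s)"
    by (simp add: sum_distrib_left sum.distrib[symmetric] algebra_simps)
  also have "\<dots> \<le> (\<Sum>k\<le>m. cv m k j * bf m k s)"
    unfolding S_def using edge_line_below_vertices[OF assms(1,2)] bf_nonneg s
    by (intro sum_mono mult_right_mono) auto
  also have "\<dots> = exp (- s * r j)" using exp_expansion[of j m s] assms(1) by simp
  also have "\<dots> = x powr \<rho>" using r1 by (simp add: x powr_def)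
  finally show ?thesis .
qed

lemma cv_le_powr:
  assumes "j \<le> m" "i \<le> m"
  shows "cv m i j \<le> cv m i 1 powr \<rho>"
proof (cases "i = m")
  case False
  then show ?thesis
    using edge_line_below_curve[OF assms(1), of i "cv m i 1"] cv_bounds[of 1 m i] assms j by simp
qed (simp add: cv_last)

lemma powr_minus_cv_eventually:
  assumes "\<not> summable (\<lambda>i. 1 / r (Suc i))" "filterlim r at_top sequentially" "\<epsilon> > 0"
  shows "\<exists>M. \<forall>m\<ge>M. j \<le> m \<and> (\<forall>i\<le>m. cv m i 1 powr \<rho> - cv m i j \<le> \<epsilon>)"
proof -
  define C where "C = r 1 * exp (- \<sigma> * r 1) * exp (- \<sigma> * r 1) powr \<rho>"
  have C: "C > 0" using r_pos[of 1] by (simp add: C_def)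
  define \<delta> where "\<delta> = C * \<epsilon> / 2"
  have \<delta>: "\<delta> > 0" using C assms(3) by (simp add: \<delta>_def)
  have "\<forall>\<^sub>F m in sequentially. r m \<ge> (r j)\<^sup>2 / \<delta>"
    using assms(2) by (simp add: filterlim_at_top)
  then obtain N where N: "\<And>m. m \<ge> N \<Longrightarrow> r m \<ge> (r j)\<^sup>2 / \<delta>" by (auto simp: eventually_sequentially)
  obtain m where m: "m \<ge> N" "j \<le> m" "Om m < \<delta>" using Om_frequently_small[OF assms(1) \<delta>] by blast
  have "(r j)\<^sup>2 / r (Suc m) \<le> \<delta>"
    using N[of "Suc m"] m r_pos[of "Suc m"] \<delta> by (simp add: field_simps)
  then have "(Om m + (r j)\<^sup>2 / r (Suc m)) / C \<le> (\<delta> + \<delta>) / C"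
    using m C by (intro divide_right_mono) auto
  also have "\<dots> = \<epsilon>" using C by (simp add: \<delta>_def)
  finally have base: "cv (Suc m) i 1 powr \<rho> - cv (Suc m) i j \<le> \<epsilon>" if "i \<le> Suc m" for i
    using powr_minus_cv_le[OF m(2) that] by (simp add: C_def)
  have "\<forall>i\<le>n. cv n i 1 powr \<rho> - cv n i j \<le> \<epsilon>" if "n \<ge> Suc m" for n
    using that
  proof (induction n rule: dec_induct)
    case (step n)
    then show ?case using powr_minus_cv_Suc[of n \<epsilon>] m(2) by auto
  qed (use base in blast)
  then show ?thesis using m(2) by (intro exI[of _ "Suc m"]) auto
qed

text \<open>The midpoint of an edge lies below the curve and its ends lie at most k \<epsilon>^2
  below the curve. Strong convexity lifts the chord of the curve by k times the squared gap at the
  midpoint, so a gap above \<epsilon> is impossible.\<close>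

lemma cv_gaps_eventually:
  assumes "\<not> summable (\<lambda>i. 1 / r (Suc i))" "filterlim r at_top sequentially" "\<epsilon> > 0"
  shows "\<exists>M. \<forall>m\<ge>M. \<forall>i<m. cv m (Suc i) 1 - cv m i 1 \<le> \<epsilon>"
proof -
  define w where "w = exp (- \<sigma> * r 1)"
  have w: "w > 0" by (simp add: w_def)
  define k where "k = \<rho> * (\<rho> - 1) * w powr \<rho> / 8"
  have k: "k > 0" unfolding k_def using \<rho>_gt_1 w
    by (intro divide_pos_pos[of "\<rho> * (\<rho> - 1) * w powr \<rho>"] mult_pos_pos[of "\<rho>"] mult_pos_pos[of "\<rho> * (\<rho> - 1)"]) auto
  obtain M where M: "\<And>m i. m \<ge> M \<Longrightarrow> j \<le> m" "\<And>m i. m \<ge> M \<Longrightarrow> i \<le> m \<Longrightarrow> cv m i 1 powr \<rho> - cv m i j \<le> k * \<epsilon>\<^sup>2"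
    using powr_minus_cv_eventually[OF assms(1,2), of "k * \<epsilon>\<^sup>2"] k assms(3) by auto
  have "cv m (Suc i) 1 - cv m i 1 \<le> \<epsilon>" if m: "m \<ge> M" and i: "i < m" for m i
  proof -
    let ?x = "cv m i 1" and ?y = "cv m (Suc i) 1"
    let ?S = "(cv m (Suc i) j - cv m i j) / (?y - ?x)"
    have jm: "j \<le> m" using M(1) m by simp
    have xy: "?x \<in> {w..1}" "?y \<in> {w..1}" using cv_bounds[of 1 m i] cv_bounds[of 1 m "Suc i"] jm j i by (auto simp: w_def)
    have d: "?y - ?x > 0" using cv_less_Suc[of 1 m i] jm j i by simp
    have line: "cv m i j + ?S * ((?x + ?y) / 2 - ?x) \<le> ((?x + ?y) / 2) powr \<rho>"
      by (rule edge_line_below_curve[OF jm i]) (use xy in \<open>auto simp: w_def\<close>)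
    have half: "?S * ((?x + ?y) / 2 - ?x) = (cv m (Suc i) j - cv m i j) / 2"
    proof -
      have "(?x + ?y) / 2 - ?x = (?y - ?x) / 2" by (simp add: field_simps)
      then show ?thesis using d by simp
    qed
    have "(cv m i j + cv m (Suc i) j) / 2 = cv m i j + (cv m (Suc i) j - cv m i j) / 2"
      by (simp add: field_simps)
    with line[unfolded half] have "(cv m i j + cv m (Suc i) j) / 2 \<le> ((?x + ?y) / 2) powr \<rho>"
      by metis
    moreover have "((?x + ?y) / 2) powr \<rho> + k * (?y - ?x)\<^sup>2 \<le> (?x powr \<rho> + ?y powr \<rho>) / 2"
      unfolding k_def by (rule powr_midpoint_gap[OF w \<rho>_gt_1 xy])
    moreover have "?x powr \<rho> - cv m i j \<le> k * \<epsilon>\<^sup>2" "?y powr \<rho> - cv m (Suc i) j \<le> k * \<epsilon>\<^sup>2"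
      using M(2)[OF m] i by auto
    ultimately have "k * (?y - ?x)\<^sup>2 \<le> k * \<epsilon>\<^sup>2" by (simp add: field_simps)
    then have "(?y - ?x)\<^sup>2 \<le> \<epsilon>\<^sup>2" using k by simp
    then show ?thesis using assms(3) by (rule power2_le_imp_le[OF _ less_imp_le])
  qed
  then show ?thesis by blast
qed

end

lemma cv_powr_limit:
  assumes "\<not> summable (\<lambda>i. 1 / r (Suc i))" "filterlim r at_top sequentially" "\<epsilon> > 0"
  shows "\<exists>M. \<forall>m\<ge>M. \<forall>i\<le>m. \<bar>cv m i 1 powr (r j / r 1) - cv m i j\<bar> \<le> \<epsilon>"
proof -
  consider "j = 0" | "j = 1" | "1 < j" by linarith
  then show ?thesis
  proof cases
    case 1
    have "\<bar>cv m i 1 powr (r j / r 1) - cv m i j\<bar> \<le> \<epsilon>" if "m \<ge> 1" "i \<le> m" for m i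
      using that assms(3) 1 cv_pos[of 1 m i] by (simp add: r0)
    then show ?thesis by blast
  next
    case 2
    have "\<bar>cv m i 1 powr (r j / r 1) - cv m i j\<bar> \<le> \<epsilon>" if "m \<ge> 1" "i \<le> m" for m i
      using that assms(3) 2 cv_pos[of 1 m i] r_pos[of 1] by simp
    then show ?thesis by blast
  next
    case 3
    obtain M where "\<forall>m\<ge>M. j \<le> m \<and> (\<forall>i\<le>m. cv m i 1 powr (r j / r 1) - cv m i j \<le> \<epsilon>)"
      using powr_minus_cv_eventually[OF 3 assms] by blast
    moreover have "\<bar>cv m i 1 powr (r j / r 1) - cv m i j\<bar> = cv m i 1 powr (r j / r 1) - cv m i j" if "j \<le> m" "i \<le> m" for m i
      using cv_le_powr[OF 3 that] by simp
    ultimately show ?thesis by metis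
  qed
qed

lemma cv_gaps_limit:
  assumes "\<not> summable (\<lambda>i. 1 / r (Suc i))" "filterlim r at_top sequentially" "\<epsilon> > 0"
  shows "\<exists>M. \<forall>m\<ge>M. \<forall>i<m. cv m (Suc i) 1 - cv m i 1 \<le> \<epsilon>"
  \<comment> \<open>The gaps concern exponent r 1 alone. Index 2 supplies a strictly convex
    comparison curve, and it is available for large m even if P uses only r 0 and r 1.\<close>
  using cv_gaps_eventually[of 2, OF _ assms] by simp

end

section \<open>Summable reciprocals: sums of exponential variables\<close>

text \<open>The integrating factor exp(R x) makes f - \<gamma> nondecreasing while g stays above
  \<gamma>. In the application f arises from g by adding an independent exponential variable of rate
  R.\<close>

lemma relaxation_lower_bound:
  fixes f g :: "real \<Rightarrow> real"
  assumes "\<And>x. (f has_real_derivative R * (g x - f x)) (at x)" "R > 0" "s \<le> t"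
    "\<And>x. s \<le> x \<Longrightarrow> x \<le> t \<Longrightarrow> \<gamma> \<le> g x"
  shows "\<gamma> + (f s - \<gamma>) * exp (- R * (t - s)) \<le> f t"
proof -
  have "exp (R * s) * (f s - \<gamma>) \<le> exp (R * t) * (f t - \<gamma>)"
  proof (rule DERIV_nonneg_imp_nondecreasing[OF assms(3)])
    fix x assume x: "s \<le> x" "x \<le> t"
    have "((\<lambda>x. exp (R * x) * (f x - \<gamma>)) has_real_derivative R * exp (R * x) * (g x - \<gamma>)) (at x)"
      by (rule derivative_eq_intros assms(1) refl | simp)+ (simp add: algebra_simps)
    moreover have "0 \<le> R * exp (R * x) * (g x - \<gamma>)" using assms(2,4) x by simp
    ultimately show "\<exists>y. ((\<lambda>x. exp (R * x) * (f x - \<gamma>)) has_real_derivative y) (at x) \<and> 0 \<le> y" by blast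
  qed
  then have "exp (- R * t) * (exp (R * s) * (f s - \<gamma>)) \<le> exp (- R * t) * (exp (R * t) * (f t - \<gamma>))"
    by (rule mult_left_mono) simp
  moreover have "exp (- R * t) * (exp (R * s) * y) = y * exp (- R * (t - s))"
    "exp (- R * t) * (exp (R * t) * y) = y" for y
  proof -
    have "exp (- R * t) * exp (R * s) = exp (- R * (t - s))" "exp (- R * t) * exp (R * t) = 1"
      unfolding exp_add[symmetric] by (simp_all add: right_diff_distrib)
    then show "exp (- R * t) * (exp (R * s) * y) = y * exp (- R * (t - s))"
      "exp (- R * t) * (exp (R * t) * y) = y"
      by (metis mult.assoc mult.commute, metis mult.assoc mult_1)
  qed
  ultimately have "(f s - \<gamma>) * exp (- R * (t - s)) \<le> f t - \<gamma>" by metis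
  then show ?thesis by linarith
qed

lemma relaxation_upper_bound:
  fixes f g :: "real \<Rightarrow> real"
  assumes "\<And>x. (f has_real_derivative R * (g x - f x)) (at x)" "R > 0" "s \<le> t"
    "\<And>x. s \<le> x \<Longrightarrow> x \<le> t \<Longrightarrow> g x \<le> \<gamma>"
  shows "f t \<le> \<gamma> + (f s - \<gamma>) * exp (- R * (t - s))"
proof -
  have "- \<gamma> + (- f s - - \<gamma>) * exp (- R * (t - s)) \<le> - f t"
  proof (rule relaxation_lower_bound[where g = "\<lambda>x. - g x"])
    show "((\<lambda>x. - f x) has_real_derivative R * (- g x - - f x)) (at x)" for x
      using DERIV_minus[OF assms(1)[of x]] by (simp add: algebra_simps)
  qed (use assms in auto)
  then show ?thesis by (simp add: algebra_simps)
qed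

lemma prod_linear_coeffs_below:
  assumes "finite K"
  shows "coeffs_below (Suc (card K)) (\<Prod>l\<in>K. [:- r l, 1:])"
  using assms
proof (induction K rule: finite_induct)
  case empty
  then show ?case by (auto simp: coeffs_below_def)
next
  case (insert x K)
  then have "coeffs_below (Suc (Suc (card K))) ([:- r x, 1:] * (\<Prod>l\<in>K. [:- r l, 1:]))"
    by (intro coeffs_below_linear_mult)
  then show ?case
    unfolding prod.insert[OF insert.hyps] card_insert_disjoint[OF insert.hyps] .
qed

context muntz_interval
begin

text \<open>Coefficients, with respect to \<open>exp (- s * r l)\<close>, of the distribution function of a sum of
  independent exponential variables with rates \<open>r (m - d + 1), \<dots>, r m\<close>.\<close>

primrec hyp :: "nat \<Rightarrow> nat \<Rightarrow> nat \<Rightarrow> real" where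
  "hyp m 0 = (\<lambda>l. if l = 0 then 1 else 0)"
| "hyp m (Suc d) = (\<lambda>l. if l = m - d then - (\<Sum>i\<in>{..m} - {m - d}. hyp m d i / (1 - r i / r (m - d)))
     else hyp m d l / (1 - r l / r (m - d)))"

lemma hyp_support: "d \<le> m \<Longrightarrow> l \<noteq> 0 \<Longrightarrow> l \<le> m - d \<Longrightarrow> hyp m d l = 0"
  by (induction d) auto

lemma hyp_0: "d \<le> m \<Longrightarrow> hyp m d 0 = 1"
  by (induction d) (auto simp: r0)

text \<open>Coefficient form of f + f' / r (m - d) = g. There is no resonance at l = m - d since g
  has no such term; that free coefficient is spent on f(0) = 0.\<close>

lemma hyp_rec:
  assumes "d < m"
  shows "hyp m (Suc d) l * (1 - r l / r (m - d)) = hyp m d l"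
proof (cases "l = m - d")
  case True
  then show ?thesis using hyp_support[of d m l] assms r_pos[of "m - d"] by simp
next
  case False
  then have "r l / r (m - d) \<noteq> 1" using assms r_pos[of "m - d"] by simp
  with False show ?thesis by simp
qed

declare hyp.simps(2) [simp del]

lemma hyp_rec': "d < m \<Longrightarrow> hyp m (Suc d) l * (r l - r (m - d)) = - r (m - d) * hyp m d l"
  using hyp_rec[of d m l] r_pos[of "m - d"] by (simp add: field_simps)

lemma hyp_sum: "(\<Sum>l\<le>m. hyp m (Suc d) l) = 0"
proof -
  have "(\<Sum>l\<in>{..m} - {m - d}. hyp m (Suc d) l) = (\<Sum>l\<in>{..m} - {m - d}. hyp m d l / (1 - r l / r (m - d)))"
    by (intro sum.cong) (auto simp: hyp.simps(2))
  moreover have "hyp m (Suc d) (m - d) = - (\<Sum>l\<in>{..m} - {m - d}. hyp m d l / (1 - r l / r (m - d)))"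
    by (simp add: hyp.simps(2))
  ultimately show ?thesis by (subst sum.remove[of _ "m - d"]) auto
qed

text \<open>Split p as p(c) + (x - c) u at the new rate c. The constant is killed by f(0) = 0, and
  the factor x - c turns the coefficients into those of the previous stage.\<close>

lemma ord_b_hyp: "d \<le> m \<Longrightarrow> ord_b m d (hyp m d)"
proof (induction d)
  case (Suc d)
  show ?case unfolding ord_b_def
  proof (intro allI impI)
    fix p assume p: "coeffs_below (Suc d) p"
    define c where "c = r (m - d)"
    have "coeffs_below (Suc d) (p - [:poly p c:])" using p by (intro coeffs_below_diff) auto
    then obtain u where u: "p - [:poly p c:] = [:- c, 1:] * u" "coeffs_below d u"
      using poly_divide_root[of "p - [:poly p c:]" c d] by auto
    have pu: "poly p x = poly p c + (x - c) * poly u x" for x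
      using arg_cong[OF u(1), of "\<lambda>p. poly p x"] by (simp add: algebra_simps)
    have "(\<Sum>l\<le>m. hyp m (Suc d) l * poly p (r l))
      = (\<Sum>l\<le>m. poly p c * hyp m (Suc d) l + (hyp m (Suc d) l * (r l - r (m - d))) * poly u (r l))"
      by (intro sum.cong refl, subst pu) (simp add: c_def algebra_simps)
    also have "\<dots> = (\<Sum>l\<le>m. poly p c * hyp m (Suc d) l + (- r (m - d)) * (hyp m d l * poly u (r l)))"
      using Suc.prems by (simp only: hyp_rec' Suc_le_eq mult.assoc)
    also have "\<dots> = poly p c * (\<Sum>l\<le>m. hyp m (Suc d) l) + (- r (m - d)) * (\<Sum>l\<le>m. hyp m d l * poly u (r l))"
      by (simp only: sum.distrib sum_distrib_left)
    also have "\<dots> = 0"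
      using hyp_sum[of m d] Suc u(2) by (simp add: ord_b_def)
    finally show "(\<Sum>l\<le>m. hyp m (Suc d) l * poly p (r l)) = 0" .
  qed
qed (simp add: ord_b_def)

text \<open>Otherwise the coefficients would live on 0 and d further nodes. The polynomial vanishing
  at those d nodes has d + 1 coefficients and sees only the coefficient at 0, which is 1.\<close>

lemma hyp_next_nonzero:
  assumes "d < m"
  shows "hyp m (Suc d) (m - d) \<noteq> 0"
proof
  assume z: "hyp m (Suc d) (m - d) = 0"
  define K where "K = {m - d<..m}"
  define p where "p = (\<Prod>l\<in>K. [:- r l, 1:])"
  have "coeffs_below (Suc d) p"
    using prod_linear_coeffs_below[of K r] assms by (simp add: p_def K_def)
  with ord_b_hyp[of "Suc d" m] assms have "(\<Sum>l\<le>m. hyp m (Suc d) l * poly p (r l)) = 0"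
    unfolding ord_b_def by simp
  moreover have "(\<Sum>l\<le>m. hyp m (Suc d) l * poly p (r l)) = hyp m (Suc d) 0 * poly p (r 0)"
  proof (subst sum.remove[of _ 0])
    have "hyp m (Suc d) l * poly p (r l) = 0" if "l \<in> {..m} - {0}" for l
    proof (cases "l \<in> K")
      case True
      then have "poly p (r l) = 0" unfolding p_def poly_prod K_def by (intro prod_zero) auto
      then show ?thesis by simp
    next
      case False
      then have "l = m - d \<or> l \<le> m - Suc d" using that by (auto simp: K_def)
      then show ?thesis using z hyp_support[of "Suc d" m l] that assms by auto
    qed
    then have "(\<Sum>l\<in>{..m} - {0}. hyp m (Suc d) l * poly p (r l)) = 0"
      by (intro sum.neutral ballI)
    then show "hyp m (Suc d) 0 * poly p (r 0) + (\<Sum>l\<in>{..m} - {0}. hyp m (Suc d) l * poly p (r l)) = hyp m (Suc d) 0 * poly p (r 0)"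
      by linarith
  qed auto
  moreover have "poly p (r 0) \<noteq> 0"
  proof -
    have "r l \<noteq> 0" if "l \<in> K" for l using r_pos[of l] that by (auto simp: K_def)
    then show ?thesis by (auto simp: p_def poly_prod r0 K_def)
  qed
  ultimately show False using hyp_0[of "Suc d" m] assms by simp
qed

section \<open>Bounds for the distribution functions\<close>

definition cdf :: "nat \<Rightarrow> nat \<Rightarrow> real \<Rightarrow> real" where
  "cdf m j s = (\<Sum>l\<le>m. hyp m (m - j) l * exp (- s * r l))"

lemma cdf_last: "cdf m m s = 1"
  by (simp add: cdf_def r0 if_distrib[of "\<lambda>x. x * _"] cong: if_cong)

lemma cdf_at_0: "j < m \<Longrightarrow> cdf m j 0 = 0"
  using hyp_sum[of m "m - Suc j"] by (simp add: cdf_def Suc_diff_Suc)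

lemma cdf_moment_rec:
  assumes "j < m"
  shows "r l * hyp m (m - j) l = r (Suc j) * (hyp m (m - j) l - hyp m (m - Suc j) l)"
  using hyp_rec'[of "m - Suc j" m l] assms by (simp add: Suc_diff_Suc algebra_simps)

lemma cdf_deriv:
  assumes "j < m"
  shows "(cdf m j has_real_derivative r (Suc j) * (cdf m (Suc j) s - cdf m j s)) (at s)"
proof -
  have "(cdf m j has_real_derivative (\<Sum>l\<le>m. hyp m (m - j) l * (- r l * exp (- s * r l)))) (at s)"
    unfolding cdf_def by (auto intro!: derivative_eq_intros DERIV_sum)
  also have "(\<Sum>l\<le>m. hyp m (m - j) l * (- r l * exp (- s * r l))) = (\<Sum>l\<le>m. - (r l * hyp m (m - j) l) * exp (- s * r l))"
    by (simp add: mult_ac)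
  also have "\<dots> = r (Suc j) * (cdf m (Suc j) s - cdf m j s)"
    unfolding cdf_moment_rec[OF assms] cdf_def
    by (simp add: sum_distrib_left sum_subtractf[symmetric] algebra_simps)
  finally show ?thesis .
qed

text \<open>Variables are added one at a time, starting from the empty sum at j = m. Bounds and
  monotonicity are carried jointly because the relaxation bound for j uses the value of j + 1 at the
  right end as its maximum.\<close>

lemma cdf_basic:
  assumes "j \<le> m"
  shows "(\<forall>s\<ge>0. 0 \<le> cdf m j s \<and> cdf m j s \<le> 1) \<and> (\<forall>s t. 0 \<le> s \<longrightarrow> s \<le> t \<longrightarrow> cdf m j s \<le> cdf m j t)"
    (is "?Q j")
  and cdf_step: "j < m \<Longrightarrow> s \<ge> 0 \<Longrightarrow> cdf m j s \<le> cdf m (Suc j) s * (1 - exp (- r (Suc j) * s))"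
proof -
  have upper: "cdf m j s \<le> cdf m (Suc j) s * (1 - exp (- r (Suc j) * s))"
    if "j < m" "s \<ge> 0" "?Q (Suc j)" for j s
  proof -
    have "cdf m j s \<le> cdf m (Suc j) s + (cdf m j 0 - cdf m (Suc j) s) * exp (- r (Suc j) * (s - 0))"
      by (rule relaxation_upper_bound[where g = "cdf m (Suc j)"])
        (use that cdf_deriv r_pos in auto)
    then show ?thesis using that by (simp add: cdf_at_0 algebra_simps)
  qed
  have Q: "?Q j" if "j \<le> m" for j
    using that
  proof (induction j rule: inc_induct)
    case base
    then show ?case by (simp add: cdf_last)
  next
    case (step j)
    then have IH: "?Q (Suc j)" by simp
    have nn: "0 \<le> cdf m j s" if "s \<ge> 0" for s
    proof -
      have "0 + (cdf m j 0 - 0) * exp (- r (Suc j) * (s - 0)) \<le> cdf m j s"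
        by (rule relaxation_lower_bound[where g = "cdf m (Suc j)"])
          (use that step cdf_deriv r_pos in auto)
      then show ?thesis using step by (simp add: cdf_at_0)
    qed
    have le: "cdf m j s \<le> cdf m (Suc j) s" if s: "s \<ge> 0" for s
    proof -
      have "cdf m j s \<le> cdf m (Suc j) s * (1 - exp (- r (Suc j) * s))" using upper step s by auto
      also have "\<dots> \<le> cdf m (Suc j) s * 1" using IH s by (intro mult_left_mono) auto
      finally show ?thesis by simp
    qed
    have "cdf m j s \<le> cdf m j t" if "0 \<le> s" "s \<le> t" for s t
    proof (rule DERIV_nonneg_imp_nondecreasing[OF that(2)])
      fix x assume "s \<le> x" "x \<le> t"
      then have "0 \<le> r (Suc j) * (cdf m (Suc j) x - cdf m j x)" using le[of x] that by simp
      then show "\<exists>y. (cdf m j has_real_derivative y) (at x) \<and> 0 \<le> y"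
        using cdf_deriv step by blast
    qed
    moreover have "cdf m j s \<le> 1" if "s \<ge> 0" for s using le[OF that] IH that by force
    ultimately show ?case using nn by blast
  qed
  show "?Q j" by (rule Q[OF assms])
  show "cdf m j s \<le> cdf m (Suc j) s * (1 - exp (- r (Suc j) * s))" if "j < m" "s \<ge> 0"
    using upper[OF that] Q[of "Suc j"] that by simp
qed

lemma cdf_nonneg: "j \<le> m \<Longrightarrow> 0 \<le> s \<Longrightarrow> 0 \<le> cdf m j s"
  and cdf_le_1: "j \<le> m \<Longrightarrow> 0 \<le> s \<Longrightarrow> cdf m j s \<le> 1"
  and cdf_mono: "j \<le> m \<Longrightarrow> 0 \<le> s \<Longrightarrow> s \<le> t \<Longrightarrow> cdf m j s \<le> cdf m j t"
  using cdf_basic by blast+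

lemma cdf_le_linear:
  assumes "j < m" "s \<ge> 0"
  shows "cdf m j s \<le> r (Suc j) * s * cdf m (Suc j) s"
proof -
  have "cdf m j s \<le> cdf m (Suc j) s * (1 - exp (- r (Suc j) * s))"
    using cdf_step[of j m s] assms by simp
  also have "\<dots> \<le> cdf m (Suc j) s * (r (Suc j) * s)"
    using exp_ge_add_one_self[of "- r (Suc j) * s"] cdf_nonneg[of "Suc j" m s] assms
    by (intro mult_left_mono) auto
  finally show ?thesis by (simp add: mult_ac)
qed

lemma cdf_le_Suc:
  assumes "j < m" "s \<ge> 0"
  shows "cdf m j s \<le> cdf m (Suc j) s"
proof -
  have "cdf m j s \<le> cdf m (Suc j) s * (1 - exp (- r (Suc j) * s))"
    using cdf_step[of j m s] assms by simp
  also have "\<dots> \<le> cdf m (Suc j) s * 1"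
    using cdf_nonneg[of "Suc j" m s] assms by (intro mult_left_mono) auto
  finally show ?thesis by simp
qed

lemma cdf_le_later: "j \<le> k \<Longrightarrow> k \<le> m \<Longrightarrow> s \<ge> 0 \<Longrightarrow> cdf m j s \<le> cdf m k s"
proof (induction k rule: dec_induct)
  case (step n)
  then show ?case using cdf_le_Suc[of n m s] by simp
qed simp

text \<open>Markov's inequality from the differential equation instead of an integral. Up to the
  mean \<mu> the left side is at most 0. Beyond it an integrating factor reduces the claim to the
  bound for j + 1, and R (\<mu> - \<nu>) = 1 pays for the derivative of \<mu> / x.\<close>

lemma cdf_markov:
  assumes "j \<le> m" "s > 0"
  shows "1 - (\<Sum>i\<in>{j<..m}. 1 / r i) / s \<le> cdf m j s"
  using assms
proof (induction j arbitrary: s rule: inc_induct)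
  case base
  then show ?case by (simp add: cdf_last)
next
  case (step j)
  define R where "R = r (Suc j)"
  define \<nu> where "\<nu> = (\<Sum>i\<in>{Suc j<..m}. 1 / r i)"
  define \<mu> where "\<mu> = \<nu> + 1 / R"
  have R: "R > 0" using r_pos by (simp add: R_def)
  have \<nu>: "\<nu> \<ge> 0" unfolding \<nu>_def by (intro sum_nonneg) simp
  have \<mu>: "\<mu> > 0" using \<nu> R by (simp add: \<mu>_def add_nonneg_pos)
  have "{j<..m} = insert (Suc j) {Suc j<..m}" using step.hyps by auto
  then have sum: "(\<Sum>i\<in>{j<..m}. 1 / r i) = \<mu>" by (simp add: \<mu>_def \<nu>_def R_def)
  show ?case
  proof (cases "s \<le> \<mu>")
    case True
    then have "1 - \<mu> / s \<le> 0" using step.prems by simp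
    also have "0 \<le> cdf m j s" using cdf_nonneg[of j m s] step by simp
    finally show ?thesis by (simp add: sum)
  next
    case False
    have "exp (R * \<mu>) * (cdf m j \<mu> - 1 + \<mu> / \<mu>) \<le> exp (R * s) * (cdf m j s - 1 + \<mu> / s)"
    proof (rule DERIV_nonneg_imp_nondecreasing[where f = "\<lambda>s. exp (R * s) * (cdf m j s - 1 + \<mu> / s)"])
      fix x assume x: "\<mu> \<le> x" "x \<le> s"
      then have x0: "x > 0" using \<mu> by simp
      have D: "(cdf m j has_real_derivative R * (cdf m (Suc j) x - cdf m j x)) (at x)"
        unfolding R_def using step.hyps by (intro cdf_deriv) auto
      have "((\<lambda>s. exp (R * s) * (cdf m j s - 1 + \<mu> / s)) has_real_derivative
        exp (R * x) * R * (cdf m j x - 1 + \<mu> / x)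
          + (R * (cdf m (Suc j) x - cdf m j x) - \<mu> / (x * x)) * exp (R * x)) (at x)"
        by (rule derivative_eq_intros D refl | use x0 in simp)+
      also have "exp (R * x) * R * (cdf m j x - 1 + \<mu> / x)
          + (R * (cdf m (Suc j) x - cdf m j x) - \<mu> / (x * x)) * exp (R * x)
        = exp (R * x) * (R * (cdf m (Suc j) x - 1 + \<mu> / x) - \<mu> / (x * x))"
        by (simp add: algebra_simps)
      finally have "((\<lambda>s. exp (R * s) * (cdf m j s - 1 + \<mu> / s)) has_real_derivative
        exp (R * x) * (R * (cdf m (Suc j) x - 1 + \<mu> / x) - \<mu> / (x * x))) (at x)" .
      moreover have "0 \<le> R * (cdf m (Suc j) x - 1 + \<mu> / x) - \<mu> / (x * x)"
      proof -
        have "1 - \<nu> / x \<le> cdf m (Suc j) x" using step.IH[OF x0] by (simp add: \<nu>_def)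
        then have "(\<mu> - \<nu>) / x \<le> cdf m (Suc j) x - 1 + \<mu> / x" by (simp add: diff_divide_distrib)
        then have "R * ((\<mu> - \<nu>) / x) \<le> R * (cdf m (Suc j) x - 1 + \<mu> / x)"
          using R by (intro mult_left_mono) auto
        moreover have "R * ((\<mu> - \<nu>) / x) = 1 / x" using R by (simp add: \<mu>_def)
        moreover have "\<mu> / (x * x) \<le> 1 / x" using x x0 by (simp add: field_simps)
        ultimately show ?thesis by linarith
      qed
      ultimately show "\<exists>y. ((\<lambda>s. exp (R * s) * (cdf m j s - 1 + \<mu> / s)) has_real_derivative y) (at x) \<and> 0 \<le> y"
        by (intro exI conjI) (assumption, simp)
    qed (use False in simp)
    moreover have "0 \<le> exp (R * \<mu>) * (cdf m j \<mu> - 1 + \<mu> / \<mu>)"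
      using cdf_nonneg[of j m \<mu>] step.hyps \<mu> by simp
    ultimately have "0 \<le> exp (R * s) * (cdf m j s - 1 + \<mu> / s)" by linarith
    then show ?thesis by (simp add: sum zero_le_mult_iff)
  qed
qed

text \<open>Half of s goes to the tail beyond M, whose mean is at most s / 4, so Markov leaves
  probability 1/2. The other half is shared by the finitely many variables j + 1, ..., M, each
  costing a factor independent of m.\<close>

lemma cdf_lower_bound:
  assumes sm: "summable (\<lambda>i. 1 / r (Suc i))" and s: "s > 0"
  shows "\<exists>L>0. \<forall>m\<ge>j. L \<le> cdf m j s"
proof -
  obtain N where N: "\<And>n. norm (\<Sum>i\<in>{N..<n}. 1 / r (Suc i)) < s / 4"
  proof -
    have "s / 4 > 0" using s by simp
    then obtain N where "\<forall>m\<ge>N. \<forall>n. norm (\<Sum>i\<in>{m..<n}. 1 / r (Suc i)) < s / 4"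
      using sm unfolding summable_Cauchy by blast
    then show thesis using that[of N] by blast
  qed
  define M where "M = max N j"
  have tail: "(\<Sum>i\<in>{M<..m}. 1 / r i) \<le> s / 4" for m
  proof -
    have "(\<Sum>i\<in>{M<..m}. 1 / r i) = (\<Sum>i\<in>{M..<m}. 1 / r (Suc i))"
      by (rule sum.reindex_bij_witness[of _ Suc "\<lambda>i. i - 1"]) auto
    also have "\<dots> \<le> (\<Sum>i\<in>{N..<m}. 1 / r (Suc i))"
      by (intro sum_mono2) (auto simp: M_def)
    also have "\<dots> \<le> s / 4" using N[of m] by simp
    finally show ?thesis .
  qed
  have base: "1 / 2 \<le> cdf m M (s / 2)" if "M \<le> m" for m
  proof -
    have "(\<Sum>i\<in>{M<..m}. 1 / r i) / (s / 2) \<le> s / 4 / (s / 2)"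
      using tail[of m] s by (intro divide_right_mono) auto
    also have "\<dots> = 1 / 2" using s by simp
    finally have "(\<Sum>i\<in>{M<..m}. 1 / r i) / (s / 2) \<le> 1 / 2" .
    moreover have "s / 2 > 0" using s by simp
    ultimately show ?thesis using cdf_markov[OF that \<open>s / 2 > 0\<close>] by linarith
  qed
  \<comment> \<open>At most M slices of this length fit into s / 2; the added 1 keeps the divisor
    positive for M = 0.\<close>
  define \<delta> where "\<delta> = s / (2 * (real M + 1))"
  have \<delta>: "\<delta> > 0" using s by (simp add: \<delta>_def)
  have "\<exists>L>0. \<forall>m\<ge>M - n. L \<le> cdf m (M - n) (s / 2 + real n * \<delta>)" if "n \<le> M" for n
    using that
  proof (induction n)
    case 0
    then show ?case using base by (intro exI[of _ "1/2"]) auto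
  next
    case (Suc n)
    then obtain L where L: "L > 0" "\<And>m. m \<ge> M - n \<Longrightarrow> L \<le> cdf m (M - n) (s / 2 + real n * \<delta>)" by auto
    define i where "i = M - Suc n"
    have i: "M - n = Suc i" using Suc.prems by (simp add: i_def)
    define t where "t = s / 2 + real n * \<delta>"
    have t: "t \<ge> 0" using s \<delta> by (simp add: t_def)
    \<comment> \<open>The minimum with 1 covers m = i, where the sum of variables is empty and the
      distribution function is constantly 1.\<close>
    define L' where "L' = min 1 (L * (1 - exp (- r (Suc i) * \<delta>)))"
    have L': "L' > 0" using L \<delta> r_pos[of "Suc i"] by (simp add: L'_def)
    have "L' \<le> cdf m i (t + \<delta>)" if m: "m \<ge> i" for m
    proof (cases "m = i")
      case True
      then show ?thesis by (simp add: cdf_last L'_def)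
    next
      case False
      then have m': "Suc i \<le> m" "i < m" using m by auto
      have "L + (cdf m i t - L) * exp (- r (Suc i) * (t + \<delta> - t)) \<le> cdf m i (t + \<delta>)"
      proof (rule relaxation_lower_bound[where g = "cdf m (Suc i)"])
        fix x assume "t \<le> x"
        have "L \<le> cdf m (Suc i) t" using L(2)[of m] m' i by (simp add: t_def)
        also have "\<dots> \<le> cdf m (Suc i) x" using cdf_mono[OF m'(1) t \<open>t \<le> x\<close>] .
        finally show "L \<le> cdf m (Suc i) x" .
      qed (use m' cdf_deriv r_pos \<delta> in auto)
      moreover have "0 \<le> cdf m i t * exp (- r (Suc i) * \<delta>)"
        using cdf_nonneg[of i m t] m' t by simp
      ultimately have "L * (1 - exp (- r (Suc i) * \<delta>)) \<le> cdf m i (t + \<delta>)" by (simp add: algebra_simps)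
      then show ?thesis by (simp add: L'_def)
    qed
    moreover have "t + \<delta> = s / 2 + real (Suc n) * \<delta>" by (simp add: t_def algebra_simps)
    ultimately show ?case using L' unfolding i_def by auto
  qed
  from this[of "M - j"] obtain L where
    L: "L > 0" "\<And>m. m \<ge> j \<Longrightarrow> L \<le> cdf m j (s / 2 + real (M - j) * \<delta>)"
    by (auto simp: M_def)
  have "s / 2 + real (M - j) * \<delta> \<le> s"
  proof -
    have "real (M - j) * \<delta> \<le> (real M + 1) * \<delta>" using \<delta> by (intro mult_right_mono) auto
    also have "\<dots> = s / 2" by (simp add: \<delta>_def field_simps)
    finally show ?thesis by simp
  qed
  then have "L \<le> cdf m j s" if "m \<ge> j" for m
    using L(2)[OF that] cdf_mono[of j m "s / 2 + real (M - j) * \<delta>" s] that s \<delta> by simp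
  with L(1) show ?thesis by blast
qed

text \<open>Near \<open>s = 0\<close> each distribution function is negligible against the next one, so the last
  coefficient of a bounded combination is bounded, and then so are the others.\<close>

lemma cdf_coeffs_bounded:
  assumes "summable (\<lambda>i. 1 / r (Suc i))"
  shows "\<exists>C\<ge>0. \<forall>m\<ge>k. \<forall>c. (\<forall>s. 0 < s \<longrightarrow> s \<le> \<sigma> \<longrightarrow> \<bar>\<Sum>j\<le>k. c j * cdf m j s\<bar> \<le> 1) \<longrightarrow> (\<forall>j\<le>k. \<bar>c j\<bar> \<le> C)"
proof (induction k)
  case 0
  obtain L where L: "L > 0" "\<And>m. L \<le> cdf m 0 \<sigma>" using cdf_lower_bound[OF assms \<sigma>_pos, of 0] by auto
  have "\<bar>c 0\<bar> \<le> 1 / L" if "\<bar>c 0 * cdf m 0 \<sigma>\<bar> \<le> 1" for c :: "nat \<Rightarrow> real" and m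
  proof -
    have "\<bar>c 0\<bar> * L \<le> \<bar>c 0\<bar> * cdf m 0 \<sigma>" using L by (intro mult_left_mono) auto
    also have "\<dots> \<le> 1" using that L(1) L(2)[of m] by (simp add: abs_mult)
    finally show ?thesis using L by (simp add: field_simps)
  qed
  then show ?case using L(1) \<sigma>_pos by (intro exI[of _ "1 / L"]) auto
next
  case (Suc k)
  then obtain C where C: "C \<ge> 0" "\<And>m c j. m \<ge> k \<Longrightarrow>
    (\<And>s. 0 < s \<Longrightarrow> s \<le> \<sigma> \<Longrightarrow> \<bar>\<Sum>j\<le>k. c j * cdf m j s\<bar> \<le> 1) \<Longrightarrow> j \<le> k \<Longrightarrow> \<bar>c j\<bar> \<le> C"
    by metis
  define R where "R = r (Suc k)"
  have R: "R > 0" using r_pos by (simp add: R_def)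
  \<comment> \<open>So small that k + 1 terms bounded by C (1 + |g|) R s v, with g the top
    coefficient and v its distribution function at s, add up to at most half of (1 + |g|) v.\<close>
  define s where "s = min \<sigma> (1 / (2 * (real k + 1) * (C + 1) * R))"
  have s: "s > 0" "s \<le> \<sigma>" using \<sigma>_pos C(1) R by (auto simp: s_def)
  have "s \<le> 1 / (2 * (real k + 1) * (C + 1) * R)" by (simp add: s_def)
  then have "s * (2 * (real k + 1) * (C + 1) * R) \<le> 1"
    using C(1) R by (simp add: pos_le_divide_eq)
  moreover have "s * (2 * (real k + 1) * C * R) \<le> s * (2 * (real k + 1) * (C + 1) * R)"
    using s R C(1) by (intro mult_left_mono mult_right_mono) auto
  ultimately have sR: "(real k + 1) * C * (R * s) \<le> 1 / 2" by (simp add: mult_ac)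
  obtain L where L: "L > 0" "\<And>m. m \<ge> Suc k \<Longrightarrow> L \<le> cdf m (Suc k) s"
    using cdf_lower_bound[OF assms s(1), of "Suc k"] by auto
  \<comment> \<open>Solves |g| v \<le> 2 + v in the worst case v = L.\<close>
  define G where "G = 2 / L + 1"
  have G: "G > 0" using L by (simp add: G_def add_pos_pos)
  have main: "\<bar>c j\<bar> \<le> G + C * (1 + G)" if m: "m \<ge> Suc k"
    and c: "\<And>s. 0 < s \<Longrightarrow> s \<le> \<sigma> \<Longrightarrow> \<bar>\<Sum>j\<le>Suc k. c j * cdf m j s\<bar> \<le> 1" and j: "j \<le> Suc k" for m c j
  proof -
    define g where "g = c (Suc k)"
    \<comment> \<open>Without its top term the combination is bounded by 1 + |g|, so the induction
      hypothesis applies after rescaling.\<close>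
    have cj: "\<bar>c j\<bar> \<le> C * (1 + \<bar>g\<bar>)" if j: "j \<le> k" for j
    proof -
      have "\<bar>c j / (1 + \<bar>g\<bar>)\<bar> \<le> C"
      proof (rule C(2)[of m "\<lambda>j. c j / (1 + \<bar>g\<bar>)"])
        fix s :: real assume s: "0 < s" "s \<le> \<sigma>"
        have "\<bar>g * cdf m (Suc k) s\<bar> \<le> \<bar>g\<bar>"
          using cdf_nonneg[OF m] cdf_le_1[OF m] s by (simp add: abs_mult mult_left_le)
        moreover have "(\<Sum>j\<le>Suc k. c j * cdf m j s) = (\<Sum>j\<le>k. c j * cdf m j s) + g * cdf m (Suc k) s"
          by (simp add: g_def)
        ultimately have "\<bar>\<Sum>j\<le>k. c j * cdf m j s\<bar> \<le> 1 + \<bar>g\<bar>" using c[OF s] by linarith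
        moreover have "(\<Sum>j\<le>k. c j / (1 + \<bar>g\<bar>) * cdf m j s) = (\<Sum>j\<le>k. c j * cdf m j s) / (1 + \<bar>g\<bar>)"
          by (simp add: sum_divide_distrib)
        ultimately show "\<bar>\<Sum>j\<le>k. c j / (1 + \<bar>g\<bar>) * cdf m j s\<bar> \<le> 1"
          by (simp add: abs_divide)
      qed (use m j in auto)
      then show ?thesis by (simp add: abs_divide divide_le_eq)
    qed
    define v where "v = cdf m (Suc k) s"
    have v: "L \<le> v" "v > 0" using L(1) L(2)[OF m] by (auto simp: v_def)
    have small: "\<bar>\<Sum>j\<le>k. c j * cdf m j s\<bar> \<le> (1 + \<bar>g\<bar>) / 2 * v"
    proof -
      have "\<bar>\<Sum>j\<le>k. c j * cdf m j s\<bar> \<le> (\<Sum>j\<le>k. \<bar>c j * cdf m j s\<bar>)" by (rule sum_abs)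
      also have "\<dots> \<le> (\<Sum>j\<le>k. C * (1 + \<bar>g\<bar>) * (R * s * v))"
      proof (rule sum_mono)
        fix j assume j: "j \<in> {..k}"
        have "0 \<le> cdf m j s" using cdf_nonneg[of j m s] m j s by simp
        moreover have "cdf m j s \<le> R * s * v"
          using cdf_le_later[of j k m s] cdf_le_linear[of k m s] m j s by (simp add: R_def v_def)
        ultimately show "\<bar>c j * cdf m j s\<bar> \<le> C * (1 + \<bar>g\<bar>) * (R * s * v)"
          unfolding abs_mult using cj[of j] j C(1) by (intro mult_mono) auto
      qed
      also have "\<dots> = ((real k + 1) * C * (R * s)) * ((1 + \<bar>g\<bar>) * v)" by (simp add: mult_ac)
      also have "\<dots> \<le> (1 / 2) * ((1 + \<bar>g\<bar>) * v)" using sR v by (intro mult_right_mono) auto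
      finally show ?thesis by simp
    qed
    have "(\<Sum>j\<le>Suc k. c j * cdf m j s) = (\<Sum>j\<le>k. c j * cdf m j s) + g * v" by (simp add: g_def v_def)
    then have "\<bar>g * v\<bar> \<le> 1 + (1 + \<bar>g\<bar>) / 2 * v" using c[OF s] small by linarith
    then have "\<bar>g\<bar> * v \<le> 2 + v" using v by (simp add: abs_mult field_simps)
    then have "\<bar>g\<bar> \<le> 2 / v + 1" using v by (simp add: field_simps)
    also have "2 / v \<le> 2 / L" using v L by (intro divide_left_mono) auto
    finally have gG: "\<bar>g\<bar> \<le> G" by (simp add: G_def)
    show ?thesis
    proof (cases "j = Suc k")
      case True
      then show ?thesis using gG C(1) G by (simp add: g_def add_increasing2)
    next
      case False
      then have "\<bar>c j\<bar> \<le> C * (1 + \<bar>g\<bar>)" using cj j by simp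
      also have "\<dots> \<le> C * (1 + G)" using gG C(1) by (intro mult_left_mono) auto
      finally show ?thesis using G by simp
    qed
  qed
  show ?case
    using main C(1) G by (intro exI[of _ "G + C * (1 + G)"]) (auto intro!: add_nonneg_nonneg mult_nonneg_nonneg)
qed

text \<open>Triangular elimination: \<open>hyp m (m - j)\<close> lives on 0 and the indices above j
  and is nonzero at j + 1. Hence j < k match the coefficients 1, ..., k, and j = k then adjusts the
  constant. The remainder lives on m - k nodes and kills polynomials with m - k coefficients, so it
  is zero.\<close>

lemma bern_as_hyp:
  assumes "k \<le> m"
  obtains c where "\<And>l. l \<le> m \<Longrightarrow> bern m k l = (\<Sum>j\<le>k. c j * hyp m (m - j) l)"
proof -
  have "\<exists>c. \<forall>l. 0 < l \<and> l \<le> n \<longrightarrow> bern m k l = (\<Sum>j<n. c j * hyp m (m - j) l)" if "n \<le> k" for n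
    using that
  proof (induction n)
    case 0
    then show ?case by auto
  next
    case (Suc n)
    then obtain c where c: "\<And>l. 0 < l \<Longrightarrow> l \<le> n \<Longrightarrow> bern m k l = (\<Sum>j<n. c j * hyp m (m - j) l)" by auto
    have nm: "n < m" "n \<le> m" using Suc.prems assms by auto
    have nz: "hyp m (m - n) (Suc n) \<noteq> 0"
      using hyp_next_nonzero[of "m - Suc n" m] nm by (simp add: Suc_diff_Suc)
    define e where "e = (bern m k (Suc n) - (\<Sum>j<n. c j * hyp m (m - j) (Suc n))) / hyp m (m - n) (Suc n)"
    have eq: "(\<Sum>j<Suc n. (c(n := e)) j * hyp m (m - j) l) = (\<Sum>j<n. c j * hyp m (m - j) l) + e * hyp m (m - n) l" for l
      by simp
    have "bern m k l = (\<Sum>j<Suc n. (c(n := e)) j * hyp m (m - j) l)" if "0 < l" "l \<le> Suc n" for l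
    proof (cases "l = Suc n")
      case True
      then show ?thesis unfolding eq using nz by (simp add: e_def)
    next
      case False
      then have "l \<le> n" "hyp m (m - n) l = 0" using that hyp_support[of "m - n" m l] nm by auto
      then show ?thesis unfolding eq using c that by simp
    qed
    then show ?case by blast
  qed
  from this[of k] obtain c where c: "\<And>l. 0 < l \<Longrightarrow> l \<le> k \<Longrightarrow> bern m k l = (\<Sum>j<k. c j * hyp m (m - j) l)" by auto
  define e where "e = bern m k 0 - (\<Sum>j<k. c j * hyp m (m - j) 0)"
  define c' where "c' = c(k := e)"
  have eq: "(\<Sum>j\<le>k. c' j * hyp m (m - j) l) = (\<Sum>j<k. c j * hyp m (m - j) l) + e * hyp m (m - k) l" for l
    by (simp add: c'_def lessThan_Suc_atMost[symmetric])
  define \<delta> where "\<delta> l = bern m k l - (\<Sum>j\<le>k. c' j * hyp m (m - j) l)" for l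
  have low: "\<delta> l = 0" if "l \<le> k" for l
  proof (cases "l = 0")
    case True
    then show ?thesis unfolding \<delta>_def eq using hyp_0[of "m - k" m] by (simp add: e_def)
  next
    case False
    then show ?thesis unfolding \<delta>_def eq using c[of l] that hyp_support[of "m - k" m l] assms by simp
  qed
  have ord: "ord_b m (m - k) \<delta>" unfolding ord_b_def
  proof (intro allI impI)
    fix p assume p: "coeffs_below (m - k) p"
    have "(\<Sum>l\<le>m. \<delta> l * poly p (r l)) = (\<Sum>l\<le>m. bern m k l * poly p (r l))
      - (\<Sum>l\<le>m. (\<Sum>j\<le>k. c' j * hyp m (m - j) l) * poly p (r l))"
      by (simp add: \<delta>_def left_diff_distrib sum_subtractf)
    also have "(\<Sum>l\<le>m. bern m k l * poly p (r l)) = 0" using bern(1)[OF assms] p by (simp add: ord_b_def)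
    also have "(\<Sum>l\<le>m. (\<Sum>j\<le>k. c' j * hyp m (m - j) l) * poly p (r l))
      = (\<Sum>j\<le>k. c' j * (\<Sum>l\<le>m. hyp m (m - j) l * poly p (r l)))"
      unfolding sum_distrib_left sum_distrib_right by (subst sum.swap) (simp add: mult_ac)
    also have "\<dots> = 0"
    proof (intro sum.neutral ballI)
      fix j assume "j \<in> {..k}"
      then have "coeffs_below (m - j) p" using p by (auto elim: coeffs_below_mono)
      then show "c' j * (\<Sum>l\<le>m. hyp m (m - j) l * poly p (r l)) = 0"
        using ord_b_hyp[of "m - j" m] by (simp add: ord_b_def)
    qed
    finally show "(\<Sum>l\<le>m. \<delta> l * poly p (r l)) = 0" by simp
  qed
  have "\<delta> i = 0" if i: "i \<le> m" for i
  proof (cases "i \<le> k")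
    case False
    define K where "K = {k<..m} - {i}"
    define p where "p = (\<Prod>l\<in>K. [:- r l, 1:])"
    have "Suc (card K) = m - k" using False i by (simp add: K_def card_Diff_singleton_if)
    then have "coeffs_below (m - k) p" using prod_linear_coeffs_below[of K r] by (simp add: p_def K_def)
    with ord have "(\<Sum>l\<le>m. \<delta> l * poly p (r l)) = 0" by (simp add: ord_b_def)
    moreover have "(\<Sum>l\<le>m. \<delta> l * poly p (r l)) = \<delta> i * poly p (r i)"
    proof (subst sum.remove[of _ i])
      have "\<delta> l * poly p (r l) = 0" if "l \<in> {..m} - {i}" for l
      proof (cases "l \<in> K")
        case True
        then have "poly p (r l) = 0" unfolding p_def poly_prod K_def by (intro prod_zero) auto
        then show ?thesis by simp
      qed (use low that in \<open>auto simp: K_def\<close>)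
      then have "(\<Sum>l\<in>{..m} - {i}. \<delta> l * poly p (r l)) = 0" by (intro sum.neutral ballI)
      then show "\<delta> i * poly p (r i) + (\<Sum>l\<in>{..m} - {i}. \<delta> l * poly p (r l)) = \<delta> i * poly p (r i)" by simp
    qed (use i in auto)
    moreover have "poly p (r i) \<noteq> 0" unfolding p_def poly_prod K_def by auto
    ultimately show ?thesis by simp
  qed (use low in auto)
  then show ?thesis using that[of c'] by (simp add: \<delta>_def)
qed

text \<open>Each factor r l is a differentiation, which the relaxation equation trades for the
  indices j and j + 1; n of them reach j + n, hence the range of m.\<close>

lemma hyp_moment_bounded:
  "\<exists>D. \<forall>m\<ge>j + n. \<bar>\<Sum>l\<le>m. hyp m (m - j) l * (r l ^ n * exp (- \<sigma> * r l))\<bar> \<le> D"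
proof (induction n arbitrary: j)
  case 0
  have "\<bar>\<Sum>l\<le>m. hyp m (m - j) l * (r l ^ 0 * exp (- \<sigma> * r l))\<bar> \<le> 1" if "m \<ge> j" for m
    using cdf_nonneg[of j m \<sigma>] cdf_le_1[of j m \<sigma>] that \<sigma>_pos by (simp add: cdf_def)
  then show ?case by auto
next
  case (Suc n)
  let ?M = "\<lambda>m j n. \<Sum>l\<le>m. hyp m (m - j) l * (r l ^ n * exp (- \<sigma> * r l))"
  obtain D1 where D1: "\<And>m. m \<ge> j + n \<Longrightarrow> \<bar>?M m j n\<bar> \<le> D1" using Suc[of j] by auto
  obtain D2 where D2: "\<And>m. m \<ge> Suc j + n \<Longrightarrow> \<bar>?M m (Suc j) n\<bar> \<le> D2" using Suc[of "Suc j"] by auto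
  have "\<bar>?M m j (Suc n)\<bar> \<le> r (Suc j) * (D1 + D2)" if m: "m \<ge> j + Suc n" for m
  proof -
    have jm: "j < m" using m by simp
    have "?M m j (Suc n) = (\<Sum>l\<le>m. (r l * hyp m (m - j) l) * (r l ^ n * exp (- \<sigma> * r l)))"
      by (intro sum.cong refl) simp
    also have "\<dots> = r (Suc j) * (?M m j n - ?M m (Suc j) n)"
      unfolding cdf_moment_rec[OF jm] by (simp add: sum_distrib_left sum_subtractf[symmetric] algebra_simps)
    finally have "\<bar>?M m j (Suc n)\<bar> = r (Suc j) * \<bar>?M m j n - ?M m (Suc j) n\<bar>" by (simp add: abs_mult)
    also have "\<dots> \<le> r (Suc j) * (D1 + D2)"
      using D1[of m] D2[of m] m by (intro mult_left_mono) auto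
    finally show ?thesis .
  qed
  then show ?case by blast
qed

lemma iden_lead_lower_bound:
  assumes "summable (\<lambda>i. 1 / r (Suc i))"
  shows "\<exists>\<delta>>0. \<forall>m\<ge>2 * k. \<delta> \<le> coeff (iden \<sigma> (nodes m) 0 k) k"
proof -
  obtain C where C: "C \<ge> 0" "\<And>m c j. m \<ge> k \<Longrightarrow>
    (\<And>s. 0 < s \<Longrightarrow> s \<le> \<sigma> \<Longrightarrow> \<bar>\<Sum>j\<le>k. c j * cdf m j s\<bar> \<le> 1) \<Longrightarrow> j \<le> k \<Longrightarrow> \<bar>c j\<bar> \<le> C"
    using cdf_coeffs_bounded[OF assms, of k] by metis
  let ?M = "\<lambda>m j. \<Sum>l\<le>m. hyp m (m - j) l * (r l ^ k * exp (- \<sigma> * r l))"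
  \<comment> \<open>The index j goes up to k and k differentiations raise it by k more, whence the
    bound 2 k on m.\<close>
  have "\<forall>j. \<exists>D. \<forall>m\<ge>j + k. \<bar>?M m j\<bar> \<le> D" using hyp_moment_bounded by blast
  then obtain D where D: "\<And>j m. m \<ge> j + k \<Longrightarrow> \<bar>?M m j\<bar> \<le> D j" by metis
  define K where "K = (\<Sum>j\<le>k. C * D j) + 1"
  have D0: "D j \<ge> 0" for j using D[of j "j + k"] by linarith
  have K: "K > 0" unfolding K_def using C(1) D0 by (intro add_nonneg_pos sum_nonneg) auto
  have "1 / K \<le> coeff (iden \<sigma> (nodes m) 0 k) k" if m: "m \<ge> 2 * k" for m
  proof -
    have km: "k \<le> m" using m by simp
    obtain c where c: "\<And>l. l \<le> m \<Longrightarrow> bern m k l = (\<Sum>j\<le>k. c j * hyp m (m - j) l)"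
      using bern_as_hyp[OF km] by blast
    have "bf m k s = (\<Sum>j\<le>k. c j * cdf m j s)" for s
    proof -
      have "bf m k s = (\<Sum>l\<le>m. (\<Sum>j\<le>k. c j * hyp m (m - j) l) * exp (- s * r l))"
        unfolding bf_def by (intro sum.cong refl) (simp add: c)
      also have "\<dots> = (\<Sum>j\<le>k. c j * cdf m j s)"
        unfolding cdf_def sum_distrib_left sum_distrib_right by (subst sum.swap) (simp add: mult_ac)
      finally show ?thesis .
    qed
    then have "\<bar>\<Sum>j\<le>k. c j * cdf m j s\<bar> \<le> 1" if "0 < s" "s \<le> \<sigma>" for s
      using bf_nonneg[OF km, of s] bf_le_1[OF km, of s] that by simp
    then have cb: "\<bar>c j\<bar> \<le> C" if "j \<le> k" for j using C(2)[OF km, of c j] that by blast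
    define q where "q = coeff (iden \<sigma> (nodes m) 0 k) k"
    define B where "B = (\<Sum>l\<le>m. bern m k l * (r l ^ k * exp (- \<sigma> * r l)))"
    have qB: "q * B = 1" unfolding q_def B_def by (rule bern_lead[OF km])
    have q: "q > 0" unfolding q_def by (rule iden_lead_nodes_pos[OF km])
    have "B = (\<Sum>l\<le>m. (\<Sum>j\<le>k. c j * hyp m (m - j) l) * (r l ^ k * exp (- \<sigma> * r l)))"
      unfolding B_def by (intro sum.cong refl) (simp add: c)
    also have "\<dots> = (\<Sum>j\<le>k. c j * ?M m j)"
      unfolding sum_distrib_left sum_distrib_right by (subst sum.swap) (simp add: mult_ac)
    also have "\<dots> \<le> (\<Sum>j\<le>k. \<bar>c j * ?M m j\<bar>)" by (intro sum_mono) simp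
    also have "\<dots> \<le> (\<Sum>j\<le>k. C * D j)"
      unfolding abs_mult using cb D m C(1) by (intro sum_mono mult_mono) auto
    finally have "B \<le> K" by (simp add: K_def)
    then have "1 \<le> q * K" using qB q by (metis mult_left_mono less_imp_le)
    then show ?thesis using K by (simp add: q_def divide_le_eq)
  qed
  then show ?thesis using K by (intro exI[of _ "1 / K"]) auto
qed

end

section \<open>Convergence of the control polygons\<close>

text \<open>For m = 0 the mesh is a \<open>Max\<close> over the empty set, so nonemptiness is asked
  only from m = 1 on.\<close>

lemma Max_tendsto_0I:
  fixes f :: "nat \<Rightarrow> nat \<Rightarrow> real"
  assumes "\<And>m. finite (I m)" "\<And>m. m \<ge> 1 \<Longrightarrow> I m \<noteq> {}" "\<And>m i. f m i \<ge> 0"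
    "\<And>\<epsilon>. \<epsilon> > 0 \<Longrightarrow> \<exists>M. \<forall>m\<ge>M. \<forall>i\<in>I m. f m i \<le> \<epsilon>"
  shows "(\<lambda>m. Max (f m ` I m)) \<longlonglongrightarrow> 0"
proof (rule LIMSEQ_I)
  fix \<epsilon> :: real assume "\<epsilon> > 0"
  then obtain M where M: "\<forall>m\<ge>M. \<forall>i\<in>I m. f m i \<le> \<epsilon> / 2" using assms(4)[of "\<epsilon> / 2"] by auto
  have "norm (Max (f m ` I m) - 0) < \<epsilon>" if m: "m \<ge> max M 1" for m
  proof -
    have "Max (f m ` I m) \<in> f m ` I m" using assms(1,2) m by (intro Max_in) auto
    then obtain i where i: "i \<in> I m" "Max (f m ` I m) = f m i" by blast
    then have "f m i \<le> \<epsilon> / 2" using M m by simp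
    then show ?thesis using i assms(3)[of m i] \<open>\<epsilon> > 0\<close> by simp
  qed
  then show "\<exists>M. \<forall>m\<ge>M. norm (Max (f m ` I m) - 0) < \<epsilon>" by blast
qed

context muntz_interval
begin

text \<open>Analogue of the Greville abscissae: the parameter at which t powr r 1 equals its own
  i-th control value.\<close>

lemma nodal_parameter:
  assumes "1 \<le> m"
  shows "b * cv m 0 1 powr (1 / r 1) = a" "b * cv m m 1 powr (1 / r 1) = b"
    "i < m \<Longrightarrow> b * cv m i 1 powr (1 / r 1) \<le> b * cv m (Suc i) 1 powr (1 / r 1)"
proof -
  have "exp (- \<sigma> * r 1) powr (1 / r 1) = exp (- \<sigma>)" using r_pos[of 1] by (simp add: powr_def)
  also have "\<dots> = a / b" using a_pos b_pos by (simp add: \<sigma>_def exp_minus)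
  finally show "b * cv m 0 1 powr (1 / r 1) = a" using assms b_pos by (simp add: cv_first)
  show "b * cv m m 1 powr (1 / r 1) = b" by (simp add: cv_last)
  assume "i < m"
  then show "b * cv m i 1 powr (1 / r 1) \<le> b * cv m (Suc i) 1 powr (1 / r 1)"
    using assms b_pos cv_less_Suc[of 1 m i] cv_pos[of 1 m i]
    by (intro mult_left_mono powr_mono2) auto
qed

lemma nodal_parameter_mesh:
  assumes "\<not> summable (\<lambda>i. 1 / r (Suc i))" "filterlim r at_top sequentially" "\<epsilon> > 0"
  shows "\<exists>M. \<forall>m\<ge>M. \<forall>i<m. \<bar>b * cv m (Suc i) 1 powr (1 / r 1) - b * cv m i 1 powr (1 / r 1)\<bar> \<le> \<epsilon>"
proof -
  define w where "w = exp (- \<sigma> * r 1)"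
  let ?g = "\<lambda>x. b * x powr (1 / r 1)"
  have w: "w > 0" by (simp add: w_def)
  then have "continuous_on {w..1} ?g" by (intro continuous_intros) auto
  then have "uniformly_continuous_on {w..1} ?g" by (intro compact_uniformly_continuous) auto
  then obtain \<delta> where \<delta>: "\<delta> > 0" "\<And>x y. x \<in> {w..1} \<Longrightarrow> y \<in> {w..1} \<Longrightarrow> dist y x < \<delta> \<Longrightarrow> dist (?g y) (?g x) < \<epsilon>"
    unfolding uniformly_continuous_on_def using assms(3) by metis
  obtain M where M: "\<And>m i. m \<ge> M \<Longrightarrow> i < m \<Longrightarrow> cv m (Suc i) 1 - cv m i 1 \<le> \<delta> / 2"
    using cv_gaps_limit[OF assms(1,2), of "\<delta> / 2"] \<delta>(1) by auto
  have "\<bar>?g (cv m (Suc i) 1) - ?g (cv m i 1)\<bar> \<le> \<epsilon>" if "m \<ge> max M 1" "i < m" for m i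
  proof -
    have "cv m i 1 \<in> {w..1}" "cv m (Suc i) 1 \<in> {w..1}"
      using cv_bounds[of 1 m i] cv_bounds[of 1 m "Suc i"] that by (auto simp: w_def)
    moreover have "dist (cv m (Suc i) 1) (cv m i 1) < \<delta>"
      using M[of m i] cv_less_Suc[of 1 m i] that \<delta>(1) by (simp add: dist_real_def)
    ultimately show ?thesis using \<delta>(2)[of "cv m i 1" "cv m (Suc i) 1"] by (simp add: dist_real_def)
  qed
  then show ?thesis by blast
qed

lemma ctrl_poly_converges:
  fixes P :: "real \<Rightarrow> real^'s" and A :: "nat \<Rightarrow> real^'s"
  assumes P: "\<And>t. t > 0 \<Longrightarrow> P t = (\<Sum>j\<le>n. t powr r j *\<^sub>R A j)" and n: "1 \<le> n"
    and ns: "\<not> summable (\<lambda>i. 1 / r (Suc i))" and lim: "filterlim r at_top sequentially"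
  shows "ctrl_poly_unif_conv r a b n P"
proof -
  define T where "T m i = b * cv m i 1 powr (1 / r 1)" for m i
  have dist_bound: "infnorm (P (T m i) - ctrl_pts r a b m P i)
     \<le> (\<Sum>j\<le>n. b powr r j * \<bar>cv m i 1 powr (r j / r 1) - cv m i j\<bar> * norm (A j))"
    if m: "m \<ge> n" "i \<le> m" for m i
  proof -
    have c: "cv m i 1 > 0" using m n by (intro cv_pos) auto
    have "T m i > 0" using c b_pos by (simp add: T_def)
    moreover have "T m i powr r j = b powr r j * cv m i 1 powr (r j / r 1)" for j
      using c b_pos by (simp add: T_def powr_mult powr_powr)
    ultimately have eq: "P (T m i) - ctrl_pts r a b m P i
      = (\<Sum>j\<le>n. (b powr r j * (cv m i 1 powr (r j / r 1) - cv m i j)) *\<^sub>R A j)"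
      using P ctrl_pts_eq[OF P m] by (simp add: sum_subtractf[symmetric] scaleR_diff_left[symmetric] right_diff_distrib)
    have "infnorm (P (T m i) - ctrl_pts r a b m P i) \<le> norm (P (T m i) - ctrl_pts r a b m P i)"
      by (rule infnorm_le_norm)
    also have "\<dots> \<le> (\<Sum>j\<le>n. b powr r j * \<bar>cv m i 1 powr (r j / r 1) - cv m i j\<bar> * norm (A j))"
      unfolding eq by (intro sum_norm_le) (simp add: abs_mult)
    finally show ?thesis .
  qed
  have "(\<lambda>m. Max ((\<lambda>i. \<bar>T m (Suc i) - T m i\<bar>) ` {..<m})) \<longlonglongrightarrow> 0"
  proof (rule Max_tendsto_0I[where I = "\<lambda>m. {..<m}"])
    fix \<epsilon> :: real assume "\<epsilon> > 0"
    then show "\<exists>M. \<forall>m\<ge>M. \<forall>i\<in>{..<m}. \<bar>T m (Suc i) - T m i\<bar> \<le> \<epsilon>"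
      using nodal_parameter_mesh[OF ns lim] unfolding T_def Ball_def lessThan_iff by blast
  qed (auto simp: lessThan_empty_iff)
  moreover have "(\<lambda>m. Max ((\<lambda>i. infnorm (P (T m i) - ctrl_pts r a b m P i)) ` {..m})) \<longlonglongrightarrow> 0"
  proof (rule Max_tendsto_0I[where I = "\<lambda>m. {..m}"])
    fix \<epsilon> :: real assume \<epsilon>: "\<epsilon> > 0"
    define K where "K = (\<Sum>j\<le>n. b powr r j * norm (A j)) + 1"
    have K: "K > 0" unfolding K_def by (intro add_nonneg_pos sum_nonneg) auto
    have "\<forall>j. \<exists>M. \<forall>m\<ge>M. \<forall>i\<le>m. \<bar>cv m i 1 powr (r j / r 1) - cv m i j\<bar> \<le> \<epsilon> / K"
      using cv_powr_limit[OF ns lim, of "\<epsilon> / K"] \<epsilon> K by auto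
    then obtain M where M: "\<And>j m i. m \<ge> M j \<Longrightarrow> i \<le> m \<Longrightarrow> \<bar>cv m i 1 powr (r j / r 1) - cv m i j\<bar> \<le> \<epsilon> / K"
      by metis
    have "infnorm (P (T m i) - ctrl_pts r a b m P i) \<le> \<epsilon>" if m: "m \<ge> max n (Max (M ` {..n}))" "i \<le> m" for m i
    proof -
      have Mj: "M j \<le> m" if "j \<le> n" for j
      proof -
        have "M j \<le> Max (M ` {..n})" using that by (intro Max_ge) auto
        also have "\<dots> \<le> m" using m(1) by linarith
        finally show ?thesis .
      qed
      have "infnorm (P (T m i) - ctrl_pts r a b m P i)
        \<le> (\<Sum>j\<le>n. b powr r j * \<bar>cv m i 1 powr (r j / r 1) - cv m i j\<bar> * norm (A j))"
        using m by (intro dist_bound) auto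
      also have "\<dots> \<le> (\<Sum>j\<le>n. b powr r j * (\<epsilon> / K) * norm (A j))"
        using M[OF Mj m(2)] by (intro sum_mono mult_right_mono mult_left_mono) auto
      also have "\<dots> = (\<epsilon> / K) * (K - 1)" by (simp add: K_def sum_distrib_left sum_divide_distrib mult_ac)
      also have "\<dots> \<le> (\<epsilon> / K) * K" using \<epsilon> K by (intro mult_left_mono) auto
      also have "\<dots> = \<epsilon>" using K by simp
      finally show ?thesis .
    qed
    then show "\<exists>M. \<forall>m\<ge>M. \<forall>i\<in>{..m}. infnorm (P (T m i) - ctrl_pts r a b m P i) \<le> \<epsilon>"
      unfolding Ball_def atMost_iff by blast
  qed (auto simp: infnorm_pos_le)
  moreover have "\<forall>m\<ge>n. T m 0 = a \<and> T m m = b \<and> (\<forall>i<m. T m i \<le> T m (Suc i))"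
    unfolding T_def using nodal_parameter n by auto
  moreover have "{g i |i. i < m} = g ` {..<m}" "{g i |i. i \<le> m} = g ` {..m}" for g :: "nat \<Rightarrow> real" and m
    by auto
  ultimately show ?thesis unfolding ctrl_poly_unif_conv_def by (intro exI[of _ T]) simp
qed

section \<open>Failure of convergence for summable reciprocals\<close>

lemma moment_nonzero:
  fixes A :: "nat \<Rightarrow> real^'s"
  assumes "\<And>l. l \<ge> 1 \<Longrightarrow> (\<Sum>j\<le>n. (a powr r j * r j ^ l) *\<^sub>R A j) = 0" "1 \<le> j" "j \<le> n"
  shows "A j = 0"
proof -
  have "A j $ s = 0" for s
  proof -
    \<comment> \<open>The factor r j shifts the moments of order at least 1 to all orders; it also
      erases index 0, as r 0 = 0, so the constant part stays undetermined.\<close>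
    have z: "(\<Sum>j\<le>n. (a powr r j * r j * A j $ s) * poly p (r j)) = 0" for p
    proof -
      have "(\<Sum>j\<le>n. (a powr r j * r j * A j $ s) * poly p (r j))
        = (\<Sum>i\<le>degree p. coeff p i * ((\<Sum>j\<le>n. (a powr r j * r j ^ Suc i) *\<^sub>R A j) $ s))"
        unfolding poly_altdef sum_distrib_left by (subst sum.swap) (simp add: sum_distrib_left mult_ac)
      also have "\<dots> = 0" using assms(1) by (intro sum.neutral) (simp del: power_Suc)
      finally show ?thesis .
    qed
    have "a powr r j * r j * A j $ s = 0"
      by (rule moments_zero_imp_zero[OF r_inj z assms(3)])
    then show ?thesis using a_pos r_pos[of j] assms(2) by simp
  qed
  then show ?thesis by (simp add: vec_eq_iff)
qed

text \<open>The l-th vector sum is (t d/dt)^l P at a. Read through the denominator q, the control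
  point is the combination of these with the coefficients of q; q has degree at most k and q(0) = 1,
  so only orders 0 and k survive.\<close>

lemma ctrl_pts_first_nonconstant:
  fixes P :: "real \<Rightarrow> real^'s" and A :: "nat \<Rightarrow> real^'s"
  assumes P: "\<And>t. t > 0 \<Longrightarrow> P t = (\<Sum>j\<le>n. t powr r j *\<^sub>R A j)" and "n \<le> m" "k \<le> m" "1 \<le> k"
    and V: "\<And>l. 1 \<le> l \<Longrightarrow> l < k \<Longrightarrow> (\<Sum>j\<le>n. (a powr r j * r j ^ l) *\<^sub>R A j) = 0"
  shows "ctrl_pts r a b m P k
    = P a + coeff (iden \<sigma> (nodes m) 0 k) k *\<^sub>R (\<Sum>j\<le>n. (a powr r j * r j ^ k) *\<^sub>R A j)"
proof -
  define V where "V l = (\<Sum>j\<le>n. (a powr r j * r j ^ l) *\<^sub>R A j)" for l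
  define q where "q = iden \<sigma> (nodes m) 0 k"
  have q: "coeffs_below (Suc k) q" using node_facts(2)[of k m] assms by (simp add: q_def)
  have q0: "coeff q 0 = 1"
    using node_facts(5)[of k m] assms by (simp add: q_def poly_0_coeff_0)
  have "ctrl_pts r a b m P k = (\<Sum>j\<le>n. (b powr r j * cv m k j) *\<^sub>R A j)"
    by (rule ctrl_pts_eq[OF P assms(2,3)])
  also have "\<dots> = (\<Sum>j\<le>n. (a powr r j * poly q (r j)) *\<^sub>R A j)"
    unfolding cv_def q_def using node_facts(3)[of k m] assms
    by (intro sum.cong refl) (auto simp: r_in_nodes a_powr mult_ac)
  also have "\<dots> = (\<Sum>i<Suc k. coeff q i *\<^sub>R V i)"
    unfolding coeffs_below_expand[OF q] V_def scaleR_sum_right sum_distrib_left scaleR_sum_left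
    by (subst sum.swap) (simp add: mult_ac)
  also have "\<dots> = (\<Sum>i\<in>{0, k}. coeff q i *\<^sub>R V i)"
    using V by (intro sum.mono_neutral_right) (auto simp: V_def)
  also have "\<dots> = V 0 + coeff q k *\<^sub>R V k" using assms(4) q0 by simp
  also have "V 0 = P a" using P[OF a_pos] by (simp add: V_def)
  finally show ?thesis by (simp add: V_def q_def)
qed

lemma ctrl_poly_diverges:
  fixes P :: "real \<Rightarrow> real^'s" and A :: "nat \<Rightarrow> real^'s"
  assumes P: "\<And>t. t > 0 \<Longrightarrow> P t = (\<Sum>j\<le>n. t powr r j *\<^sub>R A j)"
    and nonconst: "\<not> (\<exists>c. \<forall>t>0. P t = c)"
    and sm: "summable (\<lambda>i. 1 / r (Suc i))"
  shows "\<not> ctrl_poly_unif_conv r a b n P"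
proof
  assume "ctrl_poly_unif_conv r a b n P"
  then obtain T where T: "\<And>m. m \<ge> n \<Longrightarrow> T m 0 = a"
    "(\<lambda>m. Max {\<bar>T m (Suc i) - T m i\<bar> | i. i < m}) \<longlonglongrightarrow> 0"
    "(\<lambda>m. Max {infnorm (P (T m i) - ctrl_pts r a b m P i) | i. i \<le> m}) \<longlonglongrightarrow> 0"
    unfolding ctrl_poly_unif_conv_def by blast
  define V where "V l = (\<Sum>j\<le>n. (a powr r j * r j ^ l) *\<^sub>R A j)" for l
  have "\<exists>l\<ge>1. V l \<noteq> 0"
  proof (rule ccontr)
    assume "\<not> ?thesis"
    then have "A j = 0" if "1 \<le> j" "j \<le> n" for j
      using moment_nonzero[where n = n and A = A and j = j] that by (auto simp: V_def)
    then have "(\<Sum>j\<le>n. t powr r j *\<^sub>R A j) = (\<Sum>j\<in>{0}. t powr r j *\<^sub>R A j)" for t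
      by (intro sum.mono_neutral_right) auto
    then have "P t = A 0" if "t > 0" for t using P[OF that] that by (simp add: r0)
    with nonconst show False by blast
  qed
  define k where "k = (LEAST l. l \<ge> 1 \<and> V l \<noteq> 0)"
  have k: "k \<ge> 1" "V k \<noteq> 0" using LeastI_ex[OF \<open>\<exists>l\<ge>1. V l \<noteq> 0\<close>] by (auto simp: k_def)
  have V0: "V l = 0" if "1 \<le> l" "l < k" for l
    using not_less_Least[of l "\<lambda>l. l \<ge> 1 \<and> V l \<noteq> 0"] that by (auto simp: k_def)
  obtain \<delta> where \<delta>: "\<delta> > 0" "\<And>m. m \<ge> 2 * k \<Longrightarrow> \<delta> \<le> coeff (iden \<sigma> (nodes m) 0 k) k"
    using iden_lead_lower_bound[OF sm, of k] by blast
  define mesh where "mesh m = Max {\<bar>T m (Suc i) - T m i\<bar> | i. i < m}" for m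
  define err where "err m = Max {infnorm (P (T m i) - ctrl_pts r a b m P i) | i. i \<le> m}" for m
  have close: "\<bar>T m i - a\<bar> \<le> real i * mesh m" if "m \<ge> n" "i \<le> m" for m i
    using that(2)
  proof (induction i)
    case 0
    then show ?case using T(1)[OF that(1)] by simp
  next
    case (Suc i)
    have "\<bar>T m (Suc i) - T m i\<bar> \<le> mesh m" unfolding mesh_def
      by (rule Max_ge) (use Suc.prems in auto)
    then show ?case using Suc by (simp add: algebra_simps)
  qed
  have Tk: "(\<lambda>m. T m k) \<longlonglongrightarrow> a"
  proof (rule LIM_zero_cancel, rule tendsto_rabs_zero_cancel, rule tendsto_sandwich[OF _ _ tendsto_const])
    show "(\<lambda>m. real k * mesh m) \<longlonglongrightarrow> 0" using tendsto_mult_left[OF T(2), of "real k"] by (simp add: mesh_def)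
    show "\<forall>\<^sub>F m in sequentially. \<bar>T m k - a\<bar> \<le> real k * mesh m"
      using close by (intro eventually_sequentiallyI[of "max n k"]) auto
  qed simp
  \<comment> \<open>P is given by the sum only for t > 0, so continuity is taken from the sum and
    transferred once T m k is positive.\<close>
  have "(\<lambda>m. \<Sum>j\<le>n. T m k powr r j *\<^sub>R A j) \<longlonglongrightarrow> (\<Sum>j\<le>n. a powr r j *\<^sub>R A j)"
    using a_pos by (intro tendsto_intros Tk) auto
  moreover have "\<forall>\<^sub>F m in sequentially. (\<Sum>j\<le>n. T m k powr r j *\<^sub>R A j) = P (T m k)"
    using order_tendstoD(1)[OF Tk a_pos] by eventually_elim (simp add: P)
  ultimately have PT: "(\<lambda>m. P (T m k)) \<longlonglongrightarrow> P a"
    using P[OF a_pos] by (simp add: tendsto_cong)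
  have "(\<lambda>m. P (T m k) - ctrl_pts r a b m P k) \<longlonglongrightarrow> 0"
  proof (rule Lim_null_comparison)
    show "\<forall>\<^sub>F m in sequentially. norm (P (T m k) - ctrl_pts r a b m P k) \<le> sqrt DIM(real^'s) * err m"
    proof (rule eventually_sequentiallyI[of k])
      fix m assume m: "k \<le> m"
      have "norm (P (T m k) - ctrl_pts r a b m P k) \<le> sqrt DIM(real^'s) * infnorm (P (T m k) - ctrl_pts r a b m P k)"
        by (rule norm_le_infnorm)
      also have "infnorm (P (T m k) - ctrl_pts r a b m P k) \<le> err m"
        unfolding err_def by (rule Max_ge) (use m in auto)
      finally show "norm (P (T m k) - ctrl_pts r a b m P k) \<le> sqrt DIM(real^'s) * err m"
        by (simp add: mult_left_mono)
    qed
    show "(\<lambda>m. sqrt DIM(real^'s) * err m) \<longlonglongrightarrow> 0"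
      using tendsto_mult_left[OF T(3)] by (simp add: err_def)
  qed
  from tendsto_diff[OF PT this] have "(\<lambda>m. ctrl_pts r a b m P k - P a) \<longlonglongrightarrow> 0"
    by (simp add: LIM_zero)
  then have "\<forall>\<^sub>F m in sequentially. norm (ctrl_pts r a b m P k - P a) < \<delta> * norm (V k)"
    using \<delta>(1) k(2) order_tendstoD(2)[OF tendsto_norm_zero] by fastforce
  then obtain M where M: "\<And>m. m \<ge> M \<Longrightarrow> norm (ctrl_pts r a b m P k - P a) < \<delta> * norm (V k)"
    by (auto simp: eventually_sequentially)
  define m where "m = max M (max n (2 * k))"
  have "ctrl_pts r a b m P k = P a + coeff (iden \<sigma> (nodes m) 0 k) k *\<^sub>R V k"
    unfolding V_def using V0 k(1)
    by (intro ctrl_pts_first_nonconstant[OF P]) (auto simp: m_def V_def)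
  then have "norm (ctrl_pts r a b m P k - P a) = \<bar>coeff (iden \<sigma> (nodes m) 0 k) k\<bar> * norm (V k)"
    by simp
  moreover have "\<delta> \<le> \<bar>coeff (iden \<sigma> (nodes m) 0 k) k\<bar>"
  proof -
    have "m \<ge> 2 * k" by (simp add: m_def)
    from \<delta>(2)[OF this] show ?thesis by linarith
  qed
  then have "\<delta> * norm (V k) \<le> \<bar>coeff (iden \<sigma> (nodes m) 0 k) k\<bar> * norm (V k)"
    by (rule mult_right_mono) simp
  moreover have "norm (ctrl_pts r a b m P k - P a) < \<delta> * norm (V k)"
    by (rule M) (simp add: m_def)
  ultimately show False by linarith
qed

end

theorem theorem1:
  fixes r :: "nat \<Rightarrow> real" and a b :: real and n :: nat and P :: "real \<Rightarrow> real^'s"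
  assumes "r 0 = 0" and "strict_mono r" and "filterlim r at_top sequentially"
    and "0 < a" and "a < b" and "n \<ge> 1"
    and "inEv r n P" and "\<not> (\<exists>c. \<forall>t>0. P t = c)"
  shows "ctrl_poly_unif_conv r a b n P \<longleftrightarrow> \<not> summable (\<lambda>i. 1 / r (Suc i))"
proof -
  interpret muntz_interval r a b
    using assms by unfold_locales
  obtain A where P: "\<And>t. t > 0 \<Longrightarrow> P t = (\<Sum>k\<le>n. t powr r k *\<^sub>R A k)"
    using assms(7) unfolding inEv_def by blast
  show ?thesis
    using ctrl_poly_converges[OF P assms(6) _ assms(3)] ctrl_poly_diverges[OF P assms(8)] by blast
qed

end
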